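(* Let $\{x\mapsto G(\lambda,x)\}_{\lambda\in I}$ be a best approximation family, with best approximations $K(\lambda,z)$, and let $\nu$ be a non-negative Borel measure on $I$ satisfying $$\int_I\int_{-\infty}^{\infty}|G(\lambda,x)-K(\lambda,x)|\,dx\,d\nu(\lambda)<\infty.$$ Let $g:\mathbb{R}\to\mathbb{R}$ be a function defining a tempered distribution that is continuous on $\mathbb{R}\setminus\{0\}$ and such that $$\widehat{g}(\varphi)=\int_{-\infty}^{\infty}\Bigl\{\int_I\widehat{G}(\lambda,t)\,d\nu(\lambda)\Bigr\}\varphi(t)\,dt$$ for all Schwartz functions $\varphi$ supported on $[-\frac12,\frac12]^c$. Then there exists a unique best approximation $k(z)$ of exponential type $\pi$ for $g(x)$. The function $k(x)$ interpolates the values of $g(x)$ at $\mathbb{Z}+\frac12$, satisfying $$\mathrm{sgn}(\cos\pi x)\,\{g(x)-k(x)\}\ge0$$ and $$\int_{-\infty}^{\infty}|g(x)-k(x)|\,dx=\int_I\int_{-\infty}^{\infty}|G(\lambda,x)-K(\lambda,x)|\,dx\,d\nu(\lambda).$$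
   Context: An entire function $F$ is of exponential type (at most) $\pi$ if for every $\epsilon>0$ there is $C>0$ with $|F(z)|\le Ce^{(\pi+\epsilon)|z|}$ for all $z\in\mathbb{C}$. A best approximation of exponential type $\pi$ for $f:\mathbb{R}\to\mathbb{R}$ is an entire function $F$ of exponential type at most $\pi$ that minimizes $\int_{-\infty}^\infty|F(x)-f(x)|\,dx$ among all such functions. Fourier transform: $\widehat{\varphi}(y)=\int_{-\infty}^\infty\varphi(x)e^{-2\pi i xy}\,dx$. A function $g$ defines a tempered distribution by $g(\varphi)=\int_{-\infty}^\infty g(x)\varphi(x)\,dx$ for Schwartz $\varphi$, and $\widehat{g}(\varphi)=g(\widehat\varphi)$. Write $[-\frac12,\frac12]^c=(-\infty,-\frac12)\cup(\frac12,\infty)$. Pointwise inequalities are for all real $x$. Let $I\subset\mathbb{R}$ be an interval. A family of real valued even functions $x\mapsto G(\lambda,x)$, $\lambda\in I$, is a best approximation family if for each $\lambda\in I$: (i) $x\mapsto G(\lambda,x)$ is continuous on $\mathbb{R}$ and differentiable on $\mathbb{R}\setminus\{0\}$; (ii) there are constants $C=C(\lambda)>0$, $\epsilon=\epsilon(\lambda)>0$ with $|G(\lambda,x)|\le C(1+|x|)^{-1-\epsilon}$ and $|\widehat{G}(\lambda,t)|\le C(1+|t|)^{-1-\epsilon}$ for all $x,t\in\mathbb{R}$, where $\widehat G(\lambda,\cdot)$ is the Fourier transform in $x$; (iii) $t\mapsto\widehat{G}(\lambda,t)$ is non-negative and radially non-increasing; (iv) there is a unique best approximation $z\mapsto K(\lambda,z)$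 of exponential type $\pi$ for $G(\lambda,\cdot)$ that interpolates the values of $G(\lambda,x)$ at $\mathbb{Z}+\frac12$ and satisfies $\mathrm{sgn}(\cos\pi x)\{G(\lambda,x)-K(\lambda,x)\}\ge0$.
   Formalization: The sign inequality is asserted for all x ≠ 0, and at x = 0 only if g is continuous there; as stated it fails at 0, since g(0) is arbitrary (ν = 0, g = 0 off 0, g(0) = -1 has k = 0). *)

theory Defs
  imports "HOL-Analysis.Analysis"
begin

subsection \<open>Exponential type and best approximation\<close>

definition exponential_type :: "real \<Rightarrow> (complex \<Rightarrow> complex) \<Rightarrow> bool" where
  "exponential_type \<tau> F \<longleftrightarrow>
     F holomorphic_on UNIV \<and>
     (\<forall>\<epsilon>>0. \<exists>C>0. \<forall>z. cmod (F z) \<le> C * exp ((\<tau> + \<epsilon>) * cmod z))"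

definition L1_dist :: "(real \<Rightarrow> real) \<Rightarrow> (complex \<Rightarrow> complex) \<Rightarrow> ennreal" where
  "L1_dist f F = (\<integral>\<^sup>+x. ennreal (cmod (F (of_real x) - of_real (f x))) \<partial>lborel)"

text \<open>The distance may be infinite. If it is infinite for every competitor then every competitor
  is a minimizer, so the existence of a unique best approximation entails a finite minimum.\<close>

definition best_approximation :: "(real \<Rightarrow> real) \<Rightarrow> (complex \<Rightarrow> complex) \<Rightarrow> bool" where
  "best_approximation f F \<longleftrightarrow>
     exponential_type pi F \<and>
     (\<forall>H. exponential_type pi H \<longrightarrow> L1_dist f F \<le> L1_dist f H)"

definition interpolates :: "(real \<Rightarrow> real) \<Rightarrow> (complex \<Rightarrow> complex) \<Rightarrow> bool" where
  "interpolates f F \<longleftrightarrow>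
     (\<forall>n::int. F (of_real (of_int n + 1/2)) = of_real (f (of_int n + 1/2)))"

text \<open>An entire function is a priori complex valued on the real line, so the inequality
  \<open>sgn (cos \<pi>x) (f x - F x) \<ge> 0\<close> includes the assertion that \<open>F x\<close> is real.
  It is a pointwise notion: for \<open>g\<close> continuous only on \<open>\<real> - {0}\<close> the value \<open>g 0\<close> is arbitrary, and
  the inequality can be expected at \<open>0\<close> only if \<open>g\<close> is continuous there.\<close>

definition sign_condition_at :: "(real \<Rightarrow> real) \<Rightarrow> (complex \<Rightarrow> complex) \<Rightarrow> real \<Rightarrow> bool" where
  "sign_condition_at f F x \<longleftrightarrow>
     F (of_real x) \<in> \<real> \<and> sgn (cos (pi * x)) * (f x - Re (F (of_real x))) \<ge> 0"

subsection \<open>Fourier transform and tempered distributions\<close>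

definition fourier :: "(real \<Rightarrow> complex) \<Rightarrow> real \<Rightarrow> complex" where
  "fourier \<phi> y = (\<integral>x. \<phi> x * exp (- 2 * of_real pi * \<i> * of_real x * of_real y) \<partial>lborel)"

definition nth_derivative :: "nat \<Rightarrow> (real \<Rightarrow> complex) \<Rightarrow> real \<Rightarrow> complex" where
  "nth_derivative n \<phi> = ((\<lambda>h x. vector_derivative h (at x)) ^^ n) \<phi>"

definition schwartz :: "(real \<Rightarrow> complex) \<Rightarrow> bool" where
  "schwartz \<phi> \<longleftrightarrow>
     (\<forall>n x. nth_derivative n \<phi> differentiable (at x)) \<and>
     (\<forall>m n. \<exists>C. \<forall>x. \<bar>x\<bar> ^ m * cmod (nth_derivative n \<phi> x) \<le> C)"

definition schwartz_seminorm :: "nat \<Rightarrow> nat \<Rightarrow> (real \<Rightarrow> complex) \<Rightarrow> real" where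
  "schwartz_seminorm m n \<phi> = (SUP x. \<bar>x\<bar> ^ m * cmod (nth_derivative n \<phi> x))"

text \<open>Continuity of a linear functional on the Schwartz space is expressed by domination
  by finitely many of the defining seminorms. Nothing is required of \<open>T\<close> outside the
  Schwartz space.\<close>

definition tempered_distribution :: "((real \<Rightarrow> complex) \<Rightarrow> complex) \<Rightarrow> bool" where
  "tempered_distribution T \<longleftrightarrow>
     (\<forall>\<phi> \<psi>. schwartz \<phi> \<longrightarrow> schwartz \<psi> \<longrightarrow> T (\<lambda>x. \<phi> x + \<psi> x) = T \<phi> + T \<psi>) \<and>
     (\<forall>c \<phi>. schwartz \<phi> \<longrightarrow> T (\<lambda>x. c * \<phi> x) = c * T \<phi>) \<and>
     (\<exists>C N. \<forall>\<phi>. schwartz \<phi> \<longrightarrow>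
        cmod (T \<phi>) \<le> C * (\<Sum>m\<le>N. \<Sum>n\<le>N. schwartz_seminorm m n \<phi>))"

definition distribution_of :: "(real \<Rightarrow> real) \<Rightarrow> (real \<Rightarrow> complex) \<Rightarrow> complex" where
  "distribution_of g \<phi> = (\<integral>x. of_real (g x) * \<phi> x \<partial>lborel)"

definition defines_tempered_distribution :: "(real \<Rightarrow> real) \<Rightarrow> bool" where
  "defines_tempered_distribution g \<longleftrightarrow>
     (\<forall>\<phi>. schwartz \<phi> \<longrightarrow> integrable lborel (\<lambda>x. of_real (g x) * \<phi> x)) \<and>
     tempered_distribution (distribution_of g)"

definition fourier_distribution ::
    "((real \<Rightarrow> complex) \<Rightarrow> complex) \<Rightarrow> (real \<Rightarrow> complex) \<Rightarrow> complex" where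
  "fourier_distribution T \<phi> = T (fourier \<phi>)"

definition support :: "(real \<Rightarrow> complex) \<Rightarrow> real set" where
  "support \<phi> = closure {t. \<phi> t \<noteq> 0}"

subsection \<open>Best approximation families\<close>

definition family_approximation :: "(real \<Rightarrow> real) \<Rightarrow> (complex \<Rightarrow> complex) \<Rightarrow> bool" where
  "family_approximation f F \<longleftrightarrow>
     best_approximation f F \<and> interpolates f F \<and> (\<forall>x. sign_condition_at f F x)"

definition fourier_family :: "(real \<Rightarrow> real \<Rightarrow> real) \<Rightarrow> real \<Rightarrow> real \<Rightarrow> complex" where
  "fourier_family G l t = fourier (\<lambda>x. of_real (G l x)) t"

definition best_approximation_family :: "real set \<Rightarrow> (real \<Rightarrow> real \<Rightarrow> real) \<Rightarrow> bool" where
  "best_approximation_family I G \<longleftrightarrow>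
     is_interval I \<and>
     (\<forall>l\<in>I.
        (\<forall>x. G l (- x) = G l x) \<and>
        continuous_on UNIV (G l) \<and>
        (\<forall>x. x \<noteq> 0 \<longrightarrow> G l differentiable (at x)) \<and>
        (\<exists>C>0. \<exists>\<epsilon>>0.
           (\<forall>x. \<bar>G l x\<bar> \<le> C * (1 + \<bar>x\<bar>) powr (- 1 - \<epsilon>)) \<and>
           (\<forall>t. cmod (fourier_family G l t) \<le> C * (1 + \<bar>t\<bar>) powr (- 1 - \<epsilon>))) \<and>
        (\<forall>t. fourier_family G l t \<in> \<real> \<and> Re (fourier_family G l t) \<ge> 0) \<and>
        (\<forall>s t. \<bar>s\<bar> \<le> \<bar>t\<bar> \<longrightarrow> Re (fourier_family G l t) \<le> Re (fourier_family G l s)) \<and>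
        (\<exists>!F. family_approximation (G l) F))"

end

theory Submission
  imports Defs "HOL-Probability.Probability" "HOL-Complex_Analysis.Complex_Analysis"
    "HOL-Real_Asymp.Real_Asymp"
begin

text \<open>Write \<open>s x = sgn (cos (pi x))\<close>. The proof has two independent halves: a lower bound for the distance
of \<open>g\<close> to functions of exponential type \<open>pi\<close>, valid once one competitor leaves a remainder with the sign
of \<open>s\<close>, and the construction of such a competitor.

\<^bold>\<open>Optimality.\<close> An integrable function \<open>w\<close> of exponential type \<open>pi\<close> has a Fourier transform supported in
\<open>[-1/2, 1/2]\<close> (theorem \<open>fourier_exponential_type_eq_0\<close>), while the Fourier series of \<open>s\<close> only contains the
frequencies \<open>n/2\<close>, \<open>n\<close> odd. Hence \<open>w\<close> integrates to \<open>0\<close> against \<open>s\<close> (theorem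
\<open>integral_sgn_cos_eq_0\<close>). If \<open>g - k = p\<close> almost everywhere with \<open>s p \<ge> 0\<close>, then for every competitor \<open>H\<close>
the integral of \<open>(g - H) s\<close> equals that of \<open>(g - k) s = |p|\<close>, so \<open>k\<close> is optimal. In the case of equality
\<open>(g - H) s = |g - H|\<close> almost everywhere; since \<open>s\<close> changes sign at every half-integer, \<open>H\<close> interpolates
\<open>g\<close> there, and so does \<open>k\<close>. A function of type \<open>pi\<close> that is integrable and vanishes at the half-integers is
\<open>0\<close> (theorem \<open>exponential_type_determined_at_half_integers\<close>), which gives \<open>H = k\<close>. This is the locale
\<open>signed_remainder\<close>.

\<^bold>\<open>Construction.\<close> The remainder \<open>p\<close> is the superposition of the errors
\<open>D l x = G l x - K l x\<close>, that is \<open>p x = \<integral> D l x d\<nu>(l)\<close>. It inherits the sign of \<open>s\<close>, its norm is the sum of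
the norms of the errors by Fubini's theorem, and as \<open>K l\<close> has no frequencies outside \<open>[-1/2, 1/2]\<close>,
the Fourier transforms of \<open>p\<close> and \<open>g\<close> agree there. Two points need an argument.

First, Fubini's theorem requires \<open>D\<close> to be jointly measurable, but measurability in \<open>l\<close> is only known for
the Fourier transforms of the \<open>G l\<close> at frequencies \<open>|t| > 1/2\<close>. These determine \<open>D\<close>: as \<open>D l\<close> vanishes
at the half-integers, Poisson summation says that the alternating periodization of its transform is
\<open>0\<close>, which expresses the transform on \<open>|t| < 1/2\<close> as a series in its values on \<open>|t| > 1/2\<close> (theorem
\<open>alternating_periodization_eq_0\<close>). Fourier inversion then gives \<open>D\<close>. The measure \<open>\<nu>\<close> may fail to be
\<open>\<sigma>\<close>-finite; this is repaired by passing to the finite measure with density \<open>\<integral>|D l x| dx\<close> relative to \<open>\<nu>\<close> and dividing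
\<open>D l\<close> by its norm.

Secondly, \<open>g - p\<close> is a tempered function whose spectrum lies in \<open>[-1/2, 1/2]\<close>, and it must be shown to be
entire of exponential type \<open>pi\<close> (locale \<open>spectrally_supported\<close>). Let \<open>b\<close> be the transform of a bump function
supported in \<open>[-\<delta>, \<delta>]\<close>. Multiplied by the translate of \<open>b\<close> by \<open>a\<close>, the function \<open>g - p\<close> becomes integrable with
spectrum in \<open>[-1/2 - \<delta>, 1/2 + \<delta>]\<close>, hence entire by Fourier inversion. Dividing by the translate of \<open>b\<close> again and
varying \<open>a\<close> one obtains an entire function, and choosing \<open>a\<close> as the real part of the argument gives its
growth: on the imaginary axis \<open>b\<close> is at least a multiple of \<open>exp (- 2 pi \<delta> |y|)\<close>, and the dependence on \<open>a\<close> is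
polynomial because \<open>g\<close> is tempered.\<close>

section \<open>Integrals over the real line\<close>

lemma borel_measurable_cis [measurable (raw)]:
  "f \<in> borel_measurable M \<Longrightarrow> (\<lambda>x. cis (f x)) \<in> borel_measurable M"
  unfolding cis_conv_exp by measurable

lemma integrable_mult_cis:
  assumes "integrable M f" "g \<in> borel_measurable M"
  shows "integrable M (\<lambda>x. f x * cis (g x))"
  by (rule Bochner_Integration.integrable_bound[OF assms(1)]) (use assms in \<open>auto simp: norm_mult\<close>)

lemma integrable_of_real_mult_cis:
  "integrable lborel (u :: real \<Rightarrow> real) \<Longrightarrow> integrable lborel (\<lambda>x. of_real (u x) * cis (t * x))"
  by (intro integrable_mult_cis integrable_of_real) auto

text \<open>The integrability behind Fubini's theorem for double integrals of Fourier type, where \<open>c\<close> is unimodular.\<close>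

lemma integrable_tensor_bounded:
  fixes f g :: "real \<Rightarrow> complex"
  assumes f: "integrable lborel f" and g: "integrable lborel g"
    and c [measurable]: "c \<in> borel_measurable (lborel \<Otimes>\<^sub>M lborel)"
    and bound: "\<And>p. cmod (c p) \<le> C"
  shows "integrable (lborel \<Otimes>\<^sub>M lborel) (\<lambda>(x, y). f x * g y * c (x, y))"
proof (rule Bochner_Integration.integrable_bound)
  note [measurable] = borel_measurable_integrable[OF f] borel_measurable_integrable[OF g]
  show "integrable (lborel \<Otimes>\<^sub>M lborel) (\<lambda>(x, y). f x * g y * of_real C)"
  proof (rule lborel_pair.Fubini_integrable)
    show "AE x in lborel. integrable lborel (\<lambda>y. case (x, y) of (x, y) \<Rightarrow> f x * g y * complex_of_real C)"
      using g by auto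
    have "integrable lborel (\<lambda>x. cmod (f x) * (\<integral>y. cmod (g y) \<partial>lborel) * \<bar>C\<bar>)"
      using f by auto
    then show "integrable lborel (\<lambda>x. \<integral>y. cmod (case (x, y) of (x, y) \<Rightarrow> f x * g y * complex_of_real C) \<partial>lborel)"
      by (simp add: norm_mult)
  qed measurable
  show "(\<lambda>(x, y). f x * g y * c (x, y)) \<in> borel_measurable (lborel \<Otimes>\<^sub>M lborel)"
    by measurable
  show "AE p in lborel \<Otimes>\<^sub>M lborel. norm (case p of (x, y) \<Rightarrow> f x * g y * c (x, y))
      \<le> norm (case p of (x, y) \<Rightarrow> f x * g y * complex_of_real C)"
    using order_trans[OF bound abs_ge_self]
    by (intro AE_I2) (auto simp: norm_mult split_beta intro!: mult_left_mono)
qed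

text \<open>The positive and the negative part are densities of two finite measures that agree on the generating
  half-lines, so they coincide.\<close>

lemma AE_zero_if_zero_half_line_integrals:
  fixes h :: "real \<Rightarrow> real"
  assumes h: "integrable lborel h" and zero: "\<And>x. (\<integral>y. indicator {x<..} y * h y \<partial>lborel) = 0"
  shows "AE x in lborel. h x = 0"
proof -
  note [measurable] = borel_measurable_integrable[OF h]
  let ?p = "\<lambda>x. max 0 (h x)" and ?n = "\<lambda>x. max 0 (- h x)"
  have ip: "integrable lborel ?p" and "in": "integrable lborel ?n"
    using h by auto
  have ip': "integrable lborel (\<lambda>y. indicator {x<..} y * ?p y)"
    and in': "integrable lborel (\<lambda>y. indicator {x<..} y * ?n y)" for x
    using integrable_mult_indicator[OF _ ip, of "{x<..}"] integrable_mult_indicator[OF _ "in", of "{x<..}"]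
    by auto
  have ep: "emeasure (density lborel ?p) {x<..} = ennreal (\<integral>y. indicator {x<..} y * ?p y \<partial>lborel)" for x
    by (subst emeasure_density, simp, simp, subst nn_integral_eq_integral[symmetric], rule ip')
       (auto intro!: nn_integral_cong split: split_indicator)
  have en: "emeasure (density lborel ?n) {x<..} = ennreal (\<integral>y. indicator {x<..} y * ?n y \<partial>lborel)" for x
    by (subst emeasure_density, simp, simp, subst nn_integral_eq_integral[symmetric], rule in')
       (auto intro!: nn_integral_cong split: split_indicator)
  have "(\<integral>y. indicator {x<..} y * ?p y \<partial>lborel) = (\<integral>y. indicator {x<..} y * ?n y \<partial>lborel)" for x
  proof -
    have "(\<integral>y. indicator {x<..} y * ?p y \<partial>lborel) - (\<integral>y. indicator {x<..} y * ?n y \<partial>lborel)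
        = (\<integral>y. indicator {x<..} y * ?p y - indicator {x<..} y * ?n y \<partial>lborel)"
      by (rule Bochner_Integration.integral_diff[symmetric, OF ip' in'])
    also have "\<dots> = (\<integral>y. indicator {x<..} y * h y \<partial>lborel)"
      by (intro Bochner_Integration.integral_cong) (auto simp: max_def)
    finally show ?thesis using zero by simp
  qed
  then have "density lborel ?p = density lborel ?n"
    by (intro measure_eqI_lessThan) (simp_all only: ep en, auto)
  then have "AE x in lborel. ennreal (?p x) = ennreal (?n x)"
    by (intro sigma_finite_measure.density_unique[OF sigma_finite_lborel]) auto
  then show ?thesis
    by eventually_elim (auto simp: max_def split: if_splits)
qed

lemma AE_zero_if_zero_interval_integrals:
  fixes d :: "real \<Rightarrow> complex"
  assumes int: "\<And>a b. a \<le> b \<Longrightarrow> integrable lborel (\<lambda>x. indicator {a<..b} x * d x)"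
    and zero: "\<And>a b. a \<le> b \<Longrightarrow> (\<integral>x. indicator {a<..b} x * d x \<partial>lborel) = 0"
  shows "AE x in lborel. d x = 0"
proof -
  have int0: "integrable lborel (\<lambda>x. indicator {- real n<..real n} x * d x)" for n
    by (rule int) simp
  have "AE x in lborel. indicator {- real n<..real n} x * d x = 0" for n
  proof -
    let ?J = "{- real n<..real n}"
    have z: "(\<integral>y. indicator {x<..} y * (indicator ?J y * d y) \<partial>lborel) = 0" for x
    proof -
      let ?K = "{max x (- real n)<..max (real n) (max x (- real n))}"
      have 1: "indicator {x<..} y * (indicator ?J y * d y) = indicator ?K y * d y" if "x < real n" for y
        using that by (auto split: split_indicator)
      have 2: "indicator {x<..} y * (indicator ?J y * d y) = 0" if "\<not> x < real n" for y
        using that by (auto split: split_indicator)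
      show ?thesis
      proof (cases "x < real n")
        case True
        show ?thesis unfolding 1[OF True] by (rule zero) simp
      next
        case False
        show ?thesis unfolding 2[OF False] by simp
      qed
    qed
    have i: "integrable lborel (\<lambda>y. indicator {x<..} y * (indicator ?J y * d y))" for x
      using integrable_mult_indicator[OF _ int0[of n], of "{x<..}"]
      by (simp add: scaleR_conv_of_real of_real_indicator)
    have "AE x in lborel. Re (indicator ?J x * d x) = 0"
    proof (rule AE_zero_if_zero_half_line_integrals)
      show "integrable lborel (\<lambda>x. Re (indicator ?J x * d x))" using int0 by (rule integrable_Re)
      fix x
      have "(\<integral>y. indicator {x<..} y * Re (indicator ?J y * d y) \<partial>lborel)
          = (\<integral>y. Re (indicator {x<..} y * (indicator ?J y * d y)) \<partial>lborel)"
        by (intro Bochner_Integration.integral_cong) (auto split: split_indicator)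
      also have "\<dots> = Re (\<integral>y. indicator {x<..} y * (indicator ?J y * d y) \<partial>lborel)"
        by (rule integral_Re[OF i])
      finally show "(\<integral>y. indicator {x<..} y * Re (indicator ?J y * d y) \<partial>lborel) = 0" by (simp add: z)
    qed
    moreover have "AE x in lborel. Im (indicator ?J x * d x) = 0"
    proof (rule AE_zero_if_zero_half_line_integrals)
      show "integrable lborel (\<lambda>x. Im (indicator ?J x * d x))" using int0 by (rule integrable_Im)
      fix x
      have "(\<integral>y. indicator {x<..} y * Im (indicator ?J y * d y) \<partial>lborel)
          = (\<integral>y. Im (indicator {x<..} y * (indicator ?J y * d y)) \<partial>lborel)"
        by (intro Bochner_Integration.integral_cong) (auto split: split_indicator)
      also have "\<dots> = Im (\<integral>y. indicator {x<..} y * (indicator ?J y * d y) \<partial>lborel)"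
        by (rule integral_Im[OF i])
      finally show "(\<integral>y. indicator {x<..} y * Im (indicator ?J y * d y) \<partial>lborel) = 0" by (simp add: z)
    qed
    ultimately show ?thesis
      by eventually_elim (simp add: complex_eq_iff)
  qed
  then have "AE x in lborel. \<forall>n. indicator {- real n<..real n} x * d x = 0"
    unfolding AE_all_countable by blast
  then show ?thesis
  proof eventually_elim
    case (elim x)
    obtain n where "\<bar>x\<bar> < real n" using reals_Archimedean2 by blast
    then show ?case using elim[rule_format, of n] by (auto simp: indicator_def split: if_splits)
  qed
qed

text \<open>This turns statements that hold almost everywhere into pointwise ones for continuous functions.\<close>

lemma AE_lborel_dense:
  assumes "AE x in lborel. P x" "(a::real) < b"
  shows "\<exists>x. a < x \<and> x < b \<and> P x"
proof (rule ccontr)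
  assume "\<not> ?thesis"
  then have "{a<..<b} \<subseteq> {x \<in> space lborel. \<not> P x}" by auto
  moreover obtain N where "{x \<in> space lborel. \<not> P x} \<subseteq> N" "emeasure lborel N = 0" "N \<in> sets lborel"
    using assms(1) by (rule AE_E)
  ultimately have "emeasure lborel {a<..<b} \<le> 0"
    using emeasure_mono[of "{a<..<b}" N lborel] by auto
  then show False using assms(2) by (simp add: ennreal_eq_0_iff)
qed

lemma continuous_AE_eq:
  fixes f g :: "real \<Rightarrow> complex"
  assumes "continuous_on UNIV f" "continuous_on UNIV g" "AE x in lborel. f x = g x"
  shows "f x = g x"
proof (rule ccontr)
  assume ne: "f x \<noteq> g x"
  have "open {x. f x \<noteq> g x}"
    using open_Collect_neq[OF assms(1,2)] .
  then obtain e where "0 < e" "ball x e \<subseteq> {x. f x \<noteq> g x}"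
    using ne open_contains_ball by blast
  moreover obtain y where "x - e < y" "y < x + e" "f y = g y"
    using AE_lborel_dense[OF assms(3), of "x - e" "x + e"] \<open>0 < e\<close> by auto
  ultimately show False by (auto simp: ball_def dist_real_def subset_iff abs_less_iff)
qed

lemma integral_symmetric_intervals_limit:
  fixes f :: "real \<Rightarrow> complex" and R :: "nat \<Rightarrow> real"
  assumes f: "integrable lborel f" and R: "filterlim R at_top sequentially"
  shows "(\<lambda>n. \<integral>x. indicator {- R n..R n} x *\<^sub>R f x \<partial>lborel) \<longlonglongrightarrow> (\<integral>x. f x \<partial>lborel)"
proof (rule integral_dominated_convergence[where w = "\<lambda>x. cmod (f x)"])
  show "AE x in lborel. (\<lambda>n. indicator {- R n..R n} x *\<^sub>R f x) \<longlonglongrightarrow> f x"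
  proof (rule AE_I2)
    fix x :: real
    have "\<forall>\<^sub>F n in sequentially. \<bar>x\<bar> \<le> R n"
      using R unfolding filterlim_at_top by blast
    then have "\<forall>\<^sub>F n in sequentially. indicator {- R n..R n} x *\<^sub>R f x = f x"
      by eventually_elim (auto simp: indicator_def)
    then show "(\<lambda>n. indicator {- R n..R n} x *\<^sub>R f x) \<longlonglongrightarrow> f x"
      by (rule tendsto_eventually)
  qed
qed (use f in \<open>auto split: split_indicator\<close>)

lemma integral_adjacent_intervals:
  fixes f :: "real \<Rightarrow> complex"
  assumes f: "integrable lborel f" and "a \<le> b" "b \<le> c"
  shows "(\<integral>x. indicator {a..c} x *\<^sub>R f x \<partial>lborel)
    = (\<integral>x. indicator {a..b} x *\<^sub>R f x \<partial>lborel) + (\<integral>x. indicator {b..c} x *\<^sub>R f x \<partial>lborel)"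
proof -
  have i: "integrable lborel (\<lambda>x. indicator {a..b} x *\<^sub>R f x)" for a b
    using f by (intro integrable_mult_indicator) auto
  have "(\<integral>x. indicator {a..c} x *\<^sub>R f x \<partial>lborel) = (\<integral>x. indicator {a..b} x *\<^sub>R f x + indicator {b..c} x *\<^sub>R f x \<partial>lborel)"
    using assms(2,3) borel_measurable_integrable[OF f]
    by (intro integral_cong_AE) (auto intro!: eventually_mono[OF AE_lborel_singleton[of b]] split: split_indicator)
  then show ?thesis using i by simp
qed

lemma integral_translated_interval:
  fixes f :: "real \<Rightarrow> complex"
  shows "(\<integral>x. indicator {a..b} x *\<^sub>R f (x + c) \<partial>lborel) = (\<integral>x. indicator {a + c..b + c} x *\<^sub>R f x \<partial>lborel)"
proof -
  have "(\<integral>x. indicator {a + c..b + c} x *\<^sub>R f x \<partial>lborel)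
      = \<bar>1\<bar> *\<^sub>R (\<integral>x. indicator {a + c..b + c} (c + 1 * x) *\<^sub>R f (c + 1 * x) \<partial>lborel)"
    by (rule lborel_integral_real_affine) simp
  also have "\<dots> = (\<integral>x. indicator {a..b} x *\<^sub>R f (x + c) \<partial>lborel)"
    by (simp, intro Bochner_Integration.integral_cong refl) (auto simp: add.commute split: split_indicator)
  finally show ?thesis ..
qed

lemma integrable_continuous_compact_support:
  fixes U :: "real \<Rightarrow> complex"
  assumes "continuous_on UNIV U" "\<And>t. R < \<bar>t\<bar> \<Longrightarrow> U t = 0"
  shows "integrable lborel U"
proof -
  have "integrable lborel (\<lambda>t. indicator {- R..R} t *\<^sub>R U t)"
    by (rule borel_integrable_compact[OF compact_Icc continuous_on_subset[OF assms(1)]]) simp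
  moreover have "indicator {- R..R} t *\<^sub>R U t = U t" for t
    using assms(2)[of t] by (cases "\<bar>t\<bar> \<le> R") (auto simp: indicator_def)
  ultimately show ?thesis by simp
qed

lemma integral_compact_support_eq:
  fixes f :: "real \<Rightarrow> complex"
  assumes "continuous_on {a..b} f" "\<And>s. s \<notin> {a..b} \<Longrightarrow> f s = 0"
  shows "(\<integral>s. f s \<partial>lborel) = integral (cbox a b) f"
proof -
  have "(\<integral>s. indicator {a..b} s *\<^sub>R f s \<partial>lborel) = integral {a..b} f"
    using set_borel_integral_eq_integral(2)[OF borel_integrable_compact[OF compact_Icc assms(1), folded set_integrable_def]]
    by (simp add: set_lebesgue_integral_def)
  moreover have "indicator {a..b} s *\<^sub>R f s = f s" for s
    using assms(2)[of s] by (auto simp: indicator_def)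
  ultimately show ?thesis by simp
qed

text \<open>Both halves of the line are affine images of the tail of a power function.\<close>

lemma integrable_power_decay:
  assumes "0 < \<epsilon>"
  shows "integrable lborel (\<lambda>x::real. (1 + \<bar>x\<bar>) powr (- 1 - \<epsilon>))"
proof -
  have "(\<lambda>x::real. x powr (- 1 - \<epsilon>)) absolutely_integrable_on {1..}"
    by (rule nonnegative_absolutely_integrable_1)
       (use has_integral_powr_to_inf[of "- 1 - \<epsilon>" 1] assms in \<open>auto simp: integrable_on_def\<close>)
  then have "set_integrable lebesgue {1..} (\<lambda>x::real. x powr (- 1 - \<epsilon>))" by simp
  then have h: "integrable lborel (\<lambda>x. indicator {1..} x * x powr (- 1 - \<epsilon>))"
    unfolding set_integrable_def by (subst (asm) integrable_completion) auto
  have 1: "integrable lborel (\<lambda>x. indicator {1..} (1 + 1 * x) * (1 + 1 * x) powr (- 1 - \<epsilon>))"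
    by (rule lborel_integrable_real_affine[OF h, of 1 1]) simp
  have 2: "integrable lborel (\<lambda>x. indicator {1..} (1 + - 1 * x) * (1 + - 1 * x) powr (- 1 - \<epsilon>))"
    by (rule lborel_integrable_real_affine[OF h, of "-1" 1]) simp
  show ?thesis
    by (rule Bochner_Integration.integrable_bound[OF Bochner_Integration.integrable_add[OF 1 2]])
       (auto split: split_indicator)
qed

lemma integrable_if_power_decay:
  fixes f :: "real \<Rightarrow> complex"
  assumes "continuous_on UNIV f" "0 < \<epsilon>" "\<And>x. cmod (f x) \<le> C * (1 + \<bar>x\<bar>) powr (- 1 - \<epsilon>)"
  shows "integrable lborel f"
proof (rule Bochner_Integration.integrable_bound)
  show "integrable lborel (\<lambda>x. C * (1 + \<bar>x\<bar>) powr (- 1 - \<epsilon>))"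
    by (intro integrable_mult_right integrable_power_decay assms)
  show "f \<in> borel_measurable lborel" using borel_measurable_continuous_onI[OF assms(1)] by simp
  show "AE x in lborel. norm (f x) \<le> norm (C * (1 + \<bar>x\<bar>) powr (- 1 - \<epsilon>))"
    using order_trans[OF assms(3) abs_ge_self] by (intro AE_I2) simp
qed

text \<open>Rounding \<open>t\<close> down to a multiple of \<open>1/(n+1)\<close> leaves countably many sections to be measurable, and continuity
  in \<open>t\<close> allows the limit \<open>n \<rightarrow> \<infinity>\<close>.\<close>

lemma Caratheodory_measurable:
  fixes f :: "'a \<Rightarrow> real \<Rightarrow> complex"
  assumes meas: "\<And>t. (\<lambda>l. f l t) \<in> borel_measurable M"
    and cont: "\<And>l. l \<in> space M \<Longrightarrow> continuous_on UNIV (f l)"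
  shows "(\<lambda>(l, t). f l t) \<in> borel_measurable (M \<Otimes>\<^sub>M lborel)"
proof (rule borel_measurable_LIMSEQ_metric)
  fix n :: nat
  let ?q = "\<lambda>i::int. of_int i / real (Suc n)"
  have "(\<lambda>p. f (fst p) (?q i)) \<in> borel_measurable (M \<Otimes>\<^sub>M lborel)" for i
    using measurable_compose[OF measurable_fst meas] .
  moreover have "(\<lambda>p. \<lfloor>real (Suc n) * snd p\<rfloor>) \<in> measurable (M \<Otimes>\<^sub>M lborel) (count_space UNIV)"
    by measurable
  ultimately have "(\<lambda>p. f (fst p) (?q \<lfloor>real (Suc n) * snd p\<rfloor>)) \<in> borel_measurable (M \<Otimes>\<^sub>M lborel)"
    by (rule measurable_compose_countable)
  then show "(\<lambda>(l, t). f l (?q \<lfloor>real (Suc n) * t\<rfloor>)) \<in> borel_measurable (M \<Otimes>\<^sub>M lborel)"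
    by (simp add: split_beta)
next
  fix p :: "'a \<times> real" assume p: "p \<in> space (M \<Otimes>\<^sub>M lborel)"
  obtain l t where lt: "p = (l, t)" by (cases p)
  have l: "l \<in> space M" using p by (auto simp: lt space_pair_measure)
  have "(\<lambda>n. of_int \<lfloor>real (Suc n) * t\<rfloor> / real (Suc n)) \<longlonglongrightarrow> t"
  proof (rule tendsto_sandwich)
    show "\<forall>\<^sub>F n in sequentially. t - 1 / real (Suc n) \<le> of_int \<lfloor>real (Suc n) * t\<rfloor> / real (Suc n)"
    proof (intro always_eventually allI)
      fix n
      have "real (Suc n) * t - 1 \<le> of_int \<lfloor>real (Suc n) * t\<rfloor>" by linarith
      then have "(real (Suc n) * t - 1) / real (Suc n) \<le> of_int \<lfloor>real (Suc n) * t\<rfloor> / real (Suc n)"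
        by (intro divide_right_mono) auto
      then show "t - 1 / real (Suc n) \<le> of_int \<lfloor>real (Suc n) * t\<rfloor> / real (Suc n)"
        by (simp add: diff_divide_distrib del: of_nat_Suc)
    qed
    show "\<forall>\<^sub>F n in sequentially. of_int \<lfloor>real (Suc n) * t\<rfloor> / real (Suc n) \<le> t"
    proof (intro always_eventually allI)
      fix n
      have "of_int \<lfloor>real (Suc n) * t\<rfloor> \<le> t * real (Suc n)" by (simp only: mult.commute of_int_floor_le)
      then show "of_int \<lfloor>real (Suc n) * t\<rfloor> / real (Suc n) \<le> t" by (subst pos_divide_le_eq) auto
    qed
    show "(\<lambda>n. t - 1 / real (Suc n)) \<longlonglongrightarrow> t" by real_asymp
  qed simp
  then show "(\<lambda>n. case p of (l, t) \<Rightarrow> f l (of_int \<lfloor>real (Suc n) * t\<rfloor> / real (Suc n))) \<longlonglongrightarrow> (case p of (l, t) \<Rightarrow> f l t)"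
    using continuous_on_tendsto_compose[OF cont[OF l]] by (simp add: lt)
qed

section \<open>The Fourier transform of integrable functions and its inversion\<close>

lemma fourier_cis: "fourier \<phi> y = (\<integral>x. \<phi> x * cis (- 2 * pi * x * y) \<partial>lborel)"
  by (simp add: fourier_def cis_conv_exp mult_ac)

lemma norm_fourier_le:
  assumes "integrable lborel f"
  shows "cmod (fourier f t) \<le> (\<integral>x. cmod (f x) \<partial>lborel)"
  unfolding fourier_cis
  by (rule order_trans[OF integral_norm_bound]) (simp add: norm_mult)

lemma continuous_on_fourier:
  assumes "integrable lborel f"
  shows "continuous_on UNIV (fourier f)"
proof (rule continuous_at_imp_continuous_on, rule ballI)
  fix t :: real
  show "isCont (fourier f) t"
    unfolding continuous_at_sequentially comp_def fourier_cis
  proof (intro allI impI)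
    fix X :: "nat \<Rightarrow> real" assume "X \<longlonglongrightarrow> t"
    then show "(\<lambda>n. \<integral>x. f x * cis (- 2 * pi * x * X n) \<partial>lborel) \<longlonglongrightarrow>
         (\<integral>x. f x * cis (- 2 * pi * x * t) \<partial>lborel)"
      by (intro integral_dominated_convergence[where w = "\<lambda>x. cmod (f x)"])
         (use assms in \<open>auto intro!: tendsto_eq_intros AE_I2 simp: norm_mult cis_conv_exp\<close>)
  qed
qed

lemma fourier_diff:
  assumes "integrable lborel f" "integrable lborel g"
  shows "fourier (\<lambda>x. f x - g x) t = fourier f t - fourier g t"
  unfolding fourier_cis using assms
  by (simp add: left_diff_distrib Bochner_Integration.integral_diff integrable_mult_cis)

lemma fourier_multiplication_formula:
  assumes f: "integrable lborel f" and g: "integrable lborel g"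
  shows "(\<integral>x. f x * fourier g x \<partial>lborel) = (\<integral>t. fourier f t * g t \<partial>lborel)"
proof -
  have "integrable (lborel \<Otimes>\<^sub>M lborel) (\<lambda>(x, y). f x * g y * (\<lambda>(x, y). cis (- 2 * pi * y * x)) (x, y))"
    by (rule integrable_tensor_bounded[OF f g, where C=1]) auto
  then have "(\<integral>y. (\<integral>x. f x * g y * cis (- 2 * pi * y * x) \<partial>lborel) \<partial>lborel)
     = (\<integral>x. (\<integral>y. f x * g y * cis (- 2 * pi * y * x) \<partial>lborel) \<partial>lborel)"
    by (intro lborel_pair.Fubini_integral) simp
  moreover have "(\<integral>x. f x * g y * cis (- 2 * pi * y * x) \<partial>lborel) = fourier f y * g y" for y
    unfolding fourier_cis
    by (subst integral_mult_left_zero[symmetric]) (simp add: mult_ac)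
  moreover have "(\<integral>y. f x * g y * cis (- 2 * pi * y * x) \<partial>lborel) = f x * fourier g x" for x
    unfolding fourier_cis
    by (subst integral_mult_right_zero[symmetric]) (simp add: mult_ac)
  ultimately show ?thesis by simp
qed

text \<open>The integral of \<open>cis (- t x)\<close> over \<open>a < x \<le> b\<close> when \<open>t \<noteq> 0\<close>, see \<open>integral_cis_interval\<close>.\<close>

abbreviation Levy_kernel :: "real \<Rightarrow> real \<Rightarrow> real \<Rightarrow> complex" where
  "Levy_kernel a b t \<equiv> (cis (-(t * a)) - cis (-(t * b))) / (\<i> * t)"

text \<open>After normalization a non-negative function with finite positive integral is a probability density, and Levy's inversion
  theorem for characteristic functions applies.\<close>

lemma Levy_inversion_density:
  fixes u :: "real \<Rightarrow> real"
  assumes u: "integrable lborel u" and nonneg: "\<And>x. 0 \<le> u x" and ab: "a \<le> b"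
  shows "(\<lambda>T::nat. 1 / (2 * pi) * (CLBINT t=-real T..real T.
            Levy_kernel a b t * (\<integral>x. u x * cis (t * x) \<partial>lborel)))
         \<longlonglongrightarrow> of_real (\<integral>x. indicator {a<..b} x * u x \<partial>lborel)"
proof (cases "(\<integral>x. u x \<partial>lborel) = 0")
  case True
  then have *: "AE x in lborel. u x = 0"
    using integral_nonneg_eq_0_iff_AE[OF u] True nonneg by auto
  have "(\<integral>x. u x * cis (t * x) \<partial>lborel) = 0" for t
    by (rule integral_eq_zero_AE) (use * in auto)
  moreover have "(\<integral>x. indicator {a<..b} x * u x \<partial>lborel) = 0"
    by (rule integral_eq_zero_AE) (use * in auto)
  ultimately show ?thesis by simp
next
  case False
  define c where "c = (\<integral>x. u x \<partial>lborel)"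
  have c: "c > 0" using False nonneg integral_nonneg_AE[of u lborel] by (auto simp: c_def less_le)
  note [measurable] = borel_measurable_integrable[OF u]
  define M where "M = density lborel (\<lambda>x. u x / c)"
  have em: "emeasure M A = ennreal (\<integral>x. indicator A x * u x \<partial>lborel / c)" if [measurable]: "A \<in> sets borel" for A
  proof -
    have "integrable lborel (\<lambda>x. indicator A x * u x)"
      using integrable_mult_indicator[OF _ u, of A] by simp
    then have "integrable lborel (\<lambda>x. indicator A x * u x / c)"
      by simp
    then have "(\<integral>\<^sup>+x. ennreal (indicator A x * u x / c) \<partial>lborel) = ennreal (\<integral>x. indicator A x * u x / c \<partial>lborel)"
      by (rule nn_integral_eq_integral) (use nonneg c in auto)
    moreover have "emeasure M A = (\<integral>\<^sup>+x. ennreal (indicator A x * u x / c) \<partial>lborel)"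
      unfolding M_def by (subst emeasure_density) (auto intro!: nn_integral_cong split: split_indicator)
    ultimately show ?thesis by simp
  qed
  have "prob_space M"
    by standard (use em[of UNIV] c in \<open>simp add: M_def c_def\<close>)
  moreover have "sets M = sets borel" by (simp add: M_def)
  ultimately interpret real_distribution M
    by (simp add: real_distribution_def real_distribution_axioms_def)
  have meas: "measure M A = (\<integral>x. indicator A x * u x \<partial>lborel) / c" if [measurable]: "A \<in> sets borel" for A
  proof -
    have "0 \<le> (\<integral>x. indicator A x * u x \<partial>lborel) / c"
      using c nonneg by (auto intro!: integral_nonneg_AE divide_nonneg_pos)
    then show ?thesis using em[OF that] by (simp add: measure_def)
  qed
  have sing: "measure M {x} = 0" for x
  proof -
    have "(\<integral>y. indicator {x} y * u y \<partial>lborel) = 0"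
      by (rule integral_eq_zero_AE) (use AE_lborel_singleton[of x] in \<open>auto elim!: eventually_mono\<close>)
    then show ?thesis by (simp add: meas)
  qed
  have ch: "char M t = (\<integral>x. u x * cis (t * x) \<partial>lborel) / c" for t
    unfolding char_def M_def cis_conv_exp[symmetric]
    by (subst integral_density) (use c nonneg in \<open>auto simp: scaleR_conv_of_real\<close>)
  have "(\<lambda>T::nat. 1 / (2 * pi) * (CLBINT t=-real T..real T. (iexp (-(t * a)) - iexp (-(t * b))) / (\<i> * t) * char M t))
    \<longlonglongrightarrow> measure M {a<..b}"
    using Levy_Inversion[OF ab sing sing] by simp
  then have "(\<lambda>T::nat. c * (1 / (2 * pi) * (CLBINT t=-real T..real T. (iexp (-(t * a)) - iexp (-(t * b))) / (\<i> * t) * char M t)))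
    \<longlonglongrightarrow> complex_of_real c * complex_of_real (measure M {a<..b})"
    by (intro tendsto_mult tendsto_const)
  moreover have "c * (1 / (2 * pi) * (CLBINT t=-T..T. (iexp (-(t * a)) - iexp (-(t * b))) / (\<i> * t) * char M t))
     = 1 / (2 * pi) * (CLBINT t=-T..T.
            Levy_kernel a b t * (\<integral>x. u x * cis (t * x) \<partial>lborel))" if "0 \<le> T" for T :: real
  proof -
    have "c * (CLBINT t=-T..T. (iexp (-(t * a)) - iexp (-(t * b))) / (\<i> * t) * char M t)
       = (CLBINT t=-T..T. c * ((iexp (-(t * a)) - iexp (-(t * b))) / (\<i> * t) * char M t))"
      by (rule interval_lebesgue_integral_mult_right[symmetric])
    also have "\<dots> = (CLBINT t=-T..T.
            Levy_kernel a b t * (\<integral>x. u x * cis (t * x) \<partial>lborel))"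
      using c that by (intro interval_lebesgue_integral_cong) (simp_all add: ch cis_conv_exp)
    finally show ?thesis by (simp add: mult.left_commute)
  qed
  moreover have "of_real c * complex_of_real (measure M {a<..b}) = of_real ( \<integral>x. indicator {a<..b} x * u x \<partial>lborel)"
    using c by (simp add: meas)
  ultimately show ?thesis by simp
qed

lemma Levy_kernel_bound:
  assumes "a \<le> b"
  shows "cmod (Levy_kernel a b t) \<le> b - a"
  using Levy_Inversion_aux2[of "-b" "-a" t] assms
  by (cases "t = 0") (auto simp: cis_conv_exp)

lemma Levy_kernel_integrable:
  assumes "integrable lborel (v :: real \<Rightarrow> real)" "a \<le> b"
  shows "interval_lebesgue_integrable lborel (ereal c) (ereal d)
     (\<lambda>t. Levy_kernel a b t * (\<integral>x. v x * cis (t * x) \<partial>lborel))"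
proof -
  note [measurable] = borel_measurable_integrable[OF assms(1)]
  have 1: "cmod (Levy_kernel a b t) \<le> b - a" for t
    by (rule Levy_kernel_bound[OF assms(2)])
  have 2: "cmod (\<integral>x. v x * cis (t * x) \<partial>lborel) \<le> (\<integral>x. \<bar>v x\<bar> \<partial>lborel)" for t
    by (rule order_trans[OF integral_norm_bound]) (simp add: norm_mult)
  have 3: "cmod (Levy_kernel a b t * (\<integral>x. v x * cis (t * x) \<partial>lborel))
      \<le> (b - a) * (\<integral>x. \<bar>v x\<bar> \<partial>lborel)" for t
    unfolding norm_mult[of "_ / _"] by (intro mult_mono 1 2) (use assms in auto)
  have "(\<lambda>t. Levy_kernel a b t) \<in> borel_measurable lborel"
    unfolding cis_conv_exp by measurable
  moreover have "(\<lambda>t. \<integral>x. v x * cis (t * x) \<partial>lborel) \<in> borel_measurable lborel"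
    by measurable
  ultimately have 4: "(\<lambda>t. Levy_kernel a b t * (\<integral>x. v x * cis (t * x) \<partial>lborel))
      \<in> borel_measurable lborel"
    by (rule borel_measurable_times)
  have "set_integrable lborel {c<..<d} (\<lambda>t. Levy_kernel a b t * (\<integral>x. v x * cis (t * x) \<partial>lborel))" for c d
    unfolding set_integrable_def
    by (rule integrableI_bounded_set_indicator[OF _ 4 emeasure_bounded_finite AE_I2,
          where B="(b - a) * (\<integral>x. \<bar>v x\<bar> \<partial>lborel)"]) (use 3 in blast | simp)+
  then show ?thesis
    by (simp add: interval_lebesgue_integrable_def)
qed

lemma Levy_inversion_real:
  fixes u :: "real \<Rightarrow> real"
  assumes u: "integrable lborel u" and ab: "a \<le> b"
  shows "(\<lambda>T::nat. 1 / (2 * pi) * (CLBINT t=-real T..real T.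
            Levy_kernel a b t * (\<integral>x. u x * cis (t * x) \<partial>lborel)))
         \<longlonglongrightarrow> of_real (\<integral>x. indicator {a<..b} x * u x \<partial>lborel)"
proof -
  define p n where "p = (\<lambda>x. max 0 (u x))" and "n = (\<lambda>x. max 0 (- u x))"
  have p: "integrable lborel p" and n: "integrable lborel n"
    using u by (auto simp: p_def n_def)
  have un: "u x = p x - n x" for x by (auto simp: p_def n_def)
  let ?F = "\<lambda>v t. Levy_kernel a b t * (\<integral>x. of_real (v x :: real) * cis (t * x) \<partial>lborel)"
  have "(\<lambda>T::nat. 1 / (2 * pi) * (CLBINT t=-real T..real T. ?F p t)
           - 1 / (2 * pi) * (CLBINT t=-real T..real T. ?F n t))
        \<longlonglongrightarrow> of_real (\<integral>x. indicator {a<..b} x * p x \<partial>lborel) - of_real (\<integral>x. indicator {a<..b} x * n x \<partial>lborel)"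
    by (intro tendsto_diff Levy_inversion_density ab p n) (auto simp: p_def n_def)
  moreover have "1 / (2 * pi) * (CLBINT t=-real T..real T. ?F p t)
           - 1 / (2 * pi) * (CLBINT t=-real T..real T. ?F n t)
           = 1 / (2 * pi) * (CLBINT t=-real T..real T. ?F u t)" for T :: nat
  proof -
    have "?F u t = ?F p t - ?F n t" for t
    proof -
      have "(\<integral>x. u x * cis (t * x) \<partial>lborel) = (\<integral>x. p x * cis (t * x) - n x * cis (t * x) \<partial>lborel)"
        by (simp add: un algebra_simps)
      also have "\<dots> = (\<integral>x. p x * cis (t * x) \<partial>lborel) - (\<integral>x. n x * cis (t * x) \<partial>lborel)"
        by (intro Bochner_Integration.integral_diff integrable_of_real_mult_cis p n)
      finally show ?thesis by (simp add: right_diff_distrib)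
    qed
    then show ?thesis
      by (simp only: interval_lebesgue_integral_diff(2)[OF Levy_kernel_integrable[OF p ab] Levy_kernel_integrable[OF n ab]]
          right_diff_distrib)
  qed
  moreover have "(\<integral>x. indicator {a<..b} x * p x \<partial>lborel) - (\<integral>x. indicator {a<..b} x * n x \<partial>lborel)
      = (\<integral>x. indicator {a<..b} x * u x \<partial>lborel)"
    using integrable_mult_indicator[OF _ p, of "{a<..b}"] integrable_mult_indicator[OF _ n, of "{a<..b}"]
    by (subst Bochner_Integration.integral_diff[symmetric]) (auto simp: un right_diff_distrib)
  ultimately show ?thesis by (simp flip: of_real_diff)
qed

lemma integral_cis_interval:
  assumes "t \<noteq> 0" "a \<le> b"
  shows "(\<integral>x. indicator {a<..b} x * cis (- (t * x)) \<partial>lborel) = Levy_kernel a b t"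
proof -
  have d: "((\<lambda>x. - cis (- (t * x)) / (\<i> * t)) has_vector_derivative cis (- (t * x))) (at x within S)" for x S
  proof -
    have "((\<lambda>z. - exp (- (\<i> * t * z)) / (\<i> * t)) has_field_derivative exp (- (\<i> * t * x))) (at (of_real x))"
      using assms by (auto intro!: derivative_eq_intros simp: field_simps)
    from has_vector_derivative_real_field[OF this] show ?thesis
      by (simp add: cis_conv_exp mult_ac)
  qed
  have c: "continuous_on S (\<lambda>x. cis (- (t * x)))" for S
    unfolding cis_conv_exp by (intro continuous_intros)
  have "(\<integral>x. indicator {a..b} x *\<^sub>R cis (- (t * x)) \<partial>lborel) = - cis (- (t * b)) / (\<i> * t) - (- cis (-(t * a)) / (\<i> * t))"
    by (rule integral_FTC_Icc)
       (use assms d c in auto)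
  moreover have "(\<integral>x. indicator {a..b} x *\<^sub>R cis (- (t * x)) \<partial>lborel) = (\<integral>x. indicator {a<..b} x * cis (- (t * x)) \<partial>lborel)"
    by (rule integral_cong_AE)
       (use AE_lborel_singleton[of a] in \<open>auto split: split_indicator elim!: eventually_mono\<close>)
  ultimately show ?thesis by (simp add: diff_divide_distrib)
qed

text \<open>If the transform is integrable, the limit in Levy's formula is an integral over the line, and Fubini's theorem
  shows that \<open>u\<close> and the inverse transform \<open>V\<close> have the same integral over every interval.\<close>

lemma fourier_inversion_AE:
  fixes u :: "real \<Rightarrow> real"
  assumes u: "integrable lborel u" and fu: "integrable lborel (fourier (\<lambda>x. of_real (u x)))"
  shows "AE x in lborel. of_real (u x) = (\<integral>t. fourier (\<lambda>x. of_real (u x)) t * cis (2 * pi * x * t) \<partial>lborel)"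
proof -
  define U where "U t = (\<integral>x. u x * cis (t * x) \<partial>lborel)" for t
  have fU: "fourier (\<lambda>x. of_real (u x)) t = U (0 + (- 2 * pi) * t)" for t
    by (simp add: fourier_cis U_def mult_ac)
  then have iU: "integrable lborel U"
    using fu lborel_integrable_real_affine_iff[of "- 2 * pi" U 0] pi_gt_zero
    unfolding fU[abs_def] by simp
  note [measurable] = borel_measurable_integrable[OF iU] borel_measurable_integrable[OF u]
  define V where "V x = 1 / (2 * pi) * (\<integral>t. cis (- (t * x)) * U t \<partial>lborel)" for x
  have V: "V x = (\<integral>t. fourier (\<lambda>x. of_real (u x)) t * cis (2 * pi * x * t) \<partial>lborel)" for x
  proof -
    have "(\<integral>t. cis (- (t * x)) * U t \<partial>lborel) = \<bar>- 2 * pi\<bar> *\<^sub>R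
        (\<integral>t. cis (- ((0 + (- 2 * pi) * t) * x)) * U (0 + (- 2 * pi) * t) \<partial>lborel)"
      by (rule lborel_integral_real_affine) simp
    also have "\<dots> = (2 * pi) *\<^sub>R (\<integral>t. fourier (\<lambda>x. of_real (u x)) t * cis (2 * pi * x * t) \<partial>lborel)"
      unfolding fU[symmetric] by (simp add: mult.commute mult.left_commute)
    finally show ?thesis by (simp add: V_def scaleR_conv_of_real)
  qed
  have interval: "(\<integral>x. indicator {a<..b} x * of_real (u x) \<partial>lborel) = (\<integral>x. indicator {a<..b} x * V x \<partial>lborel)"
    if ab: "a \<le> b" for a b
  proof -
    let ?k = "\<lambda>t. Levy_kernel a b t"
    have k: "cmod (?k t) \<le> b - a" for t
      by (rule Levy_kernel_bound[OF ab])
    have "(\<lambda>t. ?k t) \<in> borel_measurable lborel"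
      unfolding cis_conv_exp by measurable
    then have mk: "(\<lambda>t. ?k t * U t) \<in> borel_measurable lborel"
      by (intro borel_measurable_times) (use iU in auto)
    have "integrable lborel (\<lambda>t. ?k t * U t)"
    proof (rule Bochner_Integration.integrable_bound[OF _ mk AE_I2])
      show "integrable lborel (\<lambda>t. (b - a) * cmod (U t))" using iU by simp
      show "norm (?k t * U t) \<le> norm ((b - a) * cmod (U t))" for t
        unfolding norm_mult using k[of t] ab by (intro mult_mono) auto
    qed
    from integral_symmetric_intervals_limit[OF this filterlim_real_sequentially]
    have lim: "(\<lambda>T::nat. CLBINT t=-real T..real T. ?k t * U t) \<longlonglongrightarrow> (\<integral>t. ?k t * U t \<partial>lborel)"
      by (subst interval_integral_Icc) (auto simp: set_lebesgue_integral_def)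
    have "(\<lambda>T::nat. 1 / (2 * pi) * (CLBINT t=-real T..real T. ?k t * U t))
         \<longlonglongrightarrow> of_real (\<integral>x. indicator {a<..b} x * u x \<partial>lborel)"
      using Levy_inversion_real[OF u ab] unfolding U_def .
    moreover have "(\<lambda>T::nat. 1 / (2 * pi) * (CLBINT t=-real T..real T. ?k t * U t))
         \<longlonglongrightarrow> 1 / (2 * pi) * (\<integral>t. ?k t * U t \<partial>lborel)"
      by (intro tendsto_mult lim tendsto_const)
    ultimately have "of_real (\<integral>x. indicator {a<..b} x * u x \<partial>lborel) = 1 / (2 * pi) * (\<integral>t. ?k t * U t \<partial>lborel)"
      by (rule LIMSEQ_unique)
    also have "(\<integral>t. ?k t * U t \<partial>lborel) = (\<integral>t. (\<integral>x. indicator {a<..b} x * U t * cis (- (t * x)) \<partial>lborel) \<partial>lborel)"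
    proof (rule integral_cong_AE)
      have "(\<integral>x. indicator {a<..b} x * U t * cis (- (t * x)) \<partial>lborel) = ?k t * U t" if "t \<noteq> 0" for t
      proof -
        have "(\<integral>x. indicator {a<..b} x * U t * cis (- (t * x)) \<partial>lborel)
            = (\<integral>x. indicator {a<..b} x * cis (- (t * x)) * U t \<partial>lborel)"
          by (intro Bochner_Integration.integral_cong refl) (simp only: mult_ac)
        also have "\<dots> = (\<integral>x. indicator {a<..b} x * cis (- (t * x)) \<partial>lborel) * U t"
          by (rule integral_mult_left_zero)
        finally show ?thesis unfolding integral_cis_interval[OF that ab] .
      qed
      note * = this[symmetric]
      show "AE t in lborel. ?k t * U t = (\<integral>x. indicator {a<..b} x * U t * cis (- (t * x)) \<partial>lborel)"
        by (rule eventually_mono[OF AE_lborel_singleton[of 0]]) (rule *)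
      show "(\<lambda>t. ?k t * U t) \<in> borel_measurable lborel" by (rule mk)
      show "(\<lambda>t. \<integral>x. indicator {a<..b} x * U t * cis (- (t * x)) \<partial>lborel) \<in> borel_measurable lborel" by measurable
    qed
    also have "\<dots> = (\<integral>x. (\<integral>t. indicator {a<..b} x * U t * cis (- (t * x)) \<partial>lborel) \<partial>lborel)"
    proof (rule lborel_pair.Fubini_integral)
      have "integrable lborel (indicator {a<..b} :: real \<Rightarrow> complex)"
        using integrable_of_real[OF integrable_real_indicator[of "{a<..b}" lborel], where 'a=complex]
        using ab by (simp add: of_real_indicator emeasure_lborel_Ioc)
      from integrable_tensor_bounded[OF this iU, where c = "\<lambda>(x, t). cis (- (t * x))" and C = 1]
      show "integrable (lborel \<Otimes>\<^sub>M lborel) (\<lambda>(x, t). indicator {a<..b} x * U t * cis (- (t * x)))"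
        by (simp add: split_beta')
    qed
    also have "\<dots> = (\<integral>x. 2 * pi * (indicator {a<..b} x * V x) \<partial>lborel)"
    proof (intro Bochner_Integration.integral_cong refl)
      fix x
      have "(\<integral>t. indicator {a<..b} x * U t * cis (- (t * x)) \<partial>lborel)
          = (\<integral>t. indicator {a<..b} x * (cis (- (t * x)) * U t) \<partial>lborel)"
        by (intro Bochner_Integration.integral_cong refl) (simp only: mult_ac)
      also have "\<dots> = indicator {a<..b} x * (\<integral>t. cis (- (t * x)) * U t \<partial>lborel)"
        by (rule integral_mult_right_zero)
      finally show "(\<integral>t. indicator {a<..b} x * U t * cis (- (t * x)) \<partial>lborel) = 2 * pi * (indicator {a<..b} x * V x)"
        by (simp add: V_def)
    qed
    also have "\<dots> = 2 * pi * (\<integral>x. indicator {a<..b} x * V x \<partial>lborel)"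
      by (rule integral_mult_right_zero)
    finally have "of_real (\<integral>x. indicator {a<..b} x * u x \<partial>lborel) = (\<integral>x. indicator {a<..b} x * V x \<partial>lborel)"
      by simp
    moreover have "(\<integral>x. indicator {a<..b} x * complex_of_real (u x) \<partial>lborel) = of_real (\<integral>x. indicator {a<..b} x * u x \<partial>lborel)"
      by (subst integral_complex_of_real[symmetric]) (simp add: of_real_indicator)
    ultimately show ?thesis by simp
  qed
  have "AE x in lborel. of_real (u x) - V x = 0"
  proof (rule AE_zero_if_zero_interval_integrals)
    have mV: "V \<in> borel_measurable borel" unfolding V_def by measurable
    have bV: "cmod (V x) \<le> 1 / (2 * pi) * (\<integral>t. cmod (U t) \<partial>lborel)" for x
      unfolding V_def norm_mult
      by (intro mult_mono order_trans[OF integral_norm_bound]) (auto simp: norm_mult norm_divide)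
    have iV: "integrable lborel (\<lambda>x. indicator {a<..b} x * V x)" if "a \<le> b" for a b
      using that integrableI_bounded_set_indicator[of "{a<..b}" lborel V "1 / (2 * pi) * (\<integral>t. cmod (U t) \<partial>lborel)"] bV mV emeasure_lborel_Ioc[OF that]
      by (auto simp: scaleR_conv_of_real of_real_indicator)
    have iu: "integrable lborel (\<lambda>x. indicator {a<..b} x * complex_of_real (u x))" if "a \<le> b" for a b
      using that integrable_mult_indicator[OF _ integrable_of_real[OF u], of "{a<..b}"]
      by (simp add: scaleR_conv_of_real of_real_indicator)
    show "integrable lborel (\<lambda>x. indicator {a<..b} x * (complex_of_real (u x) - V x))" if "a \<le> b" for a b
      unfolding right_diff_distrib by (intro Bochner_Integration.integrable_diff iV iu that)
    show "(\<integral>x. indicator {a<..b} x * (complex_of_real (u x) - V x) \<partial>lborel) = 0" if "a \<le> b" for a b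
      unfolding right_diff_distrib using interval[OF that] iV[OF that] iu[OF that] by simp
  qed
  then show ?thesis by eventually_elim (simp add: V)
qed

lemma fourier_real_and_imaginary_part:
  assumes w: "integrable lborel w"
  shows "fourier (\<lambda>x. of_real (Re (w x))) t = (fourier w t + cnj (fourier w (- t))) / 2"
    and "\<i> * fourier (\<lambda>x. of_real (Im (w x))) t = (fourier w t - cnj (fourier w (- t))) / 2"
proof -
  have c: "cnj (fourier w (- t)) = (\<integral>x. cnj (w x) * cis (- 2 * pi * x * t) \<partial>lborel)"
  proof -
    have "cnj (fourier w (- t)) = (\<integral>x. cnj (w x * cis (- 2 * pi * x * - t)) \<partial>lborel)"
      unfolding fourier_cis by (rule Bochner_Integration.integral_cnj[symmetric])
    then show ?thesis by (simp add: cis_cnj)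
  qed
  have i: "integrable lborel (\<lambda>x. w x * cis (- 2 * pi * x * t))" "integrable lborel (\<lambda>x. cnj (w x) * cis (- 2 * pi * x * t))"
    using w by (auto intro!: integrable_mult_cis)
  have re: "of_real (Re z) * c = (z * c + cnj z * c) / 2" for z c :: complex
    using complex_add_cnj[of z] by (simp flip: distrib_right)
  have im: "\<i> * (of_real (Im z) * c) = (z * c - cnj z * c) / 2" for z c :: complex
    using complex_diff_cnj[of z] by (simp flip: left_diff_distrib)
  show "fourier (\<lambda>x. of_real (Re (w x))) t = (fourier w t + cnj (fourier w (- t))) / 2"
    unfolding c unfolding fourier_cis re using i by simp
  show "\<i> * fourier (\<lambda>x. of_real (Im (w x))) t = (fourier w t - cnj (fourier w (- t))) / 2"
    unfolding c unfolding fourier_cis integral_mult_right_zero[symmetric] im using i by simp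
qed

lemma fourier_inversion_AE_complex:
  assumes w: "integrable lborel w" and fw: "integrable lborel (fourier w)"
  shows "AE x in lborel. w x = (\<integral>t. fourier w t * cis (2 * pi * x * t) \<partial>lborel)"
proof -
  let ?r = "fourier (\<lambda>x. of_real (Re (w x)))" and ?m = "fourier (\<lambda>x. of_real (Im (w x)))"
  have f': "integrable lborel (\<lambda>t. cnj (fourier w (- t)))"
    using lborel_integrable_real_affine[OF fw, of "-1" 0] by simp
  have ir: "integrable lborel ?r"
    unfolding fourier_real_and_imaginary_part[OF w, abs_def] using fw f' by simp
  have "integrable lborel (\<lambda>t. \<i> * ?m t)"
    unfolding fourier_real_and_imaginary_part[OF w] using fw f' by simp
  then have "integrable lborel (\<lambda>t. - \<i> * (\<i> * ?m t))"
    by (rule integrable_mult_right)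
  then have im: "integrable lborel ?m" by (simp add: mult.assoc[symmetric])
  have "AE x in lborel. of_real (Re (w x)) = (\<integral>t. ?r t * cis (2 * pi * x * t) \<partial>lborel)"
    by (rule fourier_inversion_AE) (use w ir in auto)
  moreover have "AE x in lborel. of_real (Im (w x)) = (\<integral>t. ?m t * cis (2 * pi * x * t) \<partial>lborel)"
    by (rule fourier_inversion_AE) (use w im in auto)
  ultimately show ?thesis
  proof eventually_elim
    case (elim x)
    have "w x = of_real (Re (w x)) + \<i> * of_real (Im (w x))" by (rule complex_eq)
    also have "\<dots> = (\<integral>t. ?r t * cis (2 * pi * x * t) + \<i> * (?m t * cis (2 * pi * x * t)) \<partial>lborel)"
      unfolding elim integral_mult_right_zero[symmetric]
      by (intro Bochner_Integration.integral_add[symmetric] integrable_mult_right integrable_mult_cis ir im) auto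
    also have "\<dots> = (\<integral>t. fourier w t * cis (2 * pi * x * t) \<partial>lborel)"
    proof -
      have "?r t + \<i> * ?m t = fourier w t" for t
        unfolding fourier_real_and_imaginary_part[OF w] by (simp flip: add_divide_distrib)
      then show ?thesis by (simp only: mult.assoc[symmetric] distrib_right[symmetric])
    qed
    finally show ?case .
  qed
qed

text \<open>The inverse transform is continuous, so equality almost everywhere is equality.\<close>

lemma fourier_inversion_continuous:
  assumes "continuous_on UNIV w" "integrable lborel w" "integrable lborel (fourier w)"
  shows "w x = (\<integral>t. fourier w t * cis (2 * pi * x * t) \<partial>lborel)"
proof (rule continuous_AE_eq[OF assms(1) _ fourier_inversion_AE_complex[OF assms(2,3)]])
  have "(\<integral>t. fourier w t * cis (2 * pi * x * t) \<partial>lborel) = fourier (fourier w) (- x)" for x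
    unfolding fourier_cis[of "fourier w"] by (simp add: mult_ac)
  moreover have "continuous_on UNIV (\<lambda>x. fourier (fourier w) (- x))"
    by (intro continuous_on_compose2[OF continuous_on_fourier[OF assms(3)]] continuous_intros) auto
  ultimately show "continuous_on UNIV (\<lambda>x. \<integral>t. fourier w t * cis (2 * pi * x * t) \<partial>lborel)" by simp
qed

section \<open>A Phragmen-Lindeloef principle for functions of exponential type\<close>

text \<open>For \<open>\<zeta>\<close> in the sector \<open>|arg \<zeta>| \<le> pi/4\<close> the argument of \<open>\<zeta> powr (3/2)\<close> stays below \<open>3 pi/8 < pi/2\<close>, so its
  real part grows like \<open>|\<zeta>| powr (3/2)\<close>. The power is written as a cube of the square root to obtain
  explicit inequalities between real and imaginary parts.\<close>

lemma csqrt_cube_growth: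
  assumes "1 \<le> Re \<zeta>" "\<bar>Im \<zeta>\<bar> \<le> Re \<zeta>"
  shows "1 \<le> Re (csqrt \<zeta>)" "5/6 * cmod \<zeta> \<le> (Re (csqrt \<zeta>))\<^sup>2"
    "1/3 * cmod \<zeta> * Re (csqrt \<zeta>) \<le> Re (csqrt \<zeta> ^ 3)"
proof -
  define r where "r = csqrt \<zeta>"
  define p q where "p = Re r" and "q = Im r"
  have p0: "0 \<le> p" using csqrt_principal[of \<zeta>] by (auto simp: p_def r_def)
  have sq: "\<zeta> = r ^ 2" by (simp add: r_def)
  have re: "Re \<zeta> = p\<^sup>2 - q\<^sup>2" and im: "Im \<zeta> = 2 * p * q"
    unfolding sq by (simp_all add: p_def q_def Re_power2 Im_power2)
  have cm: "cmod \<zeta> = p\<^sup>2 + q\<^sup>2"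
    unfolding sq by (simp add: norm_power cmod_power2 p_def q_def)
  have "1 \<le> p\<^sup>2" using assms(1) re by (smt (verit) zero_le_power2)
  then show p1: "1 \<le> Re (csqrt \<zeta>)" using p0 power2_le_imp_le[of 1 p] by (simp add: p_def r_def)
  have "2 * p * \<bar>q\<bar> \<le> p\<^sup>2 - q\<^sup>2" using assms(2) re im p0 by (simp add: abs_mult)
  moreover have "\<bar>q\<bar>\<^sup>2 = q\<^sup>2" by simp
  ultimately have "2 * \<bar>q\<bar> * p \<le> p\<^sup>2 - \<bar>q\<bar>\<^sup>2" by (simp add: mult_ac)
  moreover have "\<bar>q\<bar> \<le> p"
  proof (rule ccontr)
    assume "\<not> \<bar>q\<bar> \<le> p"
    then have "p\<^sup>2 \<le> \<bar>q\<bar>\<^sup>2" using p0 by (intro power_mono) auto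
    then show False using \<open>1 \<le> p\<^sup>2\<close> re assms(1) by simp
  qed
  then have "2 * \<bar>q\<bar> * \<bar>q\<bar> \<le> 2 * \<bar>q\<bar> * p" by (intro mult_left_mono) auto
  ultimately have "3 * q\<^sup>2 \<le> p\<^sup>2" by (simp add: power2_eq_square)
  have "2 * \<bar>q\<bar> \<le> p"
  proof (rule ccontr)
    assume "\<not> 2 * \<bar>q\<bar> \<le> p"
    then have "p * p \<le> 2 * \<bar>q\<bar> * p" using p0 by (intro mult_right_mono) auto
    then have "\<bar>q\<bar>\<^sup>2 \<le> 0" using \<open>2 * \<bar>q\<bar> * p \<le> p\<^sup>2 - \<bar>q\<bar>\<^sup>2\<close> by (simp add: power2_eq_square)
    then show False using \<open>\<not> 2 * \<bar>q\<bar> \<le> p\<close> p0 by simp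
  qed
  then have "(2 * \<bar>q\<bar>) * (2 * \<bar>q\<bar>) \<le> 2 * \<bar>q\<bar> * p"
    by (intro mult_left_mono) auto
  with \<open>2 * \<bar>q\<bar> * p \<le> p\<^sup>2 - \<bar>q\<bar>\<^sup>2\<close> have q5: "5 * q\<^sup>2 \<le> p\<^sup>2" by (simp add: power2_eq_square mult_ac)
  have pr: "Re (csqrt \<zeta>) = p" "csqrt \<zeta> = r" by (simp_all add: p_def r_def)
  show "5/6 * cmod \<zeta> \<le> (Re (csqrt \<zeta>))\<^sup>2" unfolding pr p_def[symmetric] cm using q5 by simp
  have "Re (r ^ 3) = p * (p\<^sup>2 - 3 * q\<^sup>2)"
    unfolding p_def q_def by (simp add: power3_eq_cube power2_eq_square algebra_simps)
  moreover have "1/3 * cmod \<zeta> \<le> p\<^sup>2 - 3 * q\<^sup>2" using q5 by (simp add: cm)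
  then have "p * (1/3 * cmod \<zeta>) \<le> p * (p\<^sup>2 - 3 * q\<^sup>2)" using p0 by (rule mult_left_mono)
  ultimately show "1/3 * cmod \<zeta> * Re (csqrt \<zeta>) \<le> Re (csqrt \<zeta> ^ 3)" unfolding pr p_def[symmetric] by (simp add: mult_ac)
qed

text \<open>Growth of order \<open>1\<close> is less than the critical order \<open>2\<close> of a quadrant. Multiplication by
  \<open>exp (- d \<zeta> powr (3/2))\<close>, where \<open>\<zeta>\<close> is the quadrant rotated onto \<open>|arg \<zeta>| \<le> pi/4\<close> and shifted to the right by
  \<open>1\<close>, makes \<open>f\<close> small on large arcs without increasing it anywhere. The maximum principle on a quarter disc
  and the limit \<open>d \<rightarrow> 0\<close> give the bound.\<close>

lemma Phragmen_Lindeloef_quadrant: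
  assumes hol: "f holomorphic_on UNIV"
    and growth: "\<And>z. cmod (f z) \<le> C * exp (c * cmod z)"
    and A: "0 < A" and re: "\<And>x. 0 \<le> x \<Longrightarrow> cmod (f (of_real x)) \<le> A"
    and im: "\<And>y. 0 \<le> y \<Longrightarrow> cmod (f (\<i> * of_real y)) \<le> A"
    and z: "0 \<le> Re z" "0 \<le> Im z"
  shows "cmod (f z) \<le> A"
proof -
  define \<zeta> where "\<zeta> w = 1 + cis (- (pi/4)) * w" for w
  define s where "s w = csqrt (\<zeta> w)" for w
  have \<zeta>: "1 \<le> Re (\<zeta> w)" "\<bar>Im (\<zeta> w)\<bar> \<le> Re (\<zeta> w)" "cmod w \<le> cmod (\<zeta> w)"
    if "0 \<le> Re w" "0 \<le> Im w" for w
  proof -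
    have r: "Re (\<zeta> w) = 1 + sqrt 2 / 2 * (Re w + Im w)"
      by (simp add: \<zeta>_def cos_45 sin_45 algebra_simps)
    have i: "Im (\<zeta> w) = sqrt 2 / 2 * (Im w - Re w)"
      by (simp add: \<zeta>_def cos_45 sin_45 algebra_simps)
    show "1 \<le> Re (\<zeta> w)" using that by (simp add: r)
    have "sqrt 2 / 2 * \<bar>Im w - Re w\<bar> \<le> sqrt 2 / 2 * (Re w + Im w)"
      using that by (intro mult_left_mono) auto
    moreover have "\<bar>Im (\<zeta> w)\<bar> = sqrt 2 / 2 * \<bar>Im w - Re w\<bar>" by (simp add: i abs_mult)
    ultimately show "\<bar>Im (\<zeta> w)\<bar> \<le> Re (\<zeta> w)" unfolding r by linarith
    have "(cmod w)\<^sup>2 \<le> (cmod (\<zeta> w))\<^sup>2"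
    proof -
      have "(sqrt 2 / 2)\<^sup>2 = (1/2::real)" by (simp add: power_divide)
      then have "(sqrt 2 / 2 * (Re w + Im w))\<^sup>2 = (Re w + Im w)\<^sup>2 / 2"
        "(sqrt 2 / 2 * (Im w - Re w))\<^sup>2 = (Im w - Re w)\<^sup>2 / 2"
        by (auto simp only: power_mult_distrib)
      moreover have "(Re w + Im w)\<^sup>2 / 2 + (Im w - Re w)\<^sup>2 / 2 = (cmod w)\<^sup>2"
        unfolding cmod_power2 by (simp add: power2_eq_square field_simps)
      moreover have "(sqrt 2 / 2 * (Re w + Im w))\<^sup>2 \<le> (1 + sqrt 2 / 2 * (Re w + Im w))\<^sup>2"
        using that by (intro power_mono) auto
      ultimately show ?thesis by (simp add: cmod_power2 r i)
    qed
    then show "cmod w \<le> cmod (\<zeta> w)" by (rule power2_le_imp_le) simp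
  qed
  have damped: "cmod (f z) * exp (- d * Re (s z ^ 3)) \<le> A" if d: "0 < d" for d
  proof -
    define h where "h w = f w * exp (- of_real d * s w ^ 3)" for w
    have hn: "cmod (h w) = cmod (f w) * exp (- d * Re (s w ^ 3))" for w
      by (simp add: h_def norm_mult)
    have spos: "0 \<le> Re (s w ^ 3)" if "0 \<le> Re w" "0 \<le> Im w" for w
      using csqrt_cube_growth(1,3)[OF \<zeta>(1,2)[OF that]] unfolding s_def
      by (smt (verit) mult_nonneg_nonneg norm_ge_zero divide_nonneg_pos)
    have small: "cmod (h w) \<le> cmod (f w)" if "0 \<le> Re w" "0 \<le> Im w" for w
      unfolding hn using spos[OF that] d by (intro mult_left_le) auto
    \<comment> \<open>once \<open>Re (s w) \<ge> Q\<close>, the damping exceeds the growth \<open>exp (c |w|)\<close> by \<open>exp |w|\<close>\<close>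
    define Q where "Q = 3 * (\<bar>c\<bar> + 1) / d"
    have C: "0 \<le> C" using growth[of 0] by (smt (verit) mult_neg_pos exp_gt_zero norm_ge_zero)
    \<comment> \<open>the radius is so large that \<open>Q \<le> Re (s w)\<close> on the arc and \<open>C / R \<le> A\<close>\<close>
    define R where "R = 1 + cmod z + 6/5 * Q\<^sup>2 + C / A"
    have Rpos: "0 < R" using A C by (auto simp: R_def intro!: add_pos_nonneg)
    have arc: "cmod (h w) \<le> A" if w: "0 \<le> Re w" "0 \<le> Im w" "cmod w = R" for w
    proof -
      note g = csqrt_cube_growth[OF \<zeta>(1,2)[OF w(1,2)], folded s_def]
      have "6/5 * Q\<^sup>2 \<le> R" using A C by (auto simp: R_def)
      then have "Q\<^sup>2 \<le> (Re (s w))\<^sup>2" using g(2) \<zeta>(3)[OF w(1,2)] w(3) by simp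
      then have Q: "Q \<le> Re (s w)" by (rule power2_le_imp_le) (use g(1) in linarith)
      have "d * Q = 3 * (\<bar>c\<bar> + 1)" unfolding Q_def using d by simp
      then have "(\<bar>c\<bar> + 1) * R = d * (1/3 * R * Q)" by (simp add: mult.left_commute[of d])
      also have "\<dots> \<le> d * (1/3 * cmod (\<zeta> w) * Re (s w))"
        using d Q \<zeta>(3)[OF w(1,2)] w(3) Rpos g(1)
        by (intro mult_left_mono mult_mono) (auto simp: Q_def)
      also have "\<dots> \<le> d * Re (s w ^ 3)" using g(3) d by (intro mult_left_mono) auto
      finally have e: "(\<bar>c\<bar> + 1) * R \<le> d * Re (s w ^ 3)" .
      have "c * R \<le> \<bar>c\<bar> * R" using Rpos by (intro mult_right_mono) auto
      with e have "c * R - d * Re (s w ^ 3) \<le> - R" by (simp add: algebra_simps)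
      then have "exp (c * R - d * Re (s w ^ 3)) \<le> exp (- R)" by simp
      moreover have "cmod (h w) \<le> C * exp (c * R) * exp (- d * Re (s w ^ 3))"
        unfolding hn using growth[of w] w(3) by (intro mult_right_mono) auto
      ultimately have "cmod (h w) \<le> C * exp (- R)"
        using C by (smt (verit) exp_add mult.assoc mult_left_mono mult_minus_left)
      also have "exp (- R) \<le> 1 / R"
      proof -
        have "R \<le> exp R" using exp_ge_add_one_self[of R] by linarith
        then show ?thesis using Rpos by (simp add: exp_minus field_simps)
      qed
      then have "C * exp (- R) \<le> C * (1 / R)" using C by (rule mult_left_mono)
      also have "\<dots> \<le> A"
      proof -
        have "C / A \<le> R" using A C by (auto simp: R_def intro!: add_nonneg_nonneg)
        then show ?thesis using Rpos A by (simp add: field_simps)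
      qed
      finally show ?thesis .
    qed
    define S where "S = {w. 0 \<le> Re w} \<inter> {w. 0 \<le> Im w} \<inter> cball 0 R"
    have Sclosed: "closed S"
      unfolding S_def by (intro closed_Int closed_cball closed_halfspace_Re_ge closed_halfspace_Im_ge)
    have int: "{w. 0 < Re w} \<inter> {w. 0 < Im w} \<inter> ball 0 R \<subseteq> interior S"
      by (rule interior_maximal)
         (auto simp: S_def intro!: open_Int open_halfspace_Re_gt open_halfspace_Im_gt)
    have holh: "h holomorphic_on {w. 0 \<le> Re w} \<inter> {w. 0 \<le> Im w}"
    proof -
      have 1: "\<zeta> w \<notin> \<real>\<^sub>\<le>\<^sub>0" if "0 \<le> Re w" "0 \<le> Im w" for w
        using \<zeta>(1)[OF that] by (auto simp: complex_nonpos_Reals_iff)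
      have 2: "\<zeta> holomorphic_on {w. 0 \<le> Re w} \<inter> {w. 0 \<le> Im w}"
        unfolding \<zeta>_def by (intro holomorphic_intros)
      show ?thesis
        unfolding h_def s_def by (intro holomorphic_intros holomorphic_on_subset[OF hol] 2) (use 1 in auto)
    qed
    have "cmod (h z) \<le> A"
    proof (rule maximum_modulus_frontier[of h S])
      show "h holomorphic_on interior S"
        by (rule holomorphic_on_subset[OF holh]) (use interior_subset S_def in auto)
      show "continuous_on (closure S) h"
        by (rule continuous_on_subset[OF holomorphic_on_imp_continuous_on[OF holh]])
           (use Sclosed S_def in auto)
      show "bounded S" unfolding S_def by (intro bounded_Int) auto
      show "z \<in> S" using z A C by (auto simp: S_def R_def intro!: add_nonneg_nonneg)
      fix w assume "w \<in> frontier S"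
      then have "w \<in> S" "w \<notin> interior S" using Sclosed by (auto simp: frontier_def)
      then consider "Re w = 0" "0 \<le> Im w" | "Im w = 0" "0 \<le> Re w" | "cmod w = R" "0 \<le> Re w" "0 \<le> Im w"
      proof -
        have "0 \<le> Re w" "0 \<le> Im w" "cmod w \<le> R" using \<open>w \<in> S\<close> by (auto simp: S_def)
        moreover have "\<not> (0 < Re w \<and> 0 < Im w \<and> cmod w < R)"
          using \<open>w \<notin> interior S\<close> int by auto
        ultimately show thesis using that by argo
      qed
      then show "cmod (h w) \<le> A"
      proof cases
        case 1
        then have "w = \<i> * of_real (Im w)" by (simp add: complex_eq_iff)
        then have "cmod (f w) \<le> A" using im[OF 1(2)] by simp
        then show ?thesis using small[of w] 1 by simp
      next
        case 2
        then have "w = of_real (Re w)" by (simp add: complex_eq_iff)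
        then have "cmod (f w) \<le> A" using re[OF 2(2)] by simp
        then show ?thesis using small[of w] 2 by simp
      next
        case 3 then show ?thesis by (intro arc)
      qed
    qed
    then show ?thesis by (simp add: hn)
  qed
  have "((\<lambda>d. cmod (f z) * exp (- d * Re (s z ^ 3))) \<longlongrightarrow> cmod (f z) * exp (- 0 * Re (s z ^ 3))) (at_right 0)"
    by (intro tendsto_intros)
  then have "((\<lambda>d. cmod (f z) * exp (- d * Re (s z ^ 3))) \<longlongrightarrow> cmod (f z)) (at_right 0)"
    by simp
  moreover have "\<forall>\<^sub>F d in at_right 0. cmod (f z) * exp (- d * Re (s z ^ 3)) \<le> A"
    by (rule eventually_mono[OF eventually_at_right_less]) (rule damped)
  ultimately show ?thesis
    by (rule tendsto_upperbound) simp
qed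

lemma entire_zero_on_reals:
  assumes "w holomorphic_on UNIV" "\<And>x. w (of_real x) = 0"
  shows "w z = 0"
proof (rule analytic_continuation[OF assms(1) open_UNIV connected_UNIV, of "range of_real" 0])
  show "(0::complex) islimpt range of_real"
    unfolding islimpt_approachable
  proof (intro allI impI)
    fix e :: real assume "0 < e"
    then show "\<exists>x'\<in>range of_real. x' \<noteq> 0 \<and> dist x' (0::complex) < e"
      by (intro bexI[OF _ rangeI[of _ "e/2"]]) auto
  qed
qed (use assms(2) in auto)

lemma continuous_on_entire_of_real:
  assumes "w holomorphic_on UNIV"
  shows "continuous_on S (\<lambda>x. w (of_real x))"
  by (rule continuous_on_compose2[OF holomorphic_on_imp_continuous_on[OF assms]]) (auto intro!: continuous_intros)

lemma exponential_type_growth: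
  assumes "exponential_type \<tau> F" "0 < \<epsilon>"
  obtains C where "0 < C" "\<And>z. cmod (F z) \<le> C * exp ((\<tau> + \<epsilon>) * cmod z)"
  using assms unfolding exponential_type_def by blast

lemma exponential_type_reflect:
  assumes "exponential_type \<tau> F"
  shows "exponential_type \<tau> (\<lambda>z. F (- z))"
proof -
  have "(F \<circ> uminus) holomorphic_on UNIV"
    using assms unfolding exponential_type_def
    by (intro holomorphic_on_compose_gen[of _ _ _ UNIV] holomorphic_intros) auto
  moreover have "\<exists>C>0. \<forall>z. cmod (F (- z)) \<le> C * exp ((\<tau> + \<epsilon>) * cmod z)" if "0 < \<epsilon>" for \<epsilon>
    using exponential_type_growth[OF assms that] by (metis norm_minus_cancel)
  ultimately show ?thesis by (simp add: exponential_type_def comp_def)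
qed

lemma exponential_type_diff:
  assumes "exponential_type \<tau> F" "exponential_type \<tau> G"
  shows "exponential_type \<tau> (\<lambda>z. F z - G z)"
  unfolding exponential_type_def
proof (intro conjI allI impI)
  show "(\<lambda>z. F z - G z) holomorphic_on UNIV"
    using assms by (intro holomorphic_intros) (auto simp: exponential_type_def)
  fix \<epsilon> :: real assume \<epsilon>: "0 < \<epsilon>"
  obtain A where A: "0 < A" "\<And>z. cmod (F z) \<le> A * exp ((\<tau> + \<epsilon>) * cmod z)"
    using exponential_type_growth[OF assms(1) \<epsilon>] by blast
  obtain B where B: "0 < B" "\<And>z. cmod (G z) \<le> B * exp ((\<tau> + \<epsilon>) * cmod z)"
    using exponential_type_growth[OF assms(2) \<epsilon>] by blast
  have "cmod (F z - G z) \<le> (A + B) * exp ((\<tau> + \<epsilon>) * cmod z)" for z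
    unfolding distrib_right[of A B] by (intro order_trans[OF norm_triangle_ineq4] add_mono A B)
  then show "\<exists>C>0. \<forall>z. cmod (F z - G z) \<le> C * exp ((\<tau> + \<epsilon>) * cmod z)"
    using A(1) B(1) by (intro exI[of _ "A + B"]) auto
qed

lemma exponential_type_zero: "exponential_type pi (\<lambda>_. 0)"
  by (auto simp: exponential_type_def intro!: exI[of _ 1])

text \<open>The factor \<open>exp (\<i> (\<tau> + \<epsilon>) z)\<close> has modulus \<open>1\<close> on the real axis and compensates the growth of \<open>F\<close> on the
  imaginary axis, so the principle applies to the product in each of the two upper quadrants.\<close>

lemma exponential_type_bounded_on_reals_upper:
  assumes F: "exponential_type \<tau> F" and \<tau>: "0 \<le> \<tau>" and \<epsilon>: "0 < \<epsilon>"
    and bounded: "\<And>x. cmod (F (of_real x)) \<le> A"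
  obtains B where "0 < B" "\<And>z. 0 \<le> Im z \<Longrightarrow> cmod (F z) \<le> B * exp ((\<tau> + \<epsilon>) * Im z)"
proof -
  obtain C where C: "0 < C" "\<And>z. cmod (F z) \<le> C * exp ((\<tau> + \<epsilon>) * cmod z)"
    using exponential_type_growth[OF F \<epsilon>] by blast
  define v where "v z = F z * exp (\<i> * of_real (\<tau> + \<epsilon>) * z)" for z
  have vn: "cmod (v z) = cmod (F z) * exp (- (\<tau> + \<epsilon>) * Im z)" for z
    by (simp add: v_def norm_mult algebra_simps)
  have hv: "v holomorphic_on UNIV"
    using F unfolding v_def exponential_type_def by (intro holomorphic_intros) auto
  have gv: "cmod (v z) \<le> C * exp (2 * (\<tau> + \<epsilon>) * cmod z)" for z
  proof -
    have "- (\<tau> + \<epsilon>) * Im z \<le> (\<tau> + \<epsilon>) * cmod z"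
      using abs_Im_le_cmod[of z] \<tau> \<epsilon> mult_left_mono[of "- Im z" "cmod z" "\<tau> + \<epsilon>"]
      by (simp add: algebra_simps abs_le_iff)
    then have "cmod (v z) \<le> C * exp ((\<tau> + \<epsilon>) * cmod z) * exp ((\<tau> + \<epsilon>) * cmod z)"
      unfolding vn using C by (intro mult_mono) auto
    then show ?thesis by (simp add: mult.assoc algebra_simps flip: exp_add)
  qed
  define B where "B = max A C"
  have B: "0 < B" using C by (simp add: B_def)
  have vre: "cmod (v (of_real x)) \<le> B" for x
    using bounded[of x] by (simp add: vn B_def)
  have vim: "cmod (v (\<i> * of_real y)) \<le> B" if "0 \<le> y" for y
  proof -
    have "cmod (v (\<i> * of_real y)) \<le> C * exp ((\<tau> + \<epsilon>) * y) * exp (- (\<tau> + \<epsilon>) * y)"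
      unfolding vn using C(2)[of "\<i> * of_real y"] that C(1) by (intro mult_mono) (auto simp: norm_mult)
    also have "\<dots> = C" by (simp add: mult.assoc algebra_simps flip: exp_add)
    finally show ?thesis by (simp add: B_def)
  qed
  have "cmod (v z) \<le> B" if "0 \<le> Im z" for z
  proof (cases "0 \<le> Re z")
    case True
    show ?thesis
      by (rule Phragmen_Lindeloef_quadrant[OF hv gv B vre vim True that])
  next
    case False
    have "cmod ((\<lambda>w. v (\<i> * w)) (- \<i> * z)) \<le> B"
    proof (rule Phragmen_Lindeloef_quadrant[where f = "\<lambda>w. v (\<i> * w)" and z = "- \<i> * z" and c = "2 * (\<tau> + \<epsilon>)" and C = C])
      have "(v \<circ> (\<lambda>w. \<i> * w)) holomorphic_on UNIV"
        by (intro holomorphic_on_compose_gen[OF _ hv] holomorphic_intros) auto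
      then show "(\<lambda>w. v (\<i> * w)) holomorphic_on UNIV" by (simp add: comp_def)
      show "cmod (v (\<i> * z)) \<le> C * exp (2 * (\<tau> + \<epsilon>) * cmod z)" for z
        using gv[of "\<i> * z"] by (simp add: norm_mult)
      show "cmod (v (\<i> * (\<i> * of_real y))) \<le> B" for y
        using vre[of "- y"] by simp
    qed (use B vim False that in auto)
    then show ?thesis by simp
  qed
  then have "cmod (F z) \<le> B * exp ((\<tau> + \<epsilon>) * Im z)" if "0 \<le> Im z" for z
  proof -
    have "cmod (F z) = cmod (v z) * exp ((\<tau> + \<epsilon>) * Im z)"
      by (simp add: vn mult.assoc algebra_simps flip: exp_add)
    also have "\<dots> \<le> B * exp ((\<tau> + \<epsilon>) * Im z)"
      using \<open>\<And>z. 0 \<le> Im z \<Longrightarrow> cmod (v z) \<le> B\<close>[OF that] by (intro mult_right_mono) auto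
    finally show ?thesis .
  qed
  then show ?thesis by (rule that[OF B])
qed

lemma exponential_type_bounded_on_reals:
  assumes F: "exponential_type \<tau> F" and \<tau>: "0 \<le> \<tau>" and \<epsilon>: "0 < \<epsilon>"
    and bounded: "\<And>x. cmod (F (of_real x)) \<le> A"
  obtains B where "0 < B" "\<And>z. cmod (F z) \<le> B * exp ((\<tau> + \<epsilon>) * \<bar>Im z\<bar>)"
proof -
  obtain B1 where B1: "0 < B1" "\<And>z. 0 \<le> Im z \<Longrightarrow> cmod (F z) \<le> B1 * exp ((\<tau> + \<epsilon>) * Im z)"
    using exponential_type_bounded_on_reals_upper[OF F \<tau> \<epsilon> bounded] by blast
  have "cmod (F (- of_real x)) \<le> A" for x using bounded[of "- x"] by simp
  then obtain B2 where B2: "0 < B2" "\<And>z. 0 \<le> Im z \<Longrightarrow> cmod (F (- z)) \<le> B2 * exp ((\<tau> + \<epsilon>) * Im z)"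
    using exponential_type_bounded_on_reals_upper[OF exponential_type_reflect[OF F] \<tau> \<epsilon>, of A] by blast
  have "cmod (F z) \<le> (B1 + B2) * exp ((\<tau> + \<epsilon>) * \<bar>Im z\<bar>)" for z
  proof (cases "0 \<le> Im z")
    case True
    then show ?thesis using B1(2)[OF True] B2(1) by (simp add: distrib_right add_increasing2)
  next
    case False
    then show ?thesis using B2(2)[of "- z"] B1(1) by (simp add: distrib_right add_increasing)
  qed
  moreover have "0 < B1 + B2" using B1(1) B2(1) by simp
  ultimately show ?thesis by (intro that)
qed

section \<open>The spectrum of an integrable function of exponential type\<close>

lemma entire_primitive_through_origin:
  assumes "w holomorphic_on UNIV"
  obtains P where "P 0 = 0" "\<And>z. (P has_field_derivative w z) (at z)"
proof -
  obtain Q where Q: "\<And>z. (Q has_field_derivative w z) (at z)"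
    using holomorphic_convex_primitive'[OF convex_UNIV open_UNIV assms] by auto
  show ?thesis
    by (rule that[of "\<lambda>z. Q z - Q 0"]) (auto intro!: derivative_eq_intros Q)
qed

lemma integral_along_horizontal_line:
  assumes P: "\<And>z. (P has_field_derivative w z) (at z)" and ab: "a \<le> b"
  shows "(\<integral>x. indicator {a..b} x *\<^sub>R w (Complex x y) \<partial>lborel) = P (Complex b y) - P (Complex a y)"
proof (rule integral_FTC_Icc[OF ab])
  have w: "w holomorphic_on UNIV"
    by (rule derivative_is_holomorphic[OF open_UNIV]) (rule P)
  show "continuous_on {a..b} (\<lambda>x. w (Complex x y))"
    unfolding Complex_eq
    by (rule continuous_on_compose2[OF holomorphic_on_imp_continuous_on[OF w]]) (auto intro!: continuous_intros)
  fix x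
  have "((\<lambda>z. P (z + \<i> * of_real y)) has_field_derivative w (of_real x + \<i> * of_real y)) (at (of_real x))"
    using P[of "of_real x + \<i> * of_real y"] by (subst DERIV_shift[symmetric]) (simp add: add.commute)
  from has_vector_derivative_real_field[OF this]
  show "((\<lambda>x. P (Complex x y)) has_vector_derivative w (Complex x y)) (at x within {a..b})"
    unfolding Complex_eq .
qed

lemma exponential_type_primitive:
  assumes w: "exponential_type \<tau> w" and \<tau>: "0 \<le> \<tau>"
    and P: "P 0 = 0" "\<And>z. (P has_field_derivative w z) (at z)"
  shows "exponential_type \<tau> P"
  unfolding exponential_type_def
proof (intro conjI allI impI)
  show "P holomorphic_on UNIV"
    using P(2) by (auto simp: holomorphic_on_def field_differentiable_def)
  fix \<epsilon> :: real assume \<epsilon>: "0 < \<epsilon>"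
  then obtain C where C: "0 < C" "\<And>z. cmod (w z) \<le> C * exp ((\<tau> + \<epsilon>/2) * cmod z)"
    using exponential_type_growth[OF w, of "\<epsilon>/2"] by auto
  have "cmod (P z) \<le> 2 * C / \<epsilon> * exp ((\<tau> + \<epsilon>) * cmod z)" for z
  proof -
    have "cmod (P z - P 0) \<le> C * exp ((\<tau> + \<epsilon>/2) * cmod z) * cmod (z - 0)"
    proof (rule field_differentiable_bound[where S = "cball 0 (cmod z)"])
      fix \<zeta> :: complex assume "\<zeta> \<in> cball 0 (cmod z)"
      then have "(\<tau> + \<epsilon>/2) * cmod \<zeta> \<le> (\<tau> + \<epsilon>/2) * cmod z"
        using \<tau> \<epsilon> by (intro mult_left_mono) auto
      then have "C * exp ((\<tau> + \<epsilon>/2) * cmod \<zeta>) \<le> C * exp ((\<tau> + \<epsilon>/2) * cmod z)"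
        using C(1) by simp
      with C(2)[of \<zeta>] show "cmod (w \<zeta>) \<le> C * exp ((\<tau> + \<epsilon>/2) * cmod z)" by simp
    qed (use P(2) in \<open>auto intro: DERIV_subset\<close>)
    also have "\<dots> = 2 * C / \<epsilon> * (exp ((\<tau> + \<epsilon>/2) * cmod z) * (\<epsilon>/2 * cmod z))" using \<epsilon> by simp
    also have "\<dots> \<le> 2 * C / \<epsilon> * (exp ((\<tau> + \<epsilon>/2) * cmod z) * exp (\<epsilon>/2 * cmod z))"
    proof (intro mult_left_mono)
      show "\<epsilon>/2 * cmod z \<le> exp (\<epsilon>/2 * cmod z)"
        using exp_ge_add_one_self[of "\<epsilon>/2 * cmod z"] by linarith
    qed (use C \<epsilon> in auto)
    also have "exp ((\<tau> + \<epsilon>/2) * cmod z) * exp (\<epsilon>/2 * cmod z) = exp ((\<tau> + \<epsilon>) * cmod z)"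
      by (simp add: algebra_simps flip: exp_add)
    finally show ?thesis using P(1) by simp
  qed
  then show "\<exists>C>0. \<forall>z. cmod (P z) \<le> C * exp ((\<tau> + \<epsilon>) * cmod z)"
    using C(1) \<epsilon> by (intro exI[of _ "2 * C / \<epsilon>"]) auto
qed

text \<open>The primitive of an integrable function is bounded on the real axis, hence bounded by a multiple of
  \<open>exp ((\<tau> + \<epsilon>) |Im z|)\<close>. Cauchy's inequality on unit discs transfers this to the derivative.\<close>

lemma exponential_type_L1_bound:
  assumes w: "exponential_type \<tau> w" and \<tau>: "0 \<le> \<tau>" and \<epsilon>: "0 < \<epsilon>"
    and L1: "integrable lborel (\<lambda>x. w (of_real x))"
  obtains B where "0 < B" "\<And>z. cmod (w z) \<le> B * exp ((\<tau> + \<epsilon>) * \<bar>Im z\<bar>)"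
proof -
  have hol: "w holomorphic_on UNIV" using w by (simp add: exponential_type_def)
  obtain P where P: "P 0 = 0" "\<And>z. (P has_field_derivative w z) (at z)"
    using entire_primitive_through_origin[OF hol] by blast
  let ?A = "\<integral>x. cmod (w (of_real x)) \<partial>lborel"
  have seg: "cmod (P (of_real b) - P (of_real a)) \<le> ?A" if "a \<le> b" for a b
  proof -
    have "P (of_real b) - P (of_real a) = (\<integral>x. indicator {a..b} x *\<^sub>R w (of_real x) \<partial>lborel)"
      using integral_along_horizontal_line[OF P(2) that, of 0] by (simp add: complex_of_real_def)
    also have "cmod \<dots> \<le> (\<integral>x. cmod (indicator {a..b} x *\<^sub>R w (of_real x)) \<partial>lborel)"
      by (rule integral_norm_bound)
    also have "\<dots> \<le> ?A"
      using L1 by (intro integral_mono integrable_norm integrable_mult_indicator) (auto split: split_indicator)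
    finally show ?thesis .
  qed
  have "cmod (P (of_real x)) \<le> ?A" for x
    using seg[of 0 x] seg[of x 0] P(1) by (cases "0 \<le> x") auto
  then obtain B where B: "0 < B" "\<And>z. cmod (P z) \<le> B * exp ((\<tau> + \<epsilon>) * \<bar>Im z\<bar>)"
    using exponential_type_bounded_on_reals[OF exponential_type_primitive[OF w \<tau> P] \<tau> \<epsilon>] by blast
  have "cmod (w z) \<le> B * exp (\<tau> + \<epsilon>) * exp ((\<tau> + \<epsilon>) * \<bar>Im z\<bar>)" for z
  proof -
    have "cmod ((deriv ^^ 1) P z) \<le> fact 1 * (B * exp ((\<tau> + \<epsilon>) * (\<bar>Im z\<bar> + 1))) / 1 ^ 1"
    proof (rule Cauchy_inequality)
      have "P holomorphic_on UNIV"
        using P(2) by (auto simp: holomorphic_on_def field_differentiable_def)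
      then show "P holomorphic_on ball z 1" "continuous_on (cball z 1) P"
        by (auto intro: holomorphic_on_subset holomorphic_on_imp_continuous_on continuous_on_subset)
      fix x assume "norm (z - x) = 1"
      then have "\<bar>Im x\<bar> \<le> \<bar>Im z\<bar> + 1"
        using abs_Im_le_cmod[of "z - x"] by simp
      then have "(\<tau> + \<epsilon>) * \<bar>Im x\<bar> \<le> (\<tau> + \<epsilon>) * (\<bar>Im z\<bar> + 1)"
        using \<tau> \<epsilon> by (intro mult_left_mono) auto
      then show "norm (P x) \<le> B * exp ((\<tau> + \<epsilon>) * (\<bar>Im z\<bar> + 1))"
        using B(1) by (intro order_trans[OF B(2)]) simp
    qed simp
    moreover have "deriv P z = w z" using P(2) by (rule DERIV_imp_deriv)
    ultimately show ?thesis by (simp add: distrib_left exp_add mult_ac)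
  qed
  with B(1) show ?thesis by (intro that[of "B * exp (\<tau> + \<epsilon>)"]) auto
qed

lemma gaussian_integral:
  assumes \<sigma>: "0 < \<sigma>"
  shows "integrable lborel (\<lambda>x. exp (- x\<^sup>2 / (2 * \<sigma>\<^sup>2)))"
    "(\<integral>x. exp (- x\<^sup>2 / (2 * \<sigma>\<^sup>2)) \<partial>lborel) = sqrt (2 * pi) * \<sigma>"
proof -
  have e: "exp (- x\<^sup>2 / (2 * \<sigma>\<^sup>2)) = sqrt (2 * pi) * \<sigma> * normal_density 0 \<sigma> x" for x
    using \<sigma> by (simp add: normal_density_def real_sqrt_mult)
  show "integrable lborel (\<lambda>x. exp (- x\<^sup>2 / (2 * \<sigma>\<^sup>2)))"
    unfolding e by (intro integrable_mult_right integrable_normal_density \<sigma>)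
  show "(\<integral>x. exp (- x\<^sup>2 / (2 * \<sigma>\<^sup>2)) \<partial>lborel) = sqrt (2 * pi) * \<sigma>"
    unfolding e using integral_normal_density[OF \<sigma>, of 0] by simp
qed

text \<open>The Gaussian makes it possible to move the line of integration from the real axis down to \<open>Im z = - \<sigma>\<close>. There
  the exponential kernel gains \<open>exp (- 2 pi t \<sigma>)\<close>, which beats the growth \<open>exp (a \<sigma>)\<close> of \<open>w\<close>, and the
  Gaussian itself only costs the factor \<open>exp (1/2)\<close>.\<close>

lemma gaussian_fourier_bound:
  assumes w: "w holomorphic_on UNIV" and B: "0 < B" "\<And>z. cmod (w z) \<le> B * exp (a * \<bar>Im z\<bar>)"
    and \<epsilon>: "0 < \<epsilon>" and t: "a + \<epsilon> = 2 * pi * t" and \<sigma>: "0 < \<sigma>"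
  shows "cmod (\<integral>x. w (of_real x) * exp (- x\<^sup>2 / (2 * \<sigma>\<^sup>2)) * cis (- 2 * pi * x * t) \<partial>lborel)
    \<le> B * exp (1/2) * exp (- \<epsilon> * \<sigma>) * (sqrt (2 * pi) * \<sigma>)"
proof -
  define \<Psi> where "\<Psi> z = w z * exp (- z\<^sup>2 / (2 * (of_real \<sigma>)\<^sup>2) - 2 * of_real pi * \<i> * of_real t * z)" for z
  define M where "M = B * exp (1/2)"
  have M: "0 < M" using B by (simp add: M_def)
  have hol\<Psi>: "\<Psi> holomorphic_on UNIV"
    unfolding \<Psi>_def using w \<sigma> by (intro holomorphic_intros) auto
  have bound: "cmod (\<Psi> (Complex x (- s))) \<le> M * exp (- \<epsilon> * s) * exp (- x\<^sup>2 / (2 * \<sigma>\<^sup>2))"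
    if s: "0 \<le> s" "s \<le> \<sigma>" for x s
  proof -
    have "Re (- (Complex x (- s))\<^sup>2 / (2 * (of_real \<sigma>)\<^sup>2) - 2 * of_real pi * \<i> * of_real t * Complex x (- s))
        = (s\<^sup>2 - x\<^sup>2) / (2 * \<sigma>\<^sup>2) - 2 * pi * t * s"
    proof -
      have "- (Complex x (- s))\<^sup>2 / (2 * (of_real \<sigma>)\<^sup>2) = - (Complex x (- s))\<^sup>2 / of_real (2 * \<sigma>\<^sup>2)" by simp
      then show ?thesis by (simp only: minus_complex.sel Re_divide_of_real, simp add: Re_power2)
    qed
    then have "cmod (\<Psi> (Complex x (- s))) = cmod (w (Complex x (- s))) * exp ((s\<^sup>2 - x\<^sup>2) / (2 * \<sigma>\<^sup>2) - 2 * pi * t * s)"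
      unfolding \<Psi>_def norm_mult norm_exp_eq_Re by simp
    also have "\<dots> \<le> B * exp (a * s) * exp ((s\<^sup>2 - x\<^sup>2) / (2 * \<sigma>\<^sup>2) - 2 * pi * t * s)"
      using B(2)[of "Complex x (- s)"] s by (intro mult_right_mono) auto
    also have "\<dots> = B * exp (a * s + ((s\<^sup>2 - x\<^sup>2) / (2 * \<sigma>\<^sup>2) - 2 * pi * t * s))"
      by (simp add: mult.assoc flip: exp_add)
    also have "a * s + ((s\<^sup>2 - x\<^sup>2) / (2 * \<sigma>\<^sup>2) - 2 * pi * t * s) = s\<^sup>2 / (2 * \<sigma>\<^sup>2) + (- \<epsilon> * s) + (- x\<^sup>2 / (2 * \<sigma>\<^sup>2))"
      unfolding t[symmetric] by (simp add: algebra_simps diff_divide_distrib)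
    also have "B * exp \<dots> \<le> B * exp (1/2 + (- \<epsilon> * s) + (- x\<^sup>2 / (2 * \<sigma>\<^sup>2)))"
    proof -
      have "s\<^sup>2 \<le> \<sigma>\<^sup>2" using s by (intro power_mono) auto
      then have "s\<^sup>2 / (2 * \<sigma>\<^sup>2) \<le> 1/2" using \<sigma> by (simp add: field_simps)
      then show ?thesis using B(1) by simp
    qed
    also have "\<dots> = M * exp (- \<epsilon> * s) * exp (- x\<^sup>2 / (2 * \<sigma>\<^sup>2))"
      unfolding exp_add M_def by simp
    finally show ?thesis .
  qed
  obtain Q where Q: "\<And>z. (Q has_field_derivative \<Psi> z) (at z)"
    using entire_primitive_through_origin[OF hol\<Psi>] by blast
  have horizontal: "(\<integral>x. indicator {- R..R} x *\<^sub>R \<Psi> (Complex x y) \<partial>lborel) = Q (Complex R y) - Q (Complex (- R) y)"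
    if "0 \<le> R" for R y
    by (rule integral_along_horizontal_line[OF Q]) (use that in simp)
  have vertical: "cmod (Q (Complex x 0) - Q (Complex x (- \<sigma>))) \<le> M * exp (- x\<^sup>2 / (2 * \<sigma>\<^sup>2)) * \<sigma>" for x
  proof -
    have "cmod (Q (Complex x 0) - Q (Complex x (- \<sigma>))) \<le> M * exp (- x\<^sup>2 / (2 * \<sigma>\<^sup>2)) * cmod (Complex x 0 - Complex x (- \<sigma>))"
    proof (rule field_differentiable_bound[where S = "closed_segment (Complex x 0) (Complex x (- \<sigma>))"])
      fix z assume "z \<in> closed_segment (Complex x 0) (Complex x (- \<sigma>))"
      then obtain u where u: "0 \<le> u" "u \<le> 1" "z = Complex x (- (u * \<sigma>))"
        by (auto simp: closed_segment_def complex_eq_iff scaleR_conv_of_real algebra_simps)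
      have "exp (- \<epsilon> * (u * \<sigma>)) \<le> 1" using u \<epsilon> \<sigma> by simp
      then have "M * exp (- \<epsilon> * (u * \<sigma>)) \<le> M" using M by simp
      then have "M * exp (- \<epsilon> * (u * \<sigma>)) * exp (- x\<^sup>2 / (2 * \<sigma>\<^sup>2)) \<le> M * exp (- x\<^sup>2 / (2 * \<sigma>\<^sup>2))"
        by (rule mult_right_mono) simp
      then show "cmod (\<Psi> z) \<le> M * exp (- x\<^sup>2 / (2 * \<sigma>\<^sup>2))"
        unfolding u(3) using u \<sigma> by (intro order_trans[OF bound]) (auto simp: mult_left_le_one_le)
    qed (use Q in \<open>auto intro: DERIV_subset\<close>)
    also have "cmod (Complex x 0 - Complex x (- \<sigma>)) = \<sigma>" using \<sigma> by (simp add: cmod_def)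
    finally show ?thesis .
  qed
  note gi = gaussian_integral[OF \<sigma>]
  have meas\<Psi>: "(\<lambda>x. \<Psi> (Complex x y)) \<in> borel_measurable lborel" for y
  proof -
    have "(\<lambda>x. \<Psi> (Complex x y)) \<in> borel_measurable borel"
      unfolding Complex_eq
      by (intro borel_measurable_continuous_onI continuous_on_compose2[OF holomorphic_on_imp_continuous_on[OF hol\<Psi>]])
         (auto intro!: continuous_intros)
    then show ?thesis by simp
  qed
  have int\<Psi>: "integrable lborel (\<lambda>x. \<Psi> (Complex x (- s)))" if "0 \<le> s" "s \<le> \<sigma>" for s
    by (rule Bochner_Integration.integrable_bound[of _ "\<lambda>x. M * exp (- \<epsilon> * s) * exp (- x\<^sup>2 / (2 * \<sigma>\<^sup>2))"])
       (use bound[OF that] M meas\<Psi> gi(1) in \<open>auto\<close>)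
  have low: "cmod (\<integral>x. indicator {- R..R} x *\<^sub>R \<Psi> (Complex x (- \<sigma>)) \<partial>lborel) \<le> M * exp (- \<epsilon> * \<sigma>) * (sqrt (2 * pi) * \<sigma>)" for R
  proof -
    have "cmod (\<integral>x. indicator {- R..R} x *\<^sub>R \<Psi> (Complex x (- \<sigma>)) \<partial>lborel)
        \<le> (\<integral>x. cmod (indicator {- R..R} x *\<^sub>R \<Psi> (Complex x (- \<sigma>))) \<partial>lborel)"
      by (rule integral_norm_bound)
    also have "\<dots> \<le> (\<integral>x. M * exp (- \<epsilon> * \<sigma>) * exp (- x\<^sup>2 / (2 * \<sigma>\<^sup>2)) \<partial>lborel)"
    proof (rule integral_mono)
      show "integrable lborel (\<lambda>x. cmod (indicator {- R..R} x *\<^sub>R \<Psi> (Complex x (- \<sigma>))))"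
        using int\<Psi>[of \<sigma>] \<sigma> by (intro integrable_norm integrable_mult_indicator) auto
      show "integrable lborel (\<lambda>x. M * exp (- \<epsilon> * \<sigma>) * exp (- x\<^sup>2 / (2 * \<sigma>\<^sup>2)))"
        by (intro integrable_mult_right gi(1))
      show "cmod (indicator {- R..R} x *\<^sub>R \<Psi> (Complex x (- \<sigma>))) \<le> M * exp (- \<epsilon> * \<sigma>) * exp (- x\<^sup>2 / (2 * \<sigma>\<^sup>2))" for x
        using bound[of \<sigma> x] \<sigma> M by (simp split: split_indicator)
    qed
    finally show ?thesis by (simp only: integral_mult_right_zero gi(2))
  qed
  have fin: "cmod (\<integral>x. indicator {- real n..real n} x *\<^sub>R \<Psi> (Complex x 0) \<partial>lborel)
      \<le> M * exp (- \<epsilon> * \<sigma>) * (sqrt (2 * pi) * \<sigma>) + 2 * M * \<sigma> * exp (- (real n)\<^sup>2 / (2 * \<sigma>\<^sup>2))" for n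
  proof -
    let ?R = "real n"
    have "(\<integral>x. indicator {- ?R..?R} x *\<^sub>R \<Psi> (Complex x 0) \<partial>lborel)
        = (\<integral>x. indicator {- ?R..?R} x *\<^sub>R \<Psi> (Complex x (- \<sigma>)) \<partial>lborel)
          + (Q (Complex ?R 0) - Q (Complex ?R (- \<sigma>))) - (Q (Complex (- ?R) 0) - Q (Complex (- ?R) (- \<sigma>)))"
      by (simp add: horizontal)
    also have "cmod \<dots> \<le> M * exp (- \<epsilon> * \<sigma>) * (sqrt (2 * pi) * \<sigma>) + M * exp (- ?R\<^sup>2 / (2 * \<sigma>\<^sup>2)) * \<sigma>
        + M * exp (- (- ?R)\<^sup>2 / (2 * \<sigma>\<^sup>2)) * \<sigma>"
      by (intro order_trans[OF norm_triangle_ineq4] add_mono order_trans[OF norm_triangle_ineq] low vertical)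
    finally show ?thesis by (simp add: mult_ac)
  qed
  have "(\<lambda>n. cmod (\<integral>x. indicator {- real n..real n} x *\<^sub>R \<Psi> (Complex x 0) \<partial>lborel)) \<longlonglongrightarrow> cmod (\<integral>x. \<Psi> (Complex x 0) \<partial>lborel)"
    using int\<Psi>[of 0] \<sigma> by (intro tendsto_norm integral_symmetric_intervals_limit filterlim_real_sequentially) auto
  moreover have "(\<lambda>n. M * exp (- \<epsilon> * \<sigma>) * (sqrt (2 * pi) * \<sigma>) + 2 * M * \<sigma> * exp (- (real n)\<^sup>2 / (2 * \<sigma>\<^sup>2)))
      \<longlonglongrightarrow> M * exp (- \<epsilon> * \<sigma>) * (sqrt (2 * pi) * \<sigma>)"
  proof -
    have "(\<lambda>n. exp (- (real n)\<^sup>2 / (2 * \<sigma>\<^sup>2))) \<longlonglongrightarrow> 0" using \<sigma> by real_asymp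
    from tendsto_add[OF tendsto_const tendsto_mult[OF tendsto_const this]]
    show ?thesis by simp
  qed
  ultimately have "cmod (\<integral>x. \<Psi> (Complex x 0) \<partial>lborel) \<le> M * exp (- \<epsilon> * \<sigma>) * (sqrt (2 * pi) * \<sigma>)"
    by (rule LIMSEQ_le) (use fin in auto)
  moreover have "\<Psi> (Complex x 0) = w (of_real x) * exp (- x\<^sup>2 / (2 * \<sigma>\<^sup>2)) * cis (- 2 * pi * x * t)" for x
  proof -
    have "- (complex_of_real x)\<^sup>2 / (2 * (of_real \<sigma>)\<^sup>2) - 2 * of_real pi * \<i> * of_real t * of_real x
       = of_real (- x\<^sup>2 / (2 * \<sigma>\<^sup>2)) + \<i> * of_real (- 2 * pi * x * t)"
      by (simp add: mult_ac)
    then show ?thesis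
      unfolding \<Psi>_def complex_of_real_def[symmetric] by (simp only: exp_add cis_conv_exp exp_of_real mult.assoc)
  qed
  ultimately show ?thesis by (simp add: M_def)
qed

text \<open>The transform is the limit of its Gaussian regularizations as the width tends to infinity, and those decay
  exponentially in the width.\<close>

lemma fourier_exponential_type_right:
  assumes w: "exponential_type \<tau> w" and \<tau>: "0 \<le> \<tau>"
    and L1: "integrable lborel (\<lambda>x. w (of_real x))" and t: "\<tau> < 2 * pi * t"
  shows "fourier (\<lambda>x. w (of_real x)) t = 0"
proof -
  define \<epsilon> where "\<epsilon> = (2 * pi * t - \<tau>) / 2"
  have \<epsilon>: "0 < \<epsilon>" and e: "(\<tau> + \<epsilon>) + \<epsilon> = 2 * pi * t" using t by (auto simp: \<epsilon>_def field_simps)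
  obtain B where B: "0 < B" "\<And>z. cmod (w z) \<le> B * exp ((\<tau> + \<epsilon>) * \<bar>Im z\<bar>)"
    using exponential_type_L1_bound[OF w \<tau> \<epsilon> L1] by blast
  have hol: "w holomorphic_on UNIV" using w by (simp add: exponential_type_def)
  let ?I = "\<lambda>n. \<integral>x. w (of_real x) * exp (- x\<^sup>2 / (2 * (real (Suc n))\<^sup>2)) * cis (- 2 * pi * x * t) \<partial>lborel"
  have "?I \<longlonglongrightarrow> (\<integral>x. w (of_real x) * cis (- 2 * pi * x * t) \<partial>lborel)"
  proof (rule integral_dominated_convergence[where w = "\<lambda>x. cmod (w (of_real x))"])
    show "AE x in lborel. (\<lambda>n. w (of_real x) * exp (- x\<^sup>2 / (2 * (real (Suc n))\<^sup>2)) * cis (- 2 * pi * x * t))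
        \<longlonglongrightarrow> w (of_real x) * cis (- 2 * pi * x * t)"
    proof (rule AE_I2)
      fix x :: real
      have "(\<lambda>n. exp (- x\<^sup>2 / (2 * (real (Suc n))\<^sup>2))) \<longlonglongrightarrow> 1" by real_asymp
      then have "(\<lambda>n. w (of_real x) * complex_of_real (exp (- x\<^sup>2 / (2 * (real (Suc n))\<^sup>2))) * cis (- 2 * pi * x * t))
        \<longlonglongrightarrow> w (of_real x) * of_real 1 * cis (- 2 * pi * x * t)"
        by (intro tendsto_intros)
      then show "(\<lambda>n. w (of_real x) * exp (- x\<^sup>2 / (2 * (real (Suc n))\<^sup>2)) * cis (- 2 * pi * x * t))
        \<longlonglongrightarrow> w (of_real x) * cis (- 2 * pi * x * t)" by simp
    qed
    show "AE x in lborel. norm (w (of_real x) * exp (- x\<^sup>2 / (2 * (real (Suc n))\<^sup>2)) * cis (- 2 * pi * x * t))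
       \<le> cmod (w (of_real x))" for n
      by (rule AE_I2) (simp add: norm_mult mult_left_le del: of_nat_Suc)
    show "integrable lborel (\<lambda>x. cmod (w (of_real x)))" using L1 by simp
  qed (use borel_measurable_integrable[OF L1] in measurable)
  moreover have "?I \<longlonglongrightarrow> 0"
  proof (rule Lim_null_comparison)
    show "\<forall>\<^sub>F n in sequentially. norm (?I n) \<le>
        B * exp (1/2) * exp (- \<epsilon> * real (Suc n)) * (sqrt (2 * pi) * real (Suc n))"
      using gaussian_fourier_bound[OF hol B \<epsilon> e] by (intro always_eventually allI) simp
    show "(\<lambda>n. B * exp (1/2) * exp (- \<epsilon> * real (Suc n)) * (sqrt (2 * pi) * real (Suc n))) \<longlonglongrightarrow> 0"
      using \<epsilon> by real_asymp
  qed
  ultimately show ?thesis unfolding fourier_cis by (rule LIMSEQ_unique)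
qed

text \<open>The endpoints \<open>2 pi |t| = \<tau>\<close> are included because the transform is continuous.\<close>

theorem fourier_exponential_type_eq_0:
  assumes w: "exponential_type \<tau> w" and \<tau>: "0 \<le> \<tau>"
    and L1: "integrable lborel (\<lambda>x. w (of_real x))" and t: "\<tau> \<le> 2 * pi * \<bar>t\<bar>" "t \<noteq> 0"
  shows "fourier (\<lambda>x. w (of_real x)) t = 0"
proof -
  have strict: "fourier (\<lambda>x. w (of_real x)) s = 0" if s: "\<tau> < 2 * pi * \<bar>s\<bar>" for s
  proof (cases "0 \<le> s")
    case True
    then show ?thesis using fourier_exponential_type_right[OF w \<tau> L1, of s] s by simp
  next
    case False
    have r: "(\<integral>x. f x \<partial>lborel) = (\<integral>x. f (- x) \<partial>lborel)" for f :: "real \<Rightarrow> complex"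
      using lborel_integral_real_affine[of "-1" f 0] by simp
    have i: "integrable lborel (\<lambda>x. w (- of_real x))"
      using lborel_integrable_real_affine[OF L1, of "-1" 0] by simp
    have "fourier (\<lambda>x. w (of_real x)) s = fourier (\<lambda>x. w (- of_real x)) (- s)"
      unfolding fourier_cis by (subst r) simp
    also have "\<dots> = 0"
      by (rule fourier_exponential_type_right[OF exponential_type_reflect[OF w] \<tau>]) (use i s False in auto)
    finally show ?thesis .
  qed
  have "(\<lambda>n. t * (1 + 1 / real (Suc n))) \<longlonglongrightarrow> t * (1 + 0)"
    by (intro tendsto_intros LIMSEQ_inverse_real_of_nat[unfolded inverse_eq_divide])
  then have "(\<lambda>n. fourier (\<lambda>x. w (of_real x)) (t * (1 + 1 / real (Suc n)))) \<longlonglongrightarrow> fourier (\<lambda>x. w (of_real x)) t"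
    using continuous_on_tendsto_compose[OF continuous_on_fourier[OF L1]] by simp
  moreover have "fourier (\<lambda>x. w (of_real x)) (t * (1 + 1 / real (Suc n))) = 0" for n
  proof (rule strict)
    have "2 * pi * \<bar>t\<bar> * 1 < 2 * pi * \<bar>t\<bar> * (1 + 1 / real (Suc n))"
      using t(2) by (intro mult_strict_left_mono) auto
    moreover have "\<bar>t * (1 + 1 / real (Suc n))\<bar> = \<bar>t\<bar> * (1 + 1 / real (Suc n))"
      unfolding abs_mult by (simp add: abs_of_nonneg del: of_nat_Suc)
    ultimately show "\<tau> < 2 * pi * \<bar>t * (1 + 1 / real (Suc n))\<bar>" using t(1) by (simp only: mult.assoc mult_1_right)
  qed
  ultimately show ?thesis using LIMSEQ_unique[OF _ tendsto_const] by simp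
qed

section \<open>Integration against the sign of the cosine\<close>

text \<open>For \<open>z = cis \<theta>\<close> the number \<open>(1 - \<i> z) / (1 + \<i> z)\<close> is \<open>- \<i>\<close> times a positive multiple of \<open>cos \<theta>\<close>.\<close>

lemma Re_Arctan_unit_circle:
  assumes "cos \<theta> \<noteq> 0"
  shows "Re (Arctan (cis \<theta>)) = pi / 4 * sgn (cos \<theta>)"
proof -
  have s: "(sin \<theta>)\<^sup>2 \<noteq> 1"
    using assms sin_squared_eq[of \<theta>] by simp
  then have s1: "1 - sin \<theta> \<noteq> 0" "1 + sin \<theta> \<noteq> 0"
    by (auto simp: power2_eq_1_iff eq_neg_iff_add_eq_0 add.commute)
  have pos: "0 < 1 - sin \<theta>"
    using s1(1) sin_le_one[of \<theta>] by linarith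
  define y where "y = - cos \<theta> / (1 - sin \<theta>)"
  have cs: "cos \<theta> * cos \<theta> = (1 - sin \<theta>) * (1 + sin \<theta>)"
    using sin_cos_squared_add[of \<theta>] by (simp add: power2_eq_square algebra_simps)
  have nz: "1 + \<i> * cis \<theta> \<noteq> 0"
    using s1 by (auto simp: complex_eq_iff)
  have "(1 - \<i> * cis \<theta>) = \<i> * of_real y * (1 + \<i> * cis \<theta>)"
    using s1(1) by (simp add: complex_eq_iff y_def field_simps cs)
  then have q: "(1 - \<i> * cis \<theta>) / (1 + \<i> * cis \<theta>) = \<i> * of_real y"
    using nz by simp
  have y0: "y \<noteq> 0" using assms s1 by (simp add: y_def)
  have sg: "sgn y = - sgn (cos \<theta>)"
    using pos by (simp add: y_def sgn_divide)
  have "Im (Ln (\<i> * of_real y)) = sgn y * pi / 2"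
  proof (cases "0 < y")
    case True
    then have "Ln (of_real y * \<i>) = of_real (ln y) + Ln \<i>" by (subst Ln_times_of_real) (auto simp: Ln_of_real)
    then show ?thesis using True by (simp add: Ln_ii mult.commute)
  next
    case False
    then have "Ln (of_real (- y) * (- \<i>)) = of_real (ln (- y)) + Ln (- \<i>)" using y0 False Ln_of_real[of "- y"] by (subst Ln_times_of_real) auto
    then show ?thesis using False y0 by (simp add: Ln_minus_ii mult.commute)
  qed
  then show ?thesis
    by (simp add: Arctan_def q sg)
qed

lemma Arctan_partial_sum_bound:
  assumes "cmod z \<le> r" "r < 1"
  shows "cmod (\<Sum>n<N. (-1)^n / of_nat (2*n+1) * z^(2*n+1)) \<le> 1 / (1 - r)"
proof -
  have r: "0 \<le> r" using assms(1) norm_ge_zero[of z] by linarith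
  have "cmod (\<Sum>n<N. (-1)^n / of_nat (2*n+1) * z^(2*n+1)) \<le> (\<Sum>n<N. r ^ n)"
  proof (rule order_trans[OF norm_sum sum_mono])
    fix n
    have "cmod ((-1)^n / of_nat (2*n+1) * z^(2*n+1)) = cmod z ^ (2*n+1) / real (2*n+1)"
      unfolding norm_mult norm_divide norm_power norm_of_nat by simp
    also have "\<dots> \<le> cmod z ^ (2*n+1) / 1"
      by (intro divide_left_mono) auto
    also have "\<dots> \<le> r ^ (2*n+1)"
      unfolding div_by_1 using assms by (intro power_mono) auto
    also have "\<dots> \<le> r ^ n"
      using r assms by (intro power_decreasing) auto
    finally show "cmod ((-1)^n / of_nat (2*n+1) * z^(2*n+1)) \<le> r ^ n" .
  qed
  also have "\<dots> \<le> (\<Sum>n. r ^ n)"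
    using r assms by (intro sum_le_suminf summable_geometric) auto
  also have "\<dots> = 1 / (1 - r)" using r assms by (simp add: suminf_geometric)
  finally show ?thesis .
qed

lemma Arctan_bound:
  assumes "cmod z \<le> r" "r < 1"
  shows "cmod (Arctan z) \<le> 1 / (1 - r)"
proof (rule Lim_norm_ubound[OF trivial_limit_sequentially])
  show "(\<lambda>N. \<Sum>n<N. (-1)^n / of_nat (2*n+1) * z^(2*n+1)) \<longlonglongrightarrow> Arctan z"
    using Arctan_series(2)[of z] assms unfolding sums_def by simp
qed (intro always_eventually allI Arctan_partial_sum_bound assms)

text \<open>The power series of \<open>Arctan\<close> only has odd powers, so each term integrates to a value of the transform at an odd
  multiple of \<open>c/2\<close>.\<close>

lemma integral_Arctan_kernel:
  fixes w :: "real \<Rightarrow> complex" and c :: real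
  assumes w: "integrable lborel w" and odd: "\<And>n::nat. odd n \<Longrightarrow> fourier w (c * n / 2) = 0"
    and r: "0 \<le> r" "r < 1"
  shows "integrable lborel (\<lambda>x. w x * Arctan (of_real r * cis (- c * pi * x)))"
    and "(\<integral>x. w x * Arctan (of_real r * cis (- c * pi * x)) \<partial>lborel) = 0"
proof -
  define g :: "nat \<Rightarrow> complex" where "g n = (-1)^n / of_nat (2*n+1)" for n
  let ?z = "\<lambda>x. of_real r * cis (- c * pi * x)"
  let ?S = "\<lambda>N x. \<Sum>n<N. g n * ?z x ^ (2*n+1)"
  have zr: "cmod (?z x) \<le> r" for x using r by (simp add: norm_mult)
  have nz: "cmod (?z x) < 1" for x using zr r(2) by (rule order.strict_trans1)
  have lim: "(\<lambda>N. ?S N x) \<longlonglongrightarrow> Arctan (?z x)" for x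
    using Arctan_series(2)[OF nz] by (simp add: sums_def g_def)
  note [measurable] = borel_measurable_integrable[OF w]
  have mA [measurable]: "(\<lambda>x. Arctan (?z x)) \<in> borel_measurable lborel"
    by (rule borel_measurable_LIMSEQ_metric[where f = ?S]) (measurable, rule lim)
  show "integrable lborel (\<lambda>x. w x * Arctan (?z x))"
  proof (rule Bochner_Integration.integrable_bound)
    show "integrable lborel (\<lambda>x. w x * of_real (1 / (1 - r)))" using w by (intro integrable_mult_left) auto
    show "AE x in lborel. norm (w x * Arctan (?z x)) \<le> norm (w x * of_real (1 / (1 - r)))"
      unfolding norm_mult
      using order_trans[OF Arctan_bound[OF zr r(2)] abs_ge_self]
      by (intro AE_I2 mult_left_mono) (simp_all del: of_real_divide add: norm_of_real)
  qed measurable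
  have "(\<lambda>N. \<integral>x. w x * ?S N x \<partial>lborel) \<longlonglongrightarrow> (\<integral>x. w x * Arctan (?z x) \<partial>lborel)"
  proof (rule integral_dominated_convergence[where w = "\<lambda>x. cmod (w x) * (1 / (1 - r))"])
    show "integrable lborel (\<lambda>x. cmod (w x) * (1 / (1 - r)))" using w by (intro integrable_mult_left) auto
    show "AE x in lborel. (\<lambda>N. w x * ?S N x) \<longlonglongrightarrow> w x * Arctan (?z x)"
      by (intro AE_I2 tendsto_mult tendsto_const lim)
    show "AE x in lborel. norm (w x * ?S N x) \<le> cmod (w x) * (1 / (1 - r))" for N
      unfolding norm_mult g_def
      by (intro AE_I2 mult_left_mono Arctan_partial_sum_bound zr r) simp
  qed measurable
  moreover have "(\<integral>x. w x * ?S N x \<partial>lborel) = 0" for N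
  proof -
    have e: "w x * ?S N x = (\<Sum>n<N. g n * of_real r ^ (2*n+1) * (w x * cis (- 2 * pi * x * (c * real (2*n+1) / 2))))" for x
    proof -
      have c: "cis (- c * pi * x) ^ (2*n+1) = cis (- 2 * pi * x * (c * real (2*n+1) / 2))" for n
        unfolding Complex.DeMoivre by (rule arg_cong[where f = cis]) simp
      show ?thesis
        unfolding sum_distrib_left power_mult_distrib c by (intro sum.cong refl) (simp only: mult_ac)
    qed
    have "(\<integral>x. w x * ?S N x \<partial>lborel)
       = (\<Sum>n<N. g n * of_real r ^ (2*n+1) * (\<integral>x. w x * cis (- 2 * pi * x * (c * real (2*n+1) / 2)) \<partial>lborel))"
      unfolding e integral_mult_right_zero[symmetric]
      by (rule Bochner_Integration.integral_sum) (intro integrable_mult_right integrable_mult_cis w; measurable)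
    also have "\<dots> = 0"
      using odd[of "2*n+1" for n] unfolding fourier_cis by (intro sum.neutral) auto
    finally show ?thesis .
  qed
  ultimately show "(\<integral>x. w x * Arctan (?z x) \<partial>lborel) = 0"
    using LIMSEQ_unique[OF _ tendsto_const] by simp
qed

lemma AE_cos_pi_nonzero: "AE x in lborel. cos (pi * x) \<noteq> 0"
proof (rule AE_I')
  show "range (\<lambda>n::int. of_int n + 1/2 :: real) \<in> null_sets lborel"
    by (intro countable_imp_null_set_lborel) auto
  have "x \<in> range (\<lambda>n::int. of_int n + 1/2 :: real)" if "cos (pi * x) = 0" for x :: real
  proof -
    have "\<exists>i::int. odd i \<and> pi * x = of_int i * (pi/2)"
      using that by (simp only: cos_zero_iff_int)
    then obtain i :: int where i: "odd i" "pi * x = of_int i * (pi/2)" by (elim exE conjE)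
    from i(1) obtain k where k: "i = 2 * k + 1" by (elim oddE)
    have "pi * x = pi * (of_int k + 1/2)" unfolding i(2) k by (simp add: algebra_simps)
    then have "x = of_int k + 1/2" by (rule mult_left_cancel[OF pi_neq_zero, THEN iffD1])
    then show ?thesis by blast
  qed
  then show "{x \<in> space lborel. \<not> cos (pi * x) \<noteq> 0} \<subseteq> range (\<lambda>n::int. of_int n + 1/2 :: real)"
    by blast
qed

text \<open>The real part of \<open>Arctan (r cis (pi x))\<close> is an Abel mean of the Fourier series of \<open>pi/4 sgn (cos (pi x))\<close>. It is
  bounded by \<open>pi/2\<close> uniformly in \<open>r < 1\<close>, so the limit \<open>r \<rightarrow> 1\<close> may be taken under the integral.\<close>

theorem integral_sgn_cos_eq_0:
  fixes w :: "real \<Rightarrow> complex"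
  assumes w: "integrable lborel w"
    and odd: "\<And>n::nat. odd n \<Longrightarrow> fourier w (n / 2) = 0" "\<And>n::nat. odd n \<Longrightarrow> fourier w (- (n / 2)) = 0"
  shows "(\<integral>x. w x * of_real (sgn (cos (pi * x))) \<partial>lborel) = 0"
proof -
  note [measurable] = borel_measurable_integrable[OF w]
  define r :: "nat \<Rightarrow> real" where "r k = 1 - 1 / (k + 2)" for k
  have r: "0 \<le> r k" "r k < 1" for k by (auto simp: r_def field_simps)
  have rlim: "r \<longlonglongrightarrow> 1" unfolding r_def by real_asymp
  let ?z = "\<lambda>k x. of_real (r k) * cis (pi * x)" and ?z' = "\<lambda>k x. of_real (r k) * cis (- (pi * x))"
  define h where "h k x = Re (Arctan (?z k x))" for k x
  have nz: "cmod (?z k x) < 1" for k x using r[of k] by (simp add: norm_mult)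
  \<comment> \<open>\<open>Arctan\<close> commutes with conjugation because its power series is real\<close>
  have h: "2 * of_real (h k x) = Arctan (?z k x) + Arctan (?z' k x)" for k x
  proof -
    have "(\<lambda>n. (-1)^n / of_nat (2*n+1) * (?z k x)^(2*n+1)) sums Arctan (?z k x)"
      using Arctan_series(2)[OF nz] .
    then have "(\<lambda>n. cnj ((-1)^n / of_nat (2*n+1) * (?z k x)^(2*n+1))) sums cnj (Arctan (?z k x))"
      by (simp only: sums_cnj)
    moreover have "cmod (cnj (?z k x)) < 1" using nz[of k x] by (simp only: complex_mod_cnj)
    then have "(\<lambda>n. (-1)^n / of_nat (2*n+1) * (cnj (?z k x))^(2*n+1)) sums Arctan (cnj (?z k x))"
      by (rule Arctan_series(2))
    ultimately have "cnj (Arctan (?z k x)) = Arctan (cnj (?z k x))"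
      by (simp add: sums_unique2)
    then show ?thesis
      using complex_add_cnj[of "Arctan (?z k x)"] by (simp add: cis_cnj h_def)
  qed
  have kernel1: "integrable lborel (\<lambda>x. w x * Arctan (?z k x))" "(\<integral>x. w x * Arctan (?z k x) \<partial>lborel) = 0" for k
    using integral_Arctan_kernel[OF w _ r, of "-1" k] odd(2) by auto
  have kernel2: "integrable lborel (\<lambda>x. w x * Arctan (?z' k x))" "(\<integral>x. w x * Arctan (?z' k x) \<partial>lborel) = 0" for k
    using integral_Arctan_kernel[OF w _ r, of 1 k] odd(1) by auto
  have wh: "w x * of_real (h k x) = (w x * Arctan (?z k x) + w x * Arctan (?z' k x)) / 2" for k x
    using arg_cong[OF h[of k x], of "\<lambda>c. w x * c / 2"] by (simp add: distrib_left)
  have zero: "(\<integral>x. w x * of_real (h k x) \<partial>lborel) = 0" for k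
    unfolding wh using kernel1[of k] kernel2[of k] by simp
  have "(\<lambda>k. \<integral>x. w x * of_real (h k x) \<partial>lborel) \<longlonglongrightarrow> (\<integral>x. w x * of_real (pi / 4 * sgn (cos (pi * x))) \<partial>lborel)"
  proof (rule integral_dominated_convergence[where w = "\<lambda>x. cmod (w x) * (pi / 2)"])
    show "(\<lambda>x. w x * of_real (pi / 4 * sgn (cos (pi * x)))) \<in> borel_measurable lborel" by measurable
    show "(\<lambda>x. w x * of_real (h k x)) \<in> borel_measurable lborel" for k
      unfolding wh using kernel1(1)[of k] kernel2(1)[of k] by simp
    show "integrable lborel (\<lambda>x. cmod (w x) * (pi / 2))" using w by (intro integrable_mult_left) auto
    show "AE x in lborel. (\<lambda>k. w x * of_real (h k x)) \<longlonglongrightarrow> w x * of_real (pi / 4 * sgn (cos (pi * x)))"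
      using AE_cos_pi_nonzero
    proof eventually_elim
      case (elim x)
      have "cos (pi * x) \<noteq> 0" by fact
      then have "isCont Arctan (cis (pi * x))" by (intro continuous_at_Arctan) simp
      moreover have "(\<lambda>k. ?z k x) \<longlonglongrightarrow> of_real 1 * cis (pi * x)"
        by (intro tendsto_intros rlim)
      ultimately have "(\<lambda>k. Arctan (?z k x)) \<longlonglongrightarrow> Arctan (cis (pi * x))"
        by (intro isCont_tendsto_compose[of _ Arctan]) auto
      then have "(\<lambda>k. h k x) \<longlonglongrightarrow> pi / 4 * sgn (cos (pi * x))"
        unfolding h_def Re_Arctan_unit_circle[OF elim, symmetric] by (rule tendsto_Re)
      then show ?case by (intro tendsto_intros)
    qed
    show "AE x in lborel. norm (w x * of_real (h k x)) \<le> cmod (w x) * (pi / 2)" for k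
    proof (rule AE_I2)
      fix x
      have "\<bar>h k x\<bar> \<le> pi / 2" using Re_Arctan_bounds[of "?z k x"] nz[of k x] abs_Im_le_cmod[of "?z k x"]
        unfolding h_def by force
      then show "norm (w x * of_real (h k x)) \<le> cmod (w x) * (pi / 2)"
        unfolding norm_mult norm_of_real by (intro mult_left_mono) auto
    qed
  qed
  then have "(\<integral>x. w x * of_real (pi / 4 * sgn (cos (pi * x))) \<partial>lborel) = 0"
    unfolding zero using LIMSEQ_unique tendsto_const by blast
  moreover have "(\<integral>x. w x * of_real (pi / 4 * sgn (cos (pi * x))) \<partial>lborel)
      = (\<integral>x. of_real (pi / 4) * (w x * of_real (sgn (cos (pi * x)))) \<partial>lborel)"
    by (intro Bochner_Integration.integral_cong refl) (simp only: of_real_mult mult_ac)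
  ultimately have "of_real (pi / 4) * (\<integral>x. w x * of_real (sgn (cos (pi * x))) \<partial>lborel) = 0"
    by (simp only: integral_mult_right_zero)
  then show ?thesis by simp
qed

section \<open>Functions vanishing at the half-integers\<close>

text \<open>A classical peaking argument. The trigonometric polynomial
  \<open>P t = 1 - cos (2 pi \<delta>) + cos (2 pi (t - t0))\<close> exceeds \<open>1\<close> near \<open>t0\<close> and is bounded by \<open>1\<close> in modulus elsewhere.
  If \<open>H\<close> did not vanish at \<open>t0\<close>, its integral against \<open>P ^ N\<close> would tend to infinity instead of being
  \<open>0\<close>.\<close>

lemma vanishing_fourier_coefficients_imp_zero:
  fixes H :: "real \<Rightarrow> complex"
  assumes cont: "continuous_on {-1/2..1/2} H"
    and coeff: "\<And>n::int. (\<integral>t. indicator {-1/2..1/2} t *\<^sub>R (H t * cis (2 * pi * n * t)) \<partial>lborel) = 0"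
    and t0: "-1/2 < t0" "t0 < 1/2"
  shows "H t0 = 0"
proof (rule ccontr)
  assume nz: "H t0 \<noteq> 0"
  let ?J = "{-1/2..1/2::real}"
  define R where "R t = Re (cnj (H t0) * H t)" for t
  define \<eta> where "\<eta> = R t0 / 2"
  have \<eta>: "0 < \<eta>" using nz by (simp add: \<eta>_def R_def complex_mult_cnj complex_eq_iff sum_power2_gt_zero_iff flip: power2_eq_square)
  have contR: "continuous_on ?J R" unfolding R_def by (intro continuous_intros cont)
  then obtain d where d: "0 < d" "\<And>t. t \<in> ?J \<Longrightarrow> dist t t0 < d \<Longrightarrow> dist (R t) (R t0) < \<eta>"
    using t0 \<eta> unfolding continuous_on_iff by (metis atLeastAtMost_iff less_imp_le)
  \<comment> \<open>within \<open>\<delta>\<close> of \<open>t0\<close> the function \<open>R\<close> stays above \<open>\<eta>\<close> and the interval is not left\<close>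
  define \<delta> where "\<delta> = min (d/2) (min (1/8) (min (1/2 - t0) (t0 + 1/2)))"
  have \<delta>: "0 < \<delta>" "\<delta> < d" "\<delta> \<le> 1/8" "\<delta> \<le> 1/2 - t0" "\<delta> \<le> t0 + 1/2"
    using d(1) t0 unfolding \<delta>_def by linarith+
  have Rpos: "\<eta> < R t" if "\<bar>t - t0\<bar> \<le> \<delta>" for t
  proof -
    have "t \<in> ?J" using that \<delta> by auto
    moreover have "dist t t0 < d" using that \<delta>(2) by (simp add: dist_real_def)
    ultimately show ?thesis using d(2)[of t] by (simp add: \<eta>_def dist_real_def abs_if split: if_splits)
  qed
  define P where "P t = 1 - cos (2 * pi * \<delta>) + cos (2 * pi * (t - t0))" for t
  define q where "q = 1 - cos (2 * pi * \<delta>) + cos (pi * \<delta>)"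
  have q: "1 < q"
    using \<delta> by (auto simp: q_def intro!: cos_monotone_0_pi)
  have contP: "continuous_on S P" for S unfolding P_def by (intro continuous_intros)
  have Pn: "(\<integral>t. indicator ?J t *\<^sub>R (H t * of_real (P t) ^ N * cis (2 * pi * n * t)) \<partial>lborel) = 0" for N and n :: int
  proof (induction N arbitrary: n)
    case 0
    then show ?case using coeff by simp
  next
    case (Suc N)
    let ?F = "\<lambda>n::int. \<lambda>t. indicator ?J t *\<^sub>R (H t * of_real (P t) ^ N * cis (2 * pi * n * t))"
    have int: "integrable lborel (?F n)" for n
      unfolding cis_conv_exp
      by (intro borel_integrable_compact compact_Icc continuous_intros cont contP)
    have "indicator ?J t *\<^sub>R (H t * of_real (P t) ^ Suc N * cis (2 * pi * n * t))
       = of_real (1 - cos (2 * pi * \<delta>)) * ?F n t + (cis (- (2 * pi * t0)) / 2 * ?F (n + 1) t + cis (2 * pi * t0) / 2 * ?F (n - 1) t)" for t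
    proof -
      have c: "complex_of_real (cos x) = (cis x + cis (- x)) / 2" for x
        by (simp add: complex_eq_iff)
      have "of_real (P t) * cis (2 * pi * n * t) = of_real (1 - cos (2 * pi * \<delta>)) * cis (2 * pi * n * t)
         + (cis (- (2 * pi * t0)) / 2 * cis (2 * pi * of_int (n + 1) * t) + cis (2 * pi * t0) / 2 * cis (2 * pi * of_int (n - 1) * t))"
        unfolding P_def of_real_add c[of "2 * pi * (t - t0)"]
        by (simp add: distrib_right add_divide_distrib cis_mult) (simp add: algebra_simps)
      from arg_cong[OF this, of "\<lambda>z. indicator ?J t *\<^sub>R (H t * of_real (P t) ^ N * z)"]
      show ?thesis by (simp add: algebra_simps split: split_indicator)
    qed
    moreover have "(\<integral>t. a * ?F n t + (b * ?F (n + 1) t + c * ?F (n - 1) t) \<partial>lborel) = 0" for a b c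
      by (subst Bochner_Integration.integral_add Bochner_Integration.integrable_add
            | intro Bochner_Integration.integrable_add integrable_mult_right int
            | simp only: integral_mult_right_zero Suc.IH mult_zero_right add_0)+
    ultimately show ?case by (simp only:)
  qed
  have Rn: "(\<integral>t. indicator ?J t *\<^sub>R (R t * P t ^ N) \<partial>lborel) = 0" for N
  proof -
    have i: "integrable lborel (\<lambda>t. cnj (H t0) * (indicator ?J t *\<^sub>R (H t * of_real (P t) ^ N)))"
      by (intro integrable_mult_right borel_integrable_compact compact_Icc continuous_intros cont contP)
    have "indicator ?J t *\<^sub>R (R t * P t ^ N) = Re (cnj (H t0) * (indicator ?J t *\<^sub>R (H t * of_real (P t) ^ N)))" for t
    proof -
      have "cnj (H t0) * (indicator ?J t *\<^sub>R (H t * of_real (P t) ^ N)) = (cnj (H t0) * H t) * of_real (indicator ?J t * P t ^ N)"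
        by (simp add: scaleR_conv_of_real mult_ac)
      then show ?thesis unfolding R_def by (simp only: Re_complex_of_real times_complex.sel Im_complex_of_real) simp
    qed
    then have "(\<integral>t. indicator ?J t *\<^sub>R (R t * P t ^ N) \<partial>lborel)
        = (\<integral>t. Re (cnj (H t0) * (indicator ?J t *\<^sub>R (H t * of_real (P t) ^ N))) \<partial>lborel)"
      by (simp only:)
    also have "\<dots> = Re (\<integral>t. cnj (H t0) * (indicator ?J t *\<^sub>R (H t * of_real (P t) ^ N)) \<partial>lborel)"
      by (rule integral_Re[OF i])
    also have "(\<integral>t. cnj (H t0) * (indicator ?J t *\<^sub>R (H t * of_real (P t) ^ N)) \<partial>lborel) = 0"
      using Pn[of N 0] by (simp only: integral_mult_right_zero) simp
    finally show ?thesis by simp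
  qed
  obtain M where M: "0 < M" "\<And>t. t \<in> ?J \<Longrightarrow> \<bar>R t\<bar> \<le> M"
    using compact_imp_bounded[OF compact_continuous_image[OF contR compact_Icc]]
    unfolding bounded_pos by auto
  have lower: "indicator {t0 - \<delta>/2..t0 + \<delta>/2} t * (\<eta> * q ^ N) - indicator ?J t * M \<le> indicator ?J t *\<^sub>R (R t * P t ^ N)" for t N
  proof (cases "t \<in> ?J")
    case False
    then have "t \<notin> {t0 - \<delta>/2..t0 + \<delta>/2}" using \<delta> by auto
    with False show ?thesis by simp
  next
    case True
    have cc: "cos (2 * pi * (t - t0)) = cos (2 * pi * \<bar>t - t0\<bar>)"
    proof -
      have "\<bar>2 * pi * (t - t0)\<bar> = 2 * pi * \<bar>t - t0\<bar>" by (simp only: abs_mult abs_numeral abs_of_pos[OF pi_gt_zero])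
      then show ?thesis using cos_abs_real[of "2 * pi * (t - t0)"] by (simp only:)
    qed
    show ?thesis
    proof (cases "\<bar>t - t0\<bar> \<le> \<delta>")
      case near: True
      have "cos (2 * pi * \<delta>) \<le> cos (2 * pi * \<bar>t - t0\<bar>)"
        using near \<delta> by (intro cos_monotone_0_pi_le) auto
      then have P1: "1 \<le> P t" by (simp add: P_def cc)
      show ?thesis
      proof (cases "\<bar>t - t0\<bar> \<le> \<delta>/2")
        case nearer: True
        have "cos (2 * pi * (\<delta>/2)) \<le> cos (2 * pi * \<bar>t - t0\<bar>)"
          using nearer \<delta> by (intro cos_monotone_0_pi_le) auto
        then have "q \<le> P t" by (simp add: P_def q_def cc)
        then have "\<eta> * q ^ N \<le> R t * P t ^ N"
          using q \<eta> Rpos[OF near] by (intro mult_mono power_mono) auto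
        moreover have "t \<in> {t0 - \<delta>/2..t0 + \<delta>/2}" using nearer unfolding atLeastAtMost_iff by linarith
        then have "indicator {t0 - \<delta>/2..t0 + \<delta>/2} t = (1::real)" by simp
        ultimately show ?thesis using True M(1) by simp
      next
        case False
        then have "t \<notin> {t0 - \<delta>/2..t0 + \<delta>/2}" unfolding atLeastAtMost_iff by linarith
        then have "indicator {t0 - \<delta>/2..t0 + \<delta>/2} t = (0::real)" by simp
        moreover have "0 \<le> R t * P t ^ N" using Rpos[OF near] \<eta> P1 by simp
        ultimately show ?thesis using True M(1) by simp
      qed
    next
      case far: False
      have le: "\<bar>t - t0\<bar> \<le> 1 - \<delta>" using True \<delta> t0 by (auto simp: abs_le_iff)
      have "cos (2 * pi * \<bar>t - t0\<bar>) \<le> cos (2 * pi * \<delta>)"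
      proof (cases "\<bar>t - t0\<bar> \<le> 1/2")
        case True
        then show ?thesis using far \<delta> by (intro cos_monotone_0_pi_le) auto
      next
        case False
        have "cos (2 * pi * \<bar>t - t0\<bar>) = cos (2 * pi - 2 * pi * \<bar>t - t0\<bar>)"
          by (simp add: cos_diff)
        also have "2 * pi - 2 * pi * \<bar>t - t0\<bar> = 2 * pi * (1 - \<bar>t - t0\<bar>)" by (simp only: right_diff_distrib mult_1_right)
        also have "cos \<dots> \<le> cos (2 * pi * \<delta>)"
          using False le \<delta> by (intro cos_monotone_0_pi_le) auto
        finally show ?thesis .
      qed
      then have "P t \<le> 1" by (simp add: P_def cc)
      moreover have "cos (2 * pi * \<delta>) \<le> 1" "-1 \<le> cos (2 * pi * (t - t0))" by simp_all
      then have "-1 \<le> P t" unfolding P_def by linarith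
      ultimately have "\<bar>P t ^ N\<bar> \<le> 1" by (simp add: power_abs power_le_one abs_le_iff)
      then have "\<bar>R t * P t ^ N\<bar> \<le> M * 1"
        unfolding abs_mult using M(2)[OF True] M(1) by (intro mult_mono) auto
      moreover have "t \<notin> {t0 - \<delta>/2..t0 + \<delta>/2}" using far \<delta>(1) unfolding atLeastAtMost_iff by linarith
      then have "indicator {t0 - \<delta>/2..t0 + \<delta>/2} t = (0::real)" by simp
      ultimately show ?thesis using True by simp
    qed
  qed
  have bound: "\<eta> * \<delta> * q ^ N \<le> M" for N
  proof -
    let ?L = "\<lambda>t. indicator {t0 - \<delta>/2..t0 + \<delta>/2} t * (\<eta> * q ^ N) - indicator ?J t * M"
    have "(\<integral>t. ?L t \<partial>lborel) \<le> (\<integral>t. indicator ?J t *\<^sub>R (R t * P t ^ N) \<partial>lborel)"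
    proof (rule integral_mono)
      show "integrable lborel (\<lambda>t. indicator ?J t *\<^sub>R (R t * P t ^ N))"
        by (intro borel_integrable_compact compact_Icc continuous_intros contR contP)
      show "integrable lborel ?L"
        by (intro Bochner_Integration.integrable_diff integrable_mult_left integrable_real_indicator
            emeasure_bounded_finite) auto
    qed (rule lower)
    moreover have "(\<integral>t. ?L t \<partial>lborel) = \<delta> * (\<eta> * q ^ N) - M"
    proof -
      have i: "integrable lborel (\<lambda>t. indicator {x..y} t * (z::real))" for x y z :: real
        by (intro integrable_mult_left integrable_real_indicator emeasure_bounded_finite) auto
      show ?thesis using \<delta>(1) by (subst Bochner_Integration.integral_diff[OF i i]) simp
    qed
    ultimately show ?thesis using Rn[of N] by (simp add: mult_ac)
  qed
  have "0 < \<eta> * \<delta>" using \<eta> \<delta> by simp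
  obtain N where "M / (\<eta> * \<delta>) < q ^ N" using real_arch_pow[OF q] by blast
  then show False using bound[of N] \<open>0 < \<eta> * \<delta>\<close> by (simp add: field_simps)
qed

lemma cis_half_integer_shift:
  "cis (2 * pi * (of_int n + 1/2) * (t + real k)) = (-1) ^ k * cis (2 * pi * (of_int n + 1/2) * t)"
  "cis (2 * pi * (of_int n + 1/2) * (t - real k)) = (-1) ^ k * cis (2 * pi * (of_int n + 1/2) * t)"
proof -
  have "cis (2 * pi * (of_int n + 1/2) * real k) = cis (2 * pi * of_int (n * int k)) * cis (real k * pi)"
    by (simp add: cis_mult algebra_simps)
  also have "\<dots> = (-1) ^ k"
    by (simp add: cis_multiple_2pi flip: Complex.DeMoivre)
  finally have k: "cis (2 * pi * (of_int n + 1/2) * real k) = (-1) ^ k" .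
  then show "cis (2 * pi * (of_int n + 1/2) * (t + real k)) = (-1) ^ k * cis (2 * pi * (of_int n + 1/2) * t)"
    unfolding distrib_left[of _ t] cis_mult[symmetric] by (simp only: mult.commute)
  have "cis (2 * pi * (of_int n + 1/2) * (t - real k)) = cis (2 * pi * (of_int n + 1/2) * t) / cis (2 * pi * (of_int n + 1/2) * real k)"
    unfolding right_diff_distrib[of _ t] cis_divide by (rule refl)
  then show "cis (2 * pi * (of_int n + 1/2) * (t - real k)) = (-1) ^ k * cis (2 * pi * (of_int n + 1/2) * t)"
    unfolding k by (cases "even k") auto
qed

text \<open>Poisson summation: the Fourier coefficients of the alternating periodization
  \<open>\<Sum>m. (-1)^m U (t + m)\<close>, taken over all integers \<open>m\<close>, are the values at half-integers of the function with transform
  \<open>U\<close>. These vanish by assumption, hence so does the periodization, and the term \<open>m = 0\<close> can be solved for.\<close>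

theorem alternating_periodization_eq_0:
  fixes U :: "real \<Rightarrow> complex"
  assumes cont: "continuous_on UNIV U" and U: "integrable lborel U"
    and \<epsilon>: "0 < \<epsilon>" and decay: "\<And>t. cmod (U t) \<le> C * (1 + \<bar>t\<bar>) powr (- 1 - \<epsilon>)"
    and zero: "\<And>n::int. (\<integral>t. U t * cis (2 * pi * (of_int n + 1/2) * t) \<partial>lborel) = 0"
    and t: "\<bar>t\<bar> < 1/2"
  shows "(\<lambda>m. (-1) ^ m * (U (t + real (Suc m)) + U (t - real (Suc m)))) sums U t"
proof -
  let ?J = "{-1/2..1/2::real}"
  define a where "a m t = (-1) ^ m * (U (t + real (Suc m)) + U (t - real (Suc m)))" for m t
  define b where "b m = 2 * (C * real (Suc m) powr (- 1 - \<epsilon>))" for m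
  have C: "0 \<le> C" using order_trans[OF norm_ge_zero decay[of 0]] by simp
  have ab: "cmod (a m t) \<le> b m" if "t \<in> ?J" for m t
  proof -
    have d: "cmod (U s) \<le> C * real (Suc m) powr (- 1 - \<epsilon>)" if "real m \<le> \<bar>s\<bar>" for s
    proof (rule order_trans[OF decay])
      show "C * (1 + \<bar>s\<bar>) powr (- 1 - \<epsilon>) \<le> C * real (Suc m) powr (- 1 - \<epsilon>)"
        using C \<epsilon> that by (intro mult_left_mono powr_mono2') auto
    qed
    have "real m \<le> \<bar>t + real (Suc m)\<bar>" "real m \<le> \<bar>t - real (Suc m)\<bar>"
      using that by auto
    then have "cmod (U (t + real (Suc m)) + U (t - real (Suc m))) \<le> b m"
      unfolding b_def mult_2 by (intro order_trans[OF norm_triangle_ineq] add_mono d)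
    then show ?thesis
      by (simp add: a_def norm_mult norm_power del: of_nat_Suc)
  qed
  have sb: "summable b"
    unfolding b_def
    by (intro summable_mult summable_Suc_iff[THEN iffD2] summable_real_powr_iff[THEN iffD2]) (use \<epsilon> in simp)
  have sa: "summable (\<lambda>m. a m t)" if "t \<in> ?J" for t
    by (rule summable_comparison_test'[OF sb]) (rule ab[OF that])
  define S where "S N t = U t - (\<Sum>m<N. a m t)" for N t
  define S' where "S' t = U t - (\<Sum>m. a m t)" for t
  have "uniform_limit ?J (\<lambda>N t. \<Sum>m<N. a m t) (\<lambda>t. \<Sum>m. a m t) sequentially"
    by (rule Weierstrass_m_test[OF ab sb])
  then have ulim: "uniform_limit ?J S S' sequentially"
    unfolding S_def S'_def by (intro uniform_limit_intros)
  have contS: "continuous_on X (S N)" for N X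
    unfolding S_def a_def
    by (intro continuous_intros continuous_on_compose2[OF cont]) auto
  have contS': "continuous_on ?J S'"
    by (rule uniform_limit_theorem[OF _ ulim]) (intro always_eventually allI contS, simp)
  have Slim: "(\<lambda>N. S N t) \<longlonglongrightarrow> S' t" if "t \<in> ?J" for t
    using tendsto_uniform_limitI[OF ulim that] .
  have coeff: "(\<integral>t. indicator ?J t *\<^sub>R (S' t * cis (2 * pi * (of_int n + 1/2) * t)) \<partial>lborel) = 0" for n :: int
  proof -
    let ?e = "\<lambda>t. cis (2 * pi * (of_int n + 1/2) * t)"
    define f where "f t = U t * ?e t" for t
    have f: "integrable lborel f" unfolding f_def by (intro integrable_mult_cis U) simp
    have part: "(\<integral>t. indicator ?J t *\<^sub>R (S N t * ?e t) \<partial>lborel)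
        = (\<integral>t. indicator {- (real N + 1/2)..real N + 1/2} t *\<^sub>R f t \<partial>lborel)" for N
    proof (induction N)
      case 0
      then show ?case by (simp add: S_def f_def)
    next
      case (Suc N)
      have fi: "integrable lborel (\<lambda>t. f (t + c))" for c
        using lborel_integrable_real_affine[OF f, of 1 c] by (simp add: add.commute)
      have i: "integrable lborel (\<lambda>t. indicator ?J t *\<^sub>R f (t + c))" for c
        by (intro integrable_mult_indicator fi) auto
      have iS: "integrable lborel (\<lambda>t. indicator ?J t *\<^sub>R (S N t * ?e t))"
        unfolding cis_conv_exp by (intro borel_integrable_compact compact_Icc continuous_intros contS)
      have "S (Suc N) t * ?e t = S N t * ?e t + (f (t + real (Suc N)) + f (t + - real (Suc N)))" for t
      proof -
        have "- a N t * ?e t = U (t + real (Suc N)) * ((-1) ^ Suc N * ?e t) + U (t - real (Suc N)) * ((-1) ^ Suc N * ?e t)"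
          by (simp add: a_def algebra_simps)
        also have "\<dots> = f (t + real (Suc N)) + f (t + - real (Suc N))"
          unfolding f_def add_uminus_conv_diff cis_half_integer_shift by (rule refl)
        finally have x: "- a N t * ?e t = f (t + real (Suc N)) + f (t + - real (Suc N))" .
        have "S (Suc N) t = S N t + - a N t" by (simp add: S_def)
        then show ?thesis by (simp only: distrib_right x)
      qed
      then have "(\<integral>t. indicator ?J t *\<^sub>R (S (Suc N) t * ?e t) \<partial>lborel)
        = (\<integral>t. indicator ?J t *\<^sub>R (S N t * ?e t) + (indicator ?J t *\<^sub>R f (t + real (Suc N)) + indicator ?J t *\<^sub>R f (t + - real (Suc N))) \<partial>lborel)"
        by (simp only: scaleR_add_right)
      also have "\<dots> = (\<integral>t. indicator ?J t *\<^sub>R (S N t * ?e t) \<partial>lborel)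
          + ((\<integral>t. indicator ?J t *\<^sub>R f (t + real (Suc N)) \<partial>lborel) + (\<integral>t. indicator ?J t *\<^sub>R f (t + - real (Suc N)) \<partial>lborel))"
        by (simp only: Bochner_Integration.integral_add Bochner_Integration.integrable_add iS i)
      also have "\<dots> = (\<integral>t. indicator {- (real N + 1/2)..real N + 1/2} t *\<^sub>R f t \<partial>lborel)
          + ((\<integral>t. indicator {real N + 1/2..real (Suc N) + 1/2} t *\<^sub>R f t \<partial>lborel)
          + (\<integral>t. indicator {- (real (Suc N) + 1/2)..- (real N + 1/2)} t *\<^sub>R f t \<partial>lborel))"
      proof -
        have "{-1/2 + real (Suc N)..1/2 + real (Suc N)} = {real N + 1/2..real (Suc N) + 1/2}"
          "{-1/2 + - real (Suc N)..1/2 + - real (Suc N)} = {- (real (Suc N) + 1/2)..- (real N + 1/2)}"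
          by auto
        then show ?thesis by (simp only: integral_translated_interval Suc.IH)
      qed
      also have "\<dots> = (\<integral>t. indicator {- (real (Suc N) + 1/2)..real (Suc N) + 1/2} t *\<^sub>R f t \<partial>lborel)"
        using integral_adjacent_intervals[OF f, of "- (real (Suc N) + 1/2)" "- (real N + 1/2)" "real (Suc N) + 1/2"]
          integral_adjacent_intervals[OF f, of "- (real N + 1/2)" "real N + 1/2" "real (Suc N) + 1/2"]
        by simp
      finally show ?case .
    qed
    have "filterlim (\<lambda>N. real N + 1/2) at_top sequentially" by real_asymp
    from integral_symmetric_intervals_limit[OF f this]
    have "(\<lambda>N. \<integral>t. indicator ?J t *\<^sub>R (S N t * ?e t) \<partial>lborel) \<longlonglongrightarrow> 0"
      unfolding part using zero[of n] by (simp add: f_def)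
    moreover have "(\<lambda>N. \<integral>t. indicator ?J t *\<^sub>R (S N t * ?e t) \<partial>lborel)
        \<longlonglongrightarrow> (\<integral>t. indicator ?J t *\<^sub>R (S' t * ?e t) \<partial>lborel)"
    proof (rule integral_dominated_convergence[where w = "\<lambda>t. indicator ?J t * (C + suminf b)"])
      have "continuous_on ?J (\<lambda>t. S' t * ?e t)"
        unfolding cis_conv_exp by (intro continuous_intros contS')
      then show "(\<lambda>t. indicator ?J t *\<^sub>R (S' t * ?e t)) \<in> borel_measurable lborel"
        by (rule borel_measurable_integrable[OF borel_integrable_compact[OF compact_Icc]])
      have "continuous_on ?J (\<lambda>t. S N t * ?e t)" for N
        unfolding cis_conv_exp by (intro continuous_intros contS)
      then show "(\<lambda>t. indicator ?J t *\<^sub>R (S N t * ?e t)) \<in> borel_measurable lborel" for N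
        by (rule borel_measurable_integrable[OF borel_integrable_compact[OF compact_Icc]])
      show "integrable lborel (\<lambda>t. indicator ?J t * (C + suminf b))"
        by (intro integrable_mult_left integrable_real_indicator emeasure_bounded_finite) auto
      show "AE t in lborel. (\<lambda>N. indicator ?J t *\<^sub>R (S N t * ?e t)) \<longlonglongrightarrow> indicator ?J t *\<^sub>R (S' t * ?e t)"
      proof (rule AE_I2)
        fix t :: real
        show "(\<lambda>N. indicator ?J t *\<^sub>R (S N t * ?e t)) \<longlonglongrightarrow> indicator ?J t *\<^sub>R (S' t * ?e t)"
          by (cases "t \<in> ?J") (auto intro!: tendsto_intros Slim)
      qed
      show "AE t in lborel. norm (indicator ?J t *\<^sub>R (S N t * ?e t)) \<le> indicator ?J t * (C + suminf b)" for N
      proof (rule AE_I2)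
        fix t :: real
        have "cmod (S N t) \<le> C + suminf b" if "t \<in> ?J"
        proof -
          have "cmod (U t) \<le> C * 1"
          proof (rule order_trans[OF decay mult_left_mono[OF _ C]])
            have "(1 + \<bar>t\<bar>) powr (- 1 - \<epsilon>) \<le> 1 powr (- 1 - \<epsilon>)"
              using \<epsilon> by (intro powr_mono2') auto
            then show "(1 + \<bar>t\<bar>) powr (- 1 - \<epsilon>) \<le> 1" by simp
          qed
          moreover have "cmod (\<Sum>m<N. a m t) \<le> (\<Sum>m<N. b m)"
            by (rule order_trans[OF norm_sum sum_mono]) (rule ab[OF that])
          moreover have "(\<Sum>m<N. b m) \<le> suminf b"
          proof (rule sum_le_suminf[OF sb])
            show "0 \<le> b m" for m using C unfolding b_def by (intro mult_nonneg_nonneg) auto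
          qed simp
          ultimately show ?thesis
            unfolding S_def using norm_triangle_ineq4[of "U t" "\<Sum>m<N. a m t"] by linarith
        qed
        then show "norm (indicator ?J t *\<^sub>R (S N t * ?e t)) \<le> indicator ?J t * (C + suminf b)"
          by (simp add: norm_mult split: split_indicator)
      qed
    qed
    ultimately show ?thesis using LIMSEQ_unique by blast
  qed
  have "S' t * cis (pi * t) = 0"
  proof (rule vanishing_fourier_coefficients_imp_zero[where H = "\<lambda>t. S' t * cis (pi * t)" and ?t0.0 = t])
    show "continuous_on ?J (\<lambda>t. S' t * cis (pi * t))"
      unfolding cis_conv_exp by (intro continuous_intros contS')
    fix n :: int
    have "S' t * cis (pi * t) * cis (2 * pi * n * t) = S' t * cis (2 * pi * (of_int n + 1/2) * t)" for t
      by (simp add: mult.assoc cis_mult algebra_simps)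
    then show "(\<integral>t. indicator ?J t *\<^sub>R (S' t * cis (pi * t) * cis (2 * pi * n * t)) \<partial>lborel) = 0"
      using coeff by (simp only:)
  qed (use t in auto)
  then have "S' t = 0" by simp
  then have "(\<Sum>m. a m t) = U t" by (simp add: S'_def)
  moreover have "t \<in> ?J" using t by (auto simp: abs_less_iff)
  ultimately have "(\<lambda>m. a m t) sums U t" using summable_sums[OF sa[of t]] by (simp only:)
  then show ?thesis unfolding a_def .
qed

text \<open>The transform of \<open>w\<close> lives on \<open>[-1/2, 1/2]\<close>, so in the alternating periodization at a point of the open
  interval all terms but one vanish.\<close>

theorem exponential_type_determined_at_half_integers:
  assumes w: "exponential_type pi w" and L1: "integrable lborel (\<lambda>x. w (of_real x))"
    and vanish: "\<And>n::int. w (of_real (of_int n + 1/2)) = 0"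
  shows "w z = 0"
proof -
  have hol: "w holomorphic_on UNIV" using w by (simp add: exponential_type_def)
  let ?w = "\<lambda>x. w (of_real x)"
  let ?U = "fourier ?w"
  have supp: "?U t = 0" if "1/2 \<le> \<bar>t\<bar>" for t
    using that by (intro fourier_exponential_type_eq_0[OF w _ L1]) auto
  have cont: "continuous_on UNIV ?U" by (rule continuous_on_fourier[OF L1])
  have iU: "integrable lborel ?U"
    by (rule integrable_continuous_compact_support[OF cont, of "1/2"]) (rule supp, simp)
  note inv = fourier_inversion_continuous[OF continuous_on_entire_of_real[OF hol] L1 iU]
  define A where "A = (\<integral>x. cmod (w (of_real x)) \<partial>lborel)"
  have A: "0 \<le> A" by (simp add: A_def)
  have "?U t = 0" if t: "\<bar>t\<bar> < 1/2" for t
  proof -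
    have "(\<lambda>m. (-1) ^ m * (?U (t + real (Suc m)) + ?U (t - real (Suc m)))) sums ?U t"
    proof (rule alternating_periodization_eq_0[OF cont iU, of 1 "4 * A"])
      fix s
      show "cmod (?U s) \<le> 4 * A * (1 + \<bar>s\<bar>) powr (- 1 - 1)"
      proof (cases "1/2 \<le> \<bar>s\<bar>")
        case True
        then show ?thesis using A supp[of s] by simp
      next
        case False
        have "1 \<le> 4 * (1 + \<bar>s\<bar>) powr (- 2)"
        proof -
          have "2 powr - 2 \<le> (1 + \<bar>s\<bar>) powr (- 2)" using False by (intro powr_mono2') auto
          moreover have "2 powr - 2 = (1/4 :: real)" by (simp add: powr_minus)
          ultimately show ?thesis by simp
        qed
        then have "A * 1 \<le> A * (4 * (1 + \<bar>s\<bar>) powr (- 2))" using A by (rule mult_left_mono)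
        then show ?thesis using norm_fourier_le[OF L1, of s] by (simp add: A_def mult_ac)
      qed
    next
      fix n :: int
      show "(\<integral>t. ?U t * cis (2 * pi * (of_int n + 1/2) * t) \<partial>lborel) = 0"
        using inv[of "of_int n + 1/2"] vanish[of n] by simp
    qed (use t in auto)
    moreover have "?U (t + real (Suc m)) = 0" "?U (t - real (Suc m)) = 0" for m
      using t by (intro supp; auto simp: abs_less_iff)+
    ultimately have "(\<lambda>m. 0) sums ?U t" by (simp only: mult_zero_right add_0)
    then show ?thesis by (rule sums_unique2) (rule sums_zero)
  qed
  then have U0: "?U t = 0" for t using supp[of t] by (cases "1/2 \<le> \<bar>t\<bar>") auto
  have "w (of_real x) = 0" for x
    by (rule trans[OF inv]) (simp only: U0 mult_zero_left Bochner_Integration.integral_zero)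
  then show ?thesis by (rule entire_zero_on_reals[OF hol])
qed

section \<open>Smooth functions with weighted bounds on their derivatives\<close>

text \<open>\<open>deriv_bound W n B f\<close> bounds all derivatives of \<open>f\<close> up to order \<open>n\<close> by \<open>B\<close> times the weight \<open>W\<close>. The recursion
  asks for the derivative as a function, which makes closure under sums and products a plain induction. An
  indicator function as weight expresses compact support, an inverse power expresses decay.\<close>

primrec deriv_bound :: "(real \<Rightarrow> real) \<Rightarrow> nat \<Rightarrow> real \<Rightarrow> (real \<Rightarrow> complex) \<Rightarrow> bool" where
  "deriv_bound W 0 B f \<longleftrightarrow> (\<forall>x. cmod (f x) \<le> B * W x)"
| "deriv_bound W (Suc n) B f \<longleftrightarrow> (\<forall>x. cmod (f x) \<le> B * W x) \<and>
     (\<exists>f'. (\<forall>x. (f has_vector_derivative f' x) (at x)) \<and> deriv_bound W n B f')"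

lemma deriv_bound_SucI:
  assumes "\<And>x. cmod (f x) \<le> B * W x" "\<And>x. (f has_vector_derivative f' x) (at x)" "deriv_bound W n B f'"
  shows "deriv_bound W (Suc n) B f"
  using assms by auto

lemma deriv_bound_pointwise: "deriv_bound W n B f \<Longrightarrow> cmod (f x) \<le> B * W x"
  by (cases n) auto

lemma deriv_bound_Suc_imp: "deriv_bound W (Suc n) B f \<Longrightarrow> deriv_bound W n B f"
proof (induction n arbitrary: f)
  case 0
  then show ?case by simp
next
  case (Suc n)
  then show ?case by (subst deriv_bound.simps(2)) (metis deriv_bound.simps(2))
qed

lemma deriv_bound_weaken:
  assumes "deriv_bound W n B f" "\<And>x. B * W x \<le> B' * W' x"
  shows "deriv_bound W' n B' f"
  using assms(1)
proof (induction n arbitrary: f)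
  case 0
  then show ?case using assms(2) by (auto intro: order_trans)
next
  case (Suc n)
  then show ?case using assms(2) by (auto intro: order_trans)
qed

lemma deriv_bound_scale: "deriv_bound W n B f \<Longrightarrow> deriv_bound W n (cmod c * B) (\<lambda>x. c * f x)"
proof (induction n arbitrary: f)
  case 0
  then show ?case by (auto simp: norm_mult mult.assoc intro!: mult_left_mono)
next
  case (Suc n)
  then obtain f' where f': "\<And>x. (f has_vector_derivative f' x) (at x)" "deriv_bound W n B f'" by auto
  have "((\<lambda>x. c * f x) has_vector_derivative c * f' x) (at x)" for x
    by (intro has_vector_derivative_mult_right f')
  then show ?case using Suc.IH[OF f'(2)] Suc.prems
    by (auto simp: norm_mult mult.assoc intro!: mult_left_mono exI[of _ "\<lambda>x. c * f' x"])
qed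

lemma deriv_bound_add:
  "deriv_bound W n A f \<Longrightarrow> deriv_bound W n B g \<Longrightarrow> deriv_bound W n (A + B) (\<lambda>x. f x + g x)"
proof (induction n arbitrary: f g)
  case 0
  then show ?case by (auto simp: distrib_right intro!: order_trans[OF norm_triangle_ineq] add_mono)
next
  case (Suc n)
  then obtain f' g' where f': "\<And>x. (f has_vector_derivative f' x) (at x)" "deriv_bound W n A f'"
    and g': "\<And>x. (g has_vector_derivative g' x) (at x)" "deriv_bound W n B g'" by auto
  have "((\<lambda>x. f x + g x) has_vector_derivative f' x + g' x) (at x)" for x
    by (intro has_vector_derivative_add f' g')
  moreover have "cmod (f x + g x) \<le> (A + B) * W x" for x
    unfolding distrib_right
    by (intro order_trans[OF norm_triangle_ineq] add_mono deriv_bound_pointwise[OF Suc.prems(1)]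
        deriv_bound_pointwise[OF Suc.prems(2)])
  ultimately show ?case using Suc.IH[OF f'(2) g'(2)]
    by (auto intro!: exI[of _ "\<lambda>x. f' x + g' x"])
qed

text \<open>The factor \<open>2 ^ n\<close> is the sum of the binomial coefficients in Leibniz's rule.\<close>

lemma deriv_bound_mult:
  assumes W: "\<And>x. 0 \<le> W x" "\<And>x. 0 \<le> V x" and "0 \<le> A" "0 \<le> B"
  shows "deriv_bound W n A f \<Longrightarrow> deriv_bound V n B g \<Longrightarrow>
    deriv_bound (\<lambda>x. W x * V x) n (2 ^ n * (A * B)) (\<lambda>x. f x * g x)"
proof (induction n arbitrary: f g)
  case 0
  have "cmod (f x) * cmod (g x) \<le> (A * W x) * (B * V x)" for x
    using 0 assms by (intro mult_mono) auto
  then show ?case by (simp add: norm_mult mult_ac)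
next
  case (Suc n)
  then obtain f' g' where f': "\<And>x. (f has_vector_derivative f' x) (at x)" "deriv_bound W n A f'"
    and g': "\<And>x. (g has_vector_derivative g' x) (at x)" "deriv_bound V n B g'" by auto
  note fg = deriv_bound_Suc_imp[OF Suc.prems(1)] deriv_bound_Suc_imp[OF Suc.prems(2)]
  have "((\<lambda>x. f x * g x) has_vector_derivative f x * g' x + f' x * g x) (at x)" for x
    by (intro has_vector_derivative_mult f' g')
  moreover have "deriv_bound (\<lambda>x. W x * V x) n (2 ^ n * (A * B) + 2 ^ n * (A * B)) (\<lambda>x. f x * g' x + f' x * g x)"
    by (intro deriv_bound_add Suc.IH f' g' fg)
  moreover have "cmod (f x * g x) \<le> 2 ^ Suc n * (A * B) * (W x * V x)" for x
  proof -
    have "cmod (f x) * cmod (g x) \<le> (A * W x) * (B * V x)"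
      using assms by (intro mult_mono deriv_bound_pointwise[OF fg(1)] deriv_bound_pointwise[OF fg(2)]) auto
    also have "\<dots> = 1 * (A * B * (W x * V x))" by (simp add: mult_ac)
    also have "\<dots> \<le> 2 ^ Suc n * (A * B * (W x * V x))"
      using assms by (intro mult_right_mono one_le_power mult_nonneg_nonneg) auto
    finally show ?thesis by (simp add: norm_mult mult_ac)
  qed
  moreover have "2 ^ n * (A * B) + 2 ^ n * (A * B) = 2 ^ Suc n * (A * B)" by simp
  ultimately show ?case by (intro deriv_bound_SucI[where f' = "\<lambda>x. f x * g' x + f' x * g x"]) (simp_all only:)
qed

lemma deriv_bound_reflect_shift:
  assumes s: "s = 1 \<or> s = - 1"
  shows "deriv_bound W n B f \<Longrightarrow> deriv_bound (\<lambda>x. W (s * x + c)) n B (\<lambda>x. f (s * x + c))"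
proof (induction n arbitrary: f)
  case 0
  then show ?case by auto
next
  case (Suc n)
  then obtain f' where f': "\<And>x. (f has_vector_derivative f' x) (at x)" "deriv_bound W n B f'" by auto
  have "((\<lambda>x. f (s * x + c)) has_vector_derivative of_real s * f' (s * x + c)) (at x)" for x
  proof -
    have "((\<lambda>x. s * x + c) has_vector_derivative s) (at x)"
      by (auto intro!: derivative_eq_intros simp: has_real_derivative_iff_has_vector_derivative[symmetric])
    from vector_diff_chain_at[OF this f'(1)] show ?thesis
      by (simp add: o_def scaleR_conv_of_real)
  qed
  moreover have "deriv_bound (\<lambda>x. W (s * x + c)) n B (\<lambda>x. of_real s * f' (s * x + c))"
    using deriv_bound_scale[OF Suc.IH[OF f'(2)], of "of_real s"] s by auto
  ultimately show ?case using deriv_bound_pointwise[OF Suc.prems]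
    by (intro deriv_bound_SucI) auto
qed

lemma deriv_bound_cis: "deriv_bound (\<lambda>_. 1) n ((1 + \<bar>c\<bar>) ^ n) (\<lambda>x. cis (c * x))"
proof (induction n)
  case 0
  then show ?case by simp
next
  case (Suc n)
  have "((\<lambda>x. cis (c * x)) has_vector_derivative \<i> * of_real c * cis (c * x)) (at x)" for x
  proof -
    have "((\<lambda>z. exp (\<i> * of_real c * z)) has_field_derivative \<i> * of_real c * exp (\<i> * of_real c * of_real x)) (at (of_real x))"
      by (auto intro!: derivative_eq_intros)
    from has_vector_derivative_real_field[OF this] show ?thesis by (simp add: cis_conv_exp mult_ac)
  qed
  moreover have "deriv_bound (\<lambda>_. 1) n ((1 + \<bar>c\<bar>) ^ Suc n) (\<lambda>x. \<i> * of_real c * cis (c * x))"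
    by (rule deriv_bound_weaken[OF deriv_bound_scale[OF Suc]]) (auto simp: norm_mult intro!: mult_right_mono)
  moreover have "cmod (cis (c * x)) \<le> (1 + \<bar>c\<bar>) ^ Suc n * 1" for x
    using one_le_power[of "1 + \<bar>c\<bar>" "Suc n"] by simp
  ultimately show ?case by (intro deriv_bound_SucI)
qed

lemma deriv_bound_imp_continuous: "deriv_bound W (Suc n) B f \<Longrightarrow> continuous_on S f"
  by (auto intro: continuous_at_imp_continuous_on has_vector_derivative_continuous)

lemma nth_derivative_bound:
  "deriv_bound W n B f \<Longrightarrow> k \<le> n \<Longrightarrow> cmod (nth_derivative k f x) \<le> B * W x"
proof (induction k arbitrary: f n)
  case 0
  then show ?case by (simp add: nth_derivative_def deriv_bound_pointwise)
next
  case (Suc k)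
  then obtain m where m: "n = Suc m" by (cases n) auto
  then obtain f' where f': "\<And>x. (f has_vector_derivative f' x) (at x)" "deriv_bound W m B f'"
    using Suc.prems by auto
  have "(\<lambda>x. vector_derivative f (at x)) = f'"
    using f'(1) by (auto intro: vector_derivative_at)
  then have "nth_derivative (Suc k) f = nth_derivative k f'"
    by (simp add: nth_derivative_def funpow_Suc_right del: funpow.simps)
  then show ?case using Suc.IH[OF f'(2)] Suc.prems m by simp
qed

lemma nth_derivative_differentiable:
  "deriv_bound W n B f \<Longrightarrow> k < n \<Longrightarrow> nth_derivative k f differentiable (at x)"
proof (induction k arbitrary: f n)
  case 0
  then obtain m where "n = Suc m" by (cases n) auto
  with 0 show ?case by (auto simp: nth_derivative_def intro: differentiableI_vector)
next
  case (Suc k)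
  then obtain m where m: "n = Suc m" by (cases n) auto
  then obtain f' where f': "\<And>x. (f has_vector_derivative f' x) (at x)" "deriv_bound W m B f'"
    using Suc.prems by auto
  have "(\<lambda>x. vector_derivative f (at x)) = f'"
    using f'(1) by (auto intro: vector_derivative_at)
  then have "nth_derivative (Suc k) f = nth_derivative k f'"
    by (simp add: nth_derivative_def funpow_Suc_right del: funpow.simps)
  then show ?case using Suc.IH[OF f'(2)] Suc.prems m by simp
qed

abbreviation decay :: "nat \<Rightarrow> real \<Rightarrow> real" where
  "decay m x \<equiv> 1 / (1 + \<bar>x\<bar>) ^ m"

lemma power_mult_decay_le_1: "\<bar>x\<bar> ^ m * decay m x \<le> (1::real)"
  by (simp add: divide_le_eq power_mono)

lemma schwartz_if_deriv_bound:
  assumes "\<And>m n. \<exists>B. deriv_bound (decay m) n B f"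
  shows "schwartz f"
  unfolding schwartz_def
proof (intro conjI allI)
  fix n x
  show "nth_derivative n f differentiable at x"
    using assms[of 0 "Suc n"] nth_derivative_differentiable[of _ "Suc n"] by blast
next
  fix m n
  obtain B where B: "deriv_bound (decay m) n B f" using assms by blast
  have "\<bar>x\<bar> ^ m * cmod (nth_derivative n f x) \<le> \<bar>B\<bar>" for x
  proof -
    have "\<bar>x\<bar> ^ m * cmod (nth_derivative n f x) \<le> \<bar>x\<bar> ^ m * (\<bar>B\<bar> * decay m x)"
      by (intro mult_left_mono order_trans[OF nth_derivative_bound[OF B order_refl]] mult_right_mono) auto
    also have "\<dots> = \<bar>B\<bar> * (\<bar>x\<bar> ^ m * decay m x)" by (simp add: mult_ac)
    also have "\<dots> \<le> \<bar>B\<bar> * 1" by (intro mult_left_mono power_mult_decay_le_1) auto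
    finally show ?thesis by simp
  qed
  then show "\<exists>C. \<forall>x. \<bar>x\<bar> ^ m * cmod (nth_derivative n f x) \<le> C" by blast
qed

lemma schwartz_seminorm_bounds:
  assumes B: "deriv_bound (decay m) n B f" and "0 \<le> B"
  shows "schwartz_seminorm m n f \<le> B" "0 \<le> schwartz_seminorm m n f"
proof -
  have le: "\<bar>x\<bar> ^ m * cmod (nth_derivative n f x) \<le> B" for x
  proof -
    have "\<bar>x\<bar> ^ m * cmod (nth_derivative n f x) \<le> \<bar>x\<bar> ^ m * (B * decay m x)"
      by (intro mult_left_mono nth_derivative_bound[OF B]) auto
    also have "\<dots> = B * (\<bar>x\<bar> ^ m * decay m x)" by (simp add: mult_ac)
    also have "\<dots> \<le> B * 1" using assms by (intro mult_left_mono power_mult_decay_le_1) auto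
    finally show ?thesis by simp
  qed
  show "schwartz_seminorm m n f \<le> B"
    unfolding schwartz_seminorm_def by (rule cSUP_least) (use le in auto)
  have "bdd_above (range (\<lambda>x. \<bar>x\<bar> ^ m * cmod (nth_derivative n f x)))"
    using le by (intro bdd_aboveI2)
  then have "\<bar>0\<bar> ^ m * cmod (nth_derivative n f 0) \<le> schwartz_seminorm m n f"
    unfolding schwartz_seminorm_def by (intro cSUP_upper) auto
  moreover have "0 \<le> \<bar>0::real\<bar> ^ m * cmod (nth_derivative n f 0)" by simp
  ultimately show "0 \<le> schwartz_seminorm m n f" by linarith
qed

section \<open>Test functions and their Fourier transforms\<close>

text \<open>Smooth functions supported in \<open>[-R, R]\<close>.\<close>

definition test_function :: "real \<Rightarrow> (real \<Rightarrow> complex) \<Rightarrow> bool" where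
  "test_function R q \<longleftrightarrow> (\<forall>n. \<exists>B\<ge>0. deriv_bound (indicator {-R..R}) n B q)"

lemma test_function_outside: "test_function R q \<Longrightarrow> R < \<bar>x\<bar> \<Longrightarrow> q x = 0"
proof -
  assume "test_function R q" "R < \<bar>x\<bar>"
  then obtain B where "deriv_bound (indicator {-R..R}) 0 B q" unfolding test_function_def by blast
  then have "cmod (q x) \<le> B * indicator {-R..R} x" by simp
  moreover have "x \<notin> {-R..R}" using \<open>R < \<bar>x\<bar>\<close> by auto
  ultimately show ?thesis by simp
qed

lemma test_function_continuous: "test_function R q \<Longrightarrow> continuous_on S q"
  unfolding test_function_def using deriv_bound_imp_continuous by blast

lemma test_function_integrable: "test_function R q \<Longrightarrow> integrable lborel q"
  by (rule integrable_continuous_compact_support[OF test_function_continuous test_function_outside])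

lemma schwartz_test_function:
  assumes "test_function R q" and R: "0 \<le> R"
  shows "schwartz q"
proof (rule schwartz_if_deriv_bound)
  fix m n
  obtain B where B: "0 \<le> B" "deriv_bound (indicator {-R..R}) n B q"
    using assms unfolding test_function_def by blast
  have "B * indicator {-R..R} x \<le> B * (1 + R) ^ m * decay m x" for x
  proof (cases "x \<in> {-R..R}")
    case True
    then have "(1 + \<bar>x\<bar>) ^ m \<le> (1 + R) ^ m" by (intro power_mono) auto
    then have "1 \<le> (1 + R) ^ m * decay m x" by (simp add: le_divide_eq)
    then have "B * 1 \<le> B * ((1 + R) ^ m * decay m x)" using B(1) by (rule mult_left_mono)
    then show ?thesis using True by (simp add: mult.assoc)
  next
    case False
    then show ?thesis using B(1) R by simp
  qed
  then show "\<exists>B. deriv_bound (decay m) n B q"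
    by (intro exI deriv_bound_weaken[OF B(2)])
qed

lemma test_function_derivative:
  assumes "test_function R q"
  obtains q' where "test_function R q'" "\<And>x. (q has_vector_derivative q' x) (at x)"
proof (rule that)
  let ?q' = "\<lambda>x. vector_derivative q (at x)"
  have *: "(\<forall>x. (q has_vector_derivative ?q' x) (at x)) \<and> (\<exists>B\<ge>0. deriv_bound (indicator {-R..R}) n B ?q')" for n
  proof -
    obtain B where "0 \<le> B" "deriv_bound (indicator {-R..R}) (Suc n) B q"
      using assms unfolding test_function_def by blast
    then obtain f' where f': "\<And>x. (q has_vector_derivative f' x) (at x)" "deriv_bound (indicator {-R..R}) n B f'" by auto
    moreover have "f' = ?q'" using f'(1) by (auto intro!: vector_derivative_at[symmetric])
    ultimately show ?thesis using \<open>0 \<le> B\<close> by auto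
  qed
  show "test_function R ?q'" unfolding test_function_def using * by blast
  show "(q has_vector_derivative ?q' x) (at x)" for x using * by blast
qed

lemma test_function_mult_identity:
  assumes q: "test_function R q" and R: "0 \<le> R"
  shows "test_function R (\<lambda>x. of_real x * q x)"
proof -
  have "deriv_bound (indicator {-R..R}) n ((R + n) * B) (\<lambda>x. of_real x * q x)"
    if "0 \<le> B" "deriv_bound (indicator {-R..R}) n B q" for n B q
    using that(2)
  proof (induction n arbitrary: q)
    case 0
    have "\<bar>x\<bar> * cmod (q x) \<le> R * B * indicator {-R..R} x" for x
    proof (cases "x \<in> {-R..R}")
      case True
      then have "\<bar>x\<bar> * cmod (q x) \<le> R * B"
        using deriv_bound_pointwise[OF 0, of x] R by (intro mult_mono) (auto simp: abs_le_iff)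
      then show ?thesis using True by simp
    next
      case False
      then show ?thesis using deriv_bound_pointwise[OF 0, of x] by simp
    qed
    then show ?case by (simp add: norm_mult)
  next
    case (Suc n)
    then obtain q' where q': "\<And>x. (q has_vector_derivative q' x) (at x)" "deriv_bound (indicator {-R..R}) n B q'" by auto
    have "((\<lambda>x. of_real x * q x) has_vector_derivative of_real x * q' x + 1 * q x) (at x)" for x
      using has_vector_derivative_mult[OF has_vector_derivative_of_real[OF DERIV_ident] q'(1)] by simp
    moreover have "deriv_bound (indicator {-R..R}) n ((R + n) * B + B) (\<lambda>x. of_real x * q' x + 1 * q x)"
      using deriv_bound_add[OF Suc.IH[OF q'(2)] deriv_bound_Suc_imp[OF Suc.prems]] by simp
    moreover have "cmod (of_real x * q x) \<le> ((R + n) * B + B) * indicator {-R..R} x" for x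
    proof (cases "x \<in> {-R..R}")
      case True
      then have "cmod (of_real x * q x) \<le> R * B"
        using deriv_bound_pointwise[OF Suc.prems, of x] R unfolding norm_mult
        by (intro mult_mono) (auto simp: abs_le_iff)
      also have "\<dots> \<le> (R + n) * B + B" using \<open>0 \<le> B\<close> by (simp add: distrib_right)
      finally show ?thesis using True by simp
    next
      case False
      then show ?thesis using deriv_bound_pointwise[OF Suc.prems, of x] by simp
    qed
    moreover have "(R + n) * B + B = (R + Suc n) * B" by (simp add: algebra_simps)
    ultimately show ?case
      by (intro deriv_bound_SucI[where f' = "\<lambda>x. of_real x * q' x + 1 * q x"]) (simp_all only:)
  qed
  moreover have "0 \<le> (R + real n) * B" if "0 \<le> B" for n B using that R by simp
  ultimately show ?thesis using q unfolding test_function_def by metis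
qed

lemma test_function_scale: "test_function R q \<Longrightarrow> test_function R (\<lambda>x. c * q x)"
  unfolding test_function_def by (metis deriv_bound_scale mult_nonneg_nonneg norm_ge_zero)

lemma fourier_test_function_as_integral:
  assumes q: "test_function R q"
  shows "fourier q x = integral (cbox (-R) R) (\<lambda>s. q s * exp (- 2 * of_real pi * \<i> * of_real s * of_real x))"
  unfolding fourier_def
proof (rule integral_compact_support_eq)
  show "continuous_on {-R..R} (\<lambda>s. q s * exp (- 2 * of_real pi * \<i> * of_real s * of_real x))"
    by (intro continuous_intros test_function_continuous[OF q])
  show "q s * exp (- 2 * of_real pi * \<i> * of_real s * of_real x) = 0" if "s \<notin> {-R..R}" for s
    using test_function_outside[OF q, of s] that by (auto simp: abs_if split: if_splits)
qed

lemma fourier_test_function_derivative: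
  assumes q: "test_function R q" and R: "0 \<le> R"
  shows "(fourier q has_vector_derivative fourier (\<lambda>s. - 2 * of_real pi * \<i> * (of_real s * q s)) x) (at x)"
proof -
  let ?e = "\<lambda>s x. exp (- 2 * of_real pi * \<i> * of_real s * of_real x)"
  have q': "test_function R (\<lambda>s. - 2 * of_real pi * \<i> * (of_real s * q s))"
    by (intro test_function_scale test_function_mult_identity q R)
  have "((\<lambda>x. integral (cbox (-R) R) (\<lambda>s. q s * ?e s x)) has_vector_derivative
      integral (cbox (-R) R) (\<lambda>s. - 2 * of_real pi * \<i> * (of_real s * q s) * ?e s x)) (at x within UNIV)"
  proof (rule leibniz_rule_vector_derivative)
    fix x s :: real
    have "((\<lambda>z. q s * exp (- 2 * of_real pi * \<i> * of_real s * z)) has_field_derivative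
        - 2 * of_real pi * \<i> * (of_real s * q s) * ?e s x) (at (of_real x))"
      by (auto intro!: derivative_eq_intros simp: mult_ac)
    from has_vector_derivative_real_field[OF this]
    show "((\<lambda>x. q s * ?e s x) has_vector_derivative - 2 * of_real pi * \<i> * (of_real s * q s) * ?e s x) (at x within UNIV)" .
  next
    show "(\<lambda>s. q s * ?e s x) integrable_on cbox (-R) R" for x
      by (intro integrable_continuous continuous_intros test_function_continuous[OF q])
    have "continuous_on (UNIV \<times> cbox (-R) R) (\<lambda>p::real\<times>real. q (snd p))"
      by (rule continuous_on_compose2[OF test_function_continuous[OF q, of UNIV]]) (auto intro!: continuous_intros)
    then show "continuous_on (UNIV \<times> cbox (-R) R) (\<lambda>(x, s). - 2 * of_real pi * \<i> * (of_real s * q s) * ?e s x)"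
      unfolding split_beta by (intro continuous_intros)
  qed auto
  then show ?thesis
    unfolding fourier_test_function_as_integral[OF q, abs_def]
      fourier_test_function_as_integral[OF q'] by simp
qed

lemma fourier_of_derivative:
  assumes q: "test_function R q" and q': "test_function R q'"
    and R: "0 \<le> R" and d: "\<And>s. (q has_vector_derivative q' s) (at s)"
  shows "fourier q' x = 2 * of_real pi * \<i> * of_real x * fourier q x"
proof -
  let ?e = "\<lambda>s. cis (- 2 * pi * s * x)"
  have e: "(?e has_vector_derivative - 2 * of_real pi * \<i> * of_real x * ?e s) (at s)" for s
  proof -
    have "((\<lambda>z. exp (- 2 * of_real pi * \<i> * of_real x * z)) has_field_derivative
        - 2 * of_real pi * \<i> * of_real x * exp (- 2 * of_real pi * \<i> * of_real x * of_real s)) (at (of_real s))"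
      by (auto intro!: derivative_eq_intros)
    from has_vector_derivative_real_field[OF this] show ?thesis by (simp add: cis_conv_exp mult_ac)
  qed
  have ce: "continuous_on S ?e" for S
    unfolding cis_conv_exp by (intro continuous_intros)
  let ?f = "\<lambda>s. q s * (- 2 * of_real pi * \<i> * of_real x * ?e s) + q' s * ?e s"
  have "(\<integral>s. indicator {- (R + 1)..R + 1} s *\<^sub>R ?f s \<partial>lborel) = q (R + 1) * ?e (R + 1) - q (- (R + 1)) * ?e (- (R + 1))"
  proof (rule integral_FTC_Icc)
    show "((\<lambda>s. q s * ?e s) has_vector_derivative ?f s) (at s within S)" for s S
      by (rule has_vector_derivative_at_within[OF has_vector_derivative_mult[OF d e]])
    show "continuous_on {- (R + 1)..R + 1} ?f"
      by (intro continuous_intros test_function_continuous[OF q] test_function_continuous[OF q'] ce)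
  qed (use R in auto)
  also have "\<dots> = 0" using test_function_outside[OF q] R by simp
  also have "(\<lambda>s. indicator {- (R + 1)..R + 1} s *\<^sub>R ?f s) = (\<lambda>s. - 2 * of_real pi * \<i> * of_real x * (q s * ?e s) + q' s * ?e s)"
  proof
    fix s show "indicator {- (R + 1)..R + 1} s *\<^sub>R ?f s = - 2 * of_real pi * \<i> * of_real x * (q s * ?e s) + q' s * ?e s"
      using test_function_outside[OF q, of s] test_function_outside[OF q', of s]
      by (cases "\<bar>s\<bar> \<le> R") (auto simp: indicator_def mult_ac)
  qed
  also have "(\<integral>s. - 2 * of_real pi * \<i> * of_real x * (q s * ?e s) + q' s * ?e s \<partial>lborel)
      = - 2 * of_real pi * \<i> * of_real x * fourier q x + fourier q' x"
    unfolding fourier_cis integral_mult_right_zero[symmetric]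
    by (intro Bochner_Integration.integral_add integrable_mult_right integrable_mult_cis
        test_function_integrable[OF q] test_function_integrable[OF q']) auto
  finally show ?thesis by (simp add: algebra_simps eq_neg_iff_add_eq_0)
qed

text \<open>One integration by parts gains one power of decay.\<close>

lemma fourier_test_function_decay:
  "test_function R q \<Longrightarrow> 0 \<le> R \<Longrightarrow> \<exists>B\<ge>0. \<forall>x. cmod (fourier q x) \<le> B * decay m x"
proof (induction m arbitrary: q)
  case 0
  then show ?case
    using norm_fourier_le[OF test_function_integrable[OF 0(1)]]
    by (intro exI[of _ "\<integral>x. cmod (q x) \<partial>lborel"]) auto
next
  case (Suc m)
  obtain q' where q': "test_function R q'" "\<And>x. (q has_vector_derivative q' x) (at x)"
    using test_function_derivative[OF Suc.prems(1)] by blast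
  obtain A where A: "0 \<le> A" "\<And>x. cmod (fourier q x) \<le> A * decay m x" using Suc by blast
  obtain B where B: "0 \<le> B" "\<And>x. cmod (fourier q' x) \<le> B * decay m x" using Suc.IH[OF q'(1)] Suc.prems(2) by blast
  have "cmod (fourier q x) \<le> (A + B) * decay (Suc m) x" for x
  proof -
    have "cmod (fourier q' x) = 2 * pi * \<bar>x\<bar> * cmod (fourier q x)"
      unfolding fourier_of_derivative[OF Suc.prems(1) q'(1) Suc.prems(2) q'(2)] by (simp add: norm_mult)
    moreover have "1 * (\<bar>x\<bar> * cmod (fourier q x)) \<le> 2 * pi * (\<bar>x\<bar> * cmod (fourier q x))"
      using pi_ge_two by (intro mult_right_mono) auto
    ultimately have "\<bar>x\<bar> * cmod (fourier q x) \<le> B * decay m x" using B(2)[of x] by simp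
    then have "(1 + \<bar>x\<bar>) * cmod (fourier q x) \<le> (A + B) * decay m x"
      using A(2)[of x] by (simp only: distrib_right mult_1_left)
    moreover have "0 < 1 + \<bar>x\<bar>" by simp
    ultimately have "cmod (fourier q x) \<le> (A + B) * decay m x / (1 + \<bar>x\<bar>)"
      by (simp only: pos_le_divide_eq mult.commute)
    then show ?thesis by (simp add: mult.commute)
  qed
  then show ?case using A B by (intro exI[of _ "A + B"]) auto
qed

text \<open>Differentiating the transform amounts to multiplying the test function by \<open>- 2 pi \<i> s\<close>, which is again a
  test function. In particular the transform is a Schwartz function.\<close>

theorem fourier_test_function_deriv_bound:
  "test_function R q \<Longrightarrow> 0 \<le> R \<Longrightarrow> \<exists>B\<ge>0. deriv_bound (decay m) n B (fourier q)"
proof (induction n arbitrary: q)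
  case 0
  then show ?case using fourier_test_function_decay[OF 0] by simp
next
  case (Suc n)
  let ?q = "\<lambda>s. - 2 * of_real pi * \<i> * (of_real s * q s)"
  have tq: "test_function R ?q"
    by (intro test_function_scale test_function_mult_identity Suc.prems)
  obtain A where A: "0 \<le> A" "deriv_bound (decay m) n A (fourier ?q)" using Suc.IH[OF tq Suc.prems(2)] by blast
  obtain B where B: "0 \<le> B" "\<And>x. cmod (fourier q x) \<le> B * decay m x"
    using fourier_test_function_decay[OF Suc.prems] by blast
  have "deriv_bound (decay m) (Suc n) (A + B) (fourier q)"
  proof (rule deriv_bound_SucI)
    show "cmod (fourier q x) \<le> (A + B) * decay m x" for x
      using A(1) by (intro order_trans[OF B(2)] mult_right_mono) auto
    show "(fourier q has_vector_derivative fourier ?q x) (at x)" for x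
      by (rule fourier_test_function_derivative[OF Suc.prems])
    show "deriv_bound (decay m) n (A + B) (fourier ?q)"
      using B(1) by (intro deriv_bound_weaken[OF A(2)] mult_right_mono) auto
  qed
  then show ?case using A(1) B(1) by (intro exI[of _ "A + B"]) auto
qed

section \<open>Bump functions and wave packets\<close>

lemma poly_exp_bound:
  fixes p :: "real poly"
  shows "0 < c \<Longrightarrow> \<exists>K\<ge>0. \<forall>u\<ge>0. \<bar>poly p u\<bar> \<le> K * exp (c * u)"
proof (induction p arbitrary: c)
  case 0
  then show ?case by (intro exI[of _ 0]) auto
next
  case (pCons a p)
  obtain K where K: "0 \<le> K" "\<And>u. 0 \<le> u \<Longrightarrow> \<bar>poly p u\<bar> \<le> K * exp (c/2 * u)"
    using pCons(2)[of "c/2"] pCons(3) by auto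
  have "\<bar>poly (pCons a p) u\<bar> \<le> (\<bar>a\<bar> + 2/c * K) * exp (c * u)" if u: "0 \<le> u" for u
  proof -
    have e: "exp (c/2 * u) * exp (c/2 * u) = exp (c * u)" by (simp flip: exp_add)
    have "u = 2/c * (c/2 * u)" using \<open>0 < c\<close> by simp
    also have "\<dots> \<le> 2/c * exp (c/2 * u)"
    proof (rule mult_left_mono)
      show "c/2 * u \<le> exp (c/2 * u)" using exp_ge_add_one_self[of "c/2 * u"] by linarith
    qed (use \<open>0 < c\<close> in simp)
    finally have "u * \<bar>poly p u\<bar> \<le> 2/c * exp (c/2 * u) * (K * exp (c/2 * u))"
      using K u by (intro mult_mono) auto
    also have "\<dots> = 2/c * K * exp (c * u)" unfolding e[symmetric] by simp
    finally have 1: "u * \<bar>poly p u\<bar> \<le> 2/c * K * exp (c * u)" .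
    have "\<bar>a\<bar> * 1 \<le> \<bar>a\<bar> * exp (c * u)" using u \<open>0 < c\<close> by (intro mult_left_mono) auto
    moreover have "\<bar>a + u * poly p u\<bar> \<le> \<bar>a\<bar> + u * \<bar>poly p u\<bar>"
      using u abs_triangle_ineq[of a "u * poly p u"] by (simp add: abs_mult)
    ultimately show ?thesis using 1 by (simp add: distrib_right)
  qed
  then show ?case using K(1) \<open>0 < c\<close> by (intro exI[of _ "\<bar>a\<bar> + 2/c * K"]) auto
qed

text \<open>These functions, with \<open>p\<close> ranging over polynomials, contain the derivatives of
  \<open>exp (- 1/x)\<close> extended by \<open>0\<close> to the left.\<close>

definition flat_function :: "real poly \<Rightarrow> real \<Rightarrow> complex" where
  "flat_function p x = (if 0 < x then of_real (poly p (1/x) * exp (- (1/x))) else 0)"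

lemma flat_function_bound: "\<exists>K\<ge>0. \<forall>x. cmod (flat_function p x) \<le> K * indicator {0<..} x"
proof -
  obtain K where K: "0 \<le> K" "\<And>u. 0 \<le> u \<Longrightarrow> \<bar>poly p u\<bar> \<le> K * exp (1 * u)"
    using poly_exp_bound[of 1 p] by auto
  have "cmod (flat_function p x) \<le> K * indicator {0<..} x" for x
  proof (cases "0 < x")
    case True
    then have "\<bar>poly p (1/x)\<bar> * exp (- (1/x)) \<le> K * exp (1/x) * exp (- (1/x))"
      using K(2)[of "1/x"] by (intro mult_right_mono) auto
    also have "\<dots> = K" by (simp add: mult.assoc flip: exp_add)
    finally show ?thesis using True unfolding flat_function_def by (simp add: norm_mult abs_mult del: of_real_mult)
  qed (simp add: flat_function_def)
  with K(1) show ?thesis by blast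
qed

lemma flat_function_derivative:
  "(flat_function p has_vector_derivative flat_function (monom 1 2 * (p - pderiv p)) x) (at x)"
proof (cases x "0 :: real" rule: linorder_cases)
  case less
  have "((\<lambda>_. 0) has_vector_derivative flat_function (monom 1 2 * (p - pderiv p)) x) (at x)"
    using less by (simp add: flat_function_def)
  then show ?thesis
    by (rule has_vector_derivative_transform_within_open[of _ _ _ "{..<0}"])
       (use less in \<open>auto simp: flat_function_def\<close>)
next
  case greater
  have "((\<lambda>y. poly p (1/y) * exp (- (1/y))) has_real_derivative
      poly (monom 1 2 * (p - pderiv p)) (1/x) * exp (- (1/x))) (at x)"
    using greater by (auto intro!: derivative_eq_intros simp: poly_monom field_simps power2_eq_square)
  then have "((\<lambda>y. complex_of_real (poly p (1/y) * exp (- (1/y)))) has_vector_derivative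
      of_real (poly (monom 1 2 * (p - pderiv p)) (1/x) * exp (- (1/x)))) (at x)"
    by (rule has_vector_derivative_of_real)
  then have "((\<lambda>y. complex_of_real (poly p (1/y) * exp (- (1/y)))) has_vector_derivative
      flat_function (monom 1 2 * (p - pderiv p)) x) (at x)"
    using greater by (simp only: flat_function_def if_True)
  then show ?thesis
    by (rule has_vector_derivative_transform_within_open[of _ _ _ "{0<..}"])
       (use greater in \<open>auto simp: flat_function_def\<close>)
next
  case equal
  obtain K where K: "0 \<le> K" "\<And>x. cmod (flat_function (monom 1 2 * p) x) \<le> K * indicator {0<..} x"
    using flat_function_bound by blast
  have b: "cmod (flat_function p y) \<le> K * y\<^sup>2" for y
  proof (cases "0 < y")
    case True
    have "flat_function (monom 1 2 * p) y = flat_function p y / of_real (y\<^sup>2)"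
      using True by (simp add: flat_function_def poly_monom power_divide)
    then have "cmod (flat_function p y) / y\<^sup>2 \<le> K"
      using K(2)[of y] True by (simp add: norm_divide norm_power)
    then show ?thesis using True by (simp add: field_simps)
  qed (use K(1) in \<open>simp add: flat_function_def\<close>)
  have "((\<lambda>h. cmod (flat_function p h) / \<bar>h\<bar>) \<longlongrightarrow> 0) (at 0)"
  proof (rule Lim_null_comparison)
    have "norm (cmod (flat_function p h) / \<bar>h\<bar>) \<le> K * \<bar>h\<bar>" for h
    proof (cases "h = 0")
      case False
      have "cmod (flat_function p h) / \<bar>h\<bar> \<le> K * h\<^sup>2 / \<bar>h\<bar>" by (intro divide_right_mono b) auto
      also have "\<dots> = K * \<bar>h\<bar>" using False by (simp add: power2_eq_square abs_if)
      finally show ?thesis by simp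
    qed simp
    then show "\<forall>\<^sub>F h in at 0. norm (cmod (flat_function p h) / \<bar>h\<bar>) \<le> K * \<bar>h\<bar>"
      by (intro always_eventually allI)
    show "((\<lambda>h. K * \<bar>h\<bar>) \<longlongrightarrow> 0) (at 0)" by (auto intro!: tendsto_eq_intros)
  qed
  moreover have "flat_function q 0 = 0" for q by (simp add: flat_function_def)
  ultimately show ?thesis
    unfolding equal has_vector_derivative_def has_derivative_at by simp
qed

lemma flat_function_deriv_bound: "\<exists>K\<ge>0. deriv_bound (indicator {0<..}) n K (flat_function p)"
proof (induction n arbitrary: p)
  case 0
  then show ?case using flat_function_bound by simp
next
  case (Suc n)
  obtain A where A: "0 \<le> A" "deriv_bound (indicator {0<..}) n A (flat_function (monom 1 2 * (p - pderiv p)))"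
    using Suc by blast
  obtain B where B: "0 \<le> B" "\<And>x. cmod (flat_function p x) \<le> B * indicator {0<..} x"
    using flat_function_bound by blast
  have "deriv_bound (indicator {0<..}) (Suc n) (A + B) (flat_function p)"
  proof (rule deriv_bound_SucI)
    show "cmod (flat_function p x) \<le> (A + B) * indicator {0<..} x" for x
      using A(1) by (intro order_trans[OF B(2)] mult_right_mono) auto
    show "deriv_bound (indicator {0<..}) n (A + B) (flat_function (monom 1 2 * (p - pderiv p)))"
      using B(1) by (intro deriv_bound_weaken[OF A(2)] mult_right_mono) auto
  qed (rule flat_function_derivative)
  then show ?case using A(1) B(1) by (intro exI[of _ "A + B"]) auto
qed

definition bump :: "real \<Rightarrow> real \<Rightarrow> real" where
  "bump \<delta> x = (if \<bar>x\<bar> < \<delta> then exp (- (1/(\<delta> + x))) * exp (- (1/(\<delta> - x))) else 0)"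

lemma bump_nonneg: "0 \<le> bump \<delta> x"
  by (auto simp: bump_def)

lemma test_function_bump:
  assumes "0 < \<delta>"
  shows "test_function \<delta> (\<lambda>x. of_real (bump \<delta> x))"
  unfolding test_function_def
proof
  fix n
  obtain K where K: "0 \<le> K" "deriv_bound (indicator {0<..}) n K (flat_function 1)"
    using flat_function_deriv_bound by blast
  have "deriv_bound (\<lambda>x. indicator {0<..} (1 * x + \<delta>) * indicator {0<..} (- 1 * x + \<delta>)) n (2 ^ n * (K * K))
      (\<lambda>x. flat_function 1 (1 * x + \<delta>) * flat_function 1 (- 1 * x + \<delta>))"
    by (intro deriv_bound_mult deriv_bound_reflect_shift K) auto
  moreover have "flat_function 1 (1 * x + \<delta>) * flat_function 1 (- 1 * x + \<delta>) = of_real (bump \<delta> x)" for x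
    by (auto simp: flat_function_def bump_def add.commute abs_less_iff)
  ultimately have b: "deriv_bound (\<lambda>x. indicator {0<..} (1 * x + \<delta>) * indicator {0<..} (- 1 * x + \<delta>)) n (2 ^ n * (K * K))
      (\<lambda>x. of_real (bump \<delta> x))" by (simp only:)
  have "deriv_bound (indicator {-\<delta>..\<delta>}) n (2 ^ n * (K * K)) (\<lambda>x. of_real (bump \<delta> x))"
    by (rule deriv_bound_weaken[OF b]) (use K(1) in \<open>auto split: split_indicator\<close>)
  then show "\<exists>B\<ge>0. deriv_bound (indicator {-\<delta>..\<delta>}) n B (\<lambda>x. of_real (bump \<delta> x))"
    using K(1) by (intro exI[of _ "2 ^ n * (K * K)"]) auto
qed

lemma integral_bump_pos:
  assumes "0 < \<delta>"
  shows "integrable lborel (bump \<delta>)" "0 < (\<integral>x. bump \<delta> x \<partial>lborel)"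
proof -
  have "integrable lborel (\<lambda>x. Re (of_real (bump \<delta> x)))"
    by (rule integrable_Re[OF test_function_integrable[OF test_function_bump[OF assms]]])
  then show i: "integrable lborel (bump \<delta>)" by simp
  have "(\<integral>x. bump \<delta> x \<partial>lborel) \<noteq> 0"
  proof
    assume "(\<integral>x. bump \<delta> x \<partial>lborel) = 0"
    then have "AE x in lborel. bump \<delta> x = 0"
      using integral_nonneg_eq_0_iff_AE[OF i] bump_nonneg by auto
    then obtain x where "- \<delta> < x" "x < \<delta>" "bump \<delta> x = 0"
      using AE_lborel_dense[of "\<lambda>x. bump \<delta> x = 0" "- \<delta>" \<delta>] assms by auto
    moreover from this have "\<bar>x\<bar> < \<delta>" by linarith
    ultimately show False unfolding bump_def by simp
  qed
  then show "0 < (\<integral>x. bump \<delta> x \<partial>lborel)"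
    using integral_nonneg_AE[of "bump \<delta>" lborel] bump_nonneg by (auto simp: less_le)
qed

text \<open>A bump function centred at \<open>t\<close>, modulated so that its transform is centred at \<open>a\<close>.\<close>

definition wave_packet :: "real \<Rightarrow> real \<Rightarrow> real \<Rightarrow> real \<Rightarrow> complex" where
  "wave_packet \<delta> a t s = of_real (bump \<delta> (s - t)) * cis (2 * pi * a * s)"

lemma test_function_wave_packet:
  assumes \<delta>: "0 < \<delta>"
  shows "test_function (\<bar>t\<bar> + \<delta>) (wave_packet \<delta> a t)"
  unfolding test_function_def
proof
  fix n
  obtain K where K: "0 \<le> K" "deriv_bound (indicator {-\<delta>..\<delta>}) n K (\<lambda>x. of_real (bump \<delta> x))"
    using test_function_bump[OF \<delta>] unfolding test_function_def by blast
  let ?A = "2 ^ n * (K * (1 + \<bar>2 * pi * a\<bar>) ^ n)"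
  have "deriv_bound (\<lambda>s. indicator {-\<delta>..\<delta>} (1 * s + (- t)) * 1) n ?A
      (\<lambda>s. of_real (bump \<delta> (1 * s + (- t))) * cis (2 * pi * a * s))"
    by (intro deriv_bound_mult deriv_bound_reflect_shift[OF _ K(2)] deriv_bound_cis K) auto
  then have "deriv_bound (indicator {- (\<bar>t\<bar> + \<delta>)..\<bar>t\<bar> + \<delta>}) n ?A
      (\<lambda>s. of_real (bump \<delta> (1 * s + (- t))) * cis (2 * pi * a * s))"
    by (rule deriv_bound_weaken) (use K(1) in \<open>auto split: split_indicator\<close>)
  then show "\<exists>B\<ge>0. deriv_bound (indicator {- (\<bar>t\<bar> + \<delta>)..\<bar>t\<bar> + \<delta>}) n B (wave_packet \<delta> a t)"
    using K(1) by (intro exI[of _ ?A]) (auto simp: wave_packet_def[abs_def])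
qed

lemma support_wave_packet: "support (wave_packet \<delta> a t) \<subseteq> {t - \<delta>..t + \<delta>}"
  unfolding support_def
  by (rule closure_minimal) (auto simp: wave_packet_def bump_def split: if_splits)

lemma fourier_wave_packet:
  "fourier (wave_packet \<delta> a t) x = cis (2 * pi * (a - x) * t) * fourier (\<lambda>s. of_real (bump \<delta> s)) (x - a)"
proof -
  have "fourier (wave_packet \<delta> a t) x = (\<integral>s. of_real (bump \<delta> (s - t)) * cis (2 * pi * a * s) * cis (- 2 * pi * s * x) \<partial>lborel)"
    by (simp add: fourier_cis wave_packet_def)
  also have "\<dots> = \<bar>1\<bar> *\<^sub>R (\<integral>v. of_real (bump \<delta> (t + 1 * v - t)) * cis (2 * pi * a * (t + 1 * v)) * cis (- 2 * pi * (t + 1 * v) * x) \<partial>lborel)"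
    by (rule lborel_integral_real_affine) simp
  also have "\<dots> = (\<integral>v. cis (2 * pi * (a - x) * t) * (of_real (bump \<delta> v) * cis (- 2 * pi * v * (x - a))) \<partial>lborel)"
    unfolding abs_one scaleR_one
  proof (intro Bochner_Integration.integral_cong refl)
    fix v
    have "cis (2 * pi * a * (t + 1 * v)) * cis (- 2 * pi * (t + 1 * v) * x) = cis (2 * pi * (a - x) * t) * cis (- 2 * pi * v * (x - a))"
      unfolding cis_mult by (rule arg_cong[where f = cis]) (simp add: algebra_simps)
    then show "of_real (bump \<delta> (t + 1 * v - t)) * cis (2 * pi * a * (t + 1 * v)) * cis (- 2 * pi * (t + 1 * v) * x)
        = cis (2 * pi * (a - x) * t) * (of_real (bump \<delta> v) * cis (- 2 * pi * v * (x - a)))"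
      by (simp add: mult.assoc mult.left_commute)
  qed
  finally show ?thesis unfolding fourier_cis integral_mult_right_zero .
qed

lemma schwartz_fourier_wave_packet:
  assumes "0 < \<delta>"
  shows "schwartz (fourier (wave_packet \<delta> a t))"
proof (rule schwartz_if_deriv_bound)
  have "0 \<le> \<bar>t\<bar> + \<delta>" using assms by simp
  from fourier_test_function_deriv_bound[OF test_function_wave_packet[OF assms] this]
  show "\<exists>B. deriv_bound (decay m) n B (fourier (wave_packet \<delta> a t))" for m n by blast
qed

text \<open>The bound is uniform for \<open>t\<close> in a compact set and polynomial in \<open>a\<close>: translating by \<open>a\<close> changes the weight
  \<open>decay m\<close> by at most the factor \<open>(1 + |a|) ^ m\<close>, and the phase has bounded derivatives.\<close>

lemma fourier_wave_packet_deriv_bound: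
  assumes \<delta>: "0 < \<delta>"
  shows "\<exists>K\<ge>0. \<forall>a t. \<bar>t\<bar> \<le> T \<longrightarrow>
    deriv_bound (decay m) n (K * (1 + \<bar>a\<bar>) ^ m) (fourier (wave_packet \<delta> a t))"
proof -
  obtain B where B: "0 \<le> B" "deriv_bound (decay m) n B (fourier (\<lambda>s. of_real (bump \<delta> s)))"
    using fourier_test_function_deriv_bound[OF test_function_bump[OF \<delta>] less_imp_le[OF \<delta>]] by blast
  \<comment> \<open>Leibniz factor, derivatives of the phase, derivatives of the transform of the bump\<close>
  define K where "K = 2 ^ n * ((1 + 2 * pi * \<bar>T\<bar>) ^ n * B)"
  have "deriv_bound (decay m) n (K * (1 + \<bar>a\<bar>) ^ m) (fourier (wave_packet \<delta> a t))" if t: "\<bar>t\<bar> \<le> T" for a t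
  proof -
    have "deriv_bound (\<lambda>x. 1 * decay m (1 * x + (- a))) n (2 ^ n * ((1 + \<bar>- 2 * pi * t\<bar>) ^ n * B))
        (\<lambda>x. cis (- 2 * pi * t * x) * fourier (\<lambda>s. of_real (bump \<delta> s)) (1 * x + (- a)))"
      by (intro deriv_bound_mult deriv_bound_reflect_shift[OF _ B(2)] deriv_bound_cis B) auto
    from deriv_bound_scale[OF this, of "cis (2 * pi * a * t)"]
    have 1: "deriv_bound (\<lambda>x. decay m (x - a)) n (2 ^ n * ((1 + \<bar>- 2 * pi * t\<bar>) ^ n * B))
        (\<lambda>x. cis (2 * pi * a * t) * (cis (- 2 * pi * t * x) * fourier (\<lambda>s. of_real (bump \<delta> s)) (x - a)))"
      by simp
    have "cis (2 * pi * a * t) * cis (- 2 * pi * t * x) = cis (2 * pi * (a - x) * t)" for x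
      unfolding cis_mult by (rule arg_cong[where f = cis]) (simp add: algebra_simps)
    then have "cis (2 * pi * a * t) * (cis (- 2 * pi * t * x) * fourier (\<lambda>s. of_real (bump \<delta> s)) (x - a))
        = fourier (wave_packet \<delta> a t) x" for x
      by (simp only: mult.assoc[symmetric] fourier_wave_packet)
    with 1 have 2: "deriv_bound (\<lambda>x. decay m (x - a)) n (2 ^ n * ((1 + \<bar>- 2 * pi * t\<bar>) ^ n * B)) (fourier (wave_packet \<delta> a t))"
      by (simp only:)
    show ?thesis
    proof (rule deriv_bound_weaken[OF 2])
      fix x
      have "2 * pi * \<bar>t\<bar> \<le> 2 * pi * \<bar>T\<bar>" using t by (intro mult_left_mono) auto
      then have "2 ^ n * ((1 + \<bar>- 2 * pi * t\<bar>) ^ n * B) \<le> K"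
        unfolding K_def using B(1) by (intro mult_left_mono mult_right_mono power_mono) (auto simp: abs_mult)
      moreover have "decay m (x - a) \<le> (1 + \<bar>a\<bar>) ^ m * decay m x"
      proof -
        have "1 + \<bar>x\<bar> \<le> 1 + \<bar>x - a\<bar> + \<bar>a\<bar> + \<bar>a\<bar> * \<bar>x - a\<bar>" 
        proof -
          have "0 \<le> \<bar>a\<bar> * \<bar>x - a\<bar>" by (rule mult_nonneg_nonneg) auto
          then show ?thesis by linarith
        qed
        also have "\<dots> = (1 + \<bar>a\<bar>) * (1 + \<bar>x - a\<bar>)" by (simp add: algebra_simps)
        finally have "(1 + \<bar>x\<bar>) ^ m \<le> ((1 + \<bar>a\<bar>) * (1 + \<bar>x - a\<bar>)) ^ m" by (intro power_mono) auto
        then show ?thesis unfolding power_mult_distrib by (simp add: divide_le_eq le_divide_eq)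
      qed
      ultimately have "2 ^ n * ((1 + \<bar>- 2 * pi * t\<bar>) ^ n * B) * decay m (x - a) \<le> K * ((1 + \<bar>a\<bar>) ^ m * decay m x)"
        using B(1) by (intro mult_mono) (auto simp: K_def)
      then show "2 ^ n * ((1 + \<bar>- 2 * pi * t\<bar>) ^ n * B) * decay m (x - a) \<le> K * (1 + \<bar>a\<bar>) ^ m * decay m x"
        by (simp only: mult.assoc)
    qed
  qed
  moreover have "0 \<le> K" using B(1) by (simp add: K_def)
  ultimately show ?thesis by blast
qed

section \<open>A Paley-Wiener theorem for tempered functions\<close>

text \<open>The inverse Fourier transform of \<open>U\<close> restricted to \<open>[-T, T]\<close>, at a complex argument.\<close>

definition band_limited :: "real \<Rightarrow> (real \<Rightarrow> complex) \<Rightarrow> complex \<Rightarrow> complex" where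
  "band_limited T U z = integral (cbox (- T) T) (\<lambda>t. U t * exp (2 * of_real pi * \<i> * z * of_real t))"

lemma holomorphic_band_limited:
  assumes "continuous_on {-T..T} U"
  shows "band_limited T U holomorphic_on UNIV"
  unfolding band_limited_def[abs_def]
proof (rule leibniz_rule_holomorphic)
  show "((\<lambda>z. U t * exp (2 * of_real pi * \<i> * z * of_real t)) has_field_derivative
      U t * (exp (2 * of_real pi * \<i> * z * of_real t) * (2 * of_real pi * \<i> * of_real t))) (at z within UNIV)" for z t
    by (auto intro!: derivative_eq_intros)
  show "(\<lambda>t. U t * exp (2 * of_real pi * \<i> * z * of_real t)) integrable_on cbox (- T) T" for z
    using assms by (intro integrable_continuous continuous_intros) auto
  have "continuous_on (UNIV \<times> cbox (-T) T) (\<lambda>p::complex\<times>real. U (snd p))"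
    by (rule continuous_on_compose2[OF assms]) (auto intro!: continuous_intros)
  then show "continuous_on (UNIV \<times> cbox (- T) T)
      (\<lambda>(z, t). U t * (exp (2 * of_real pi * \<i> * z * of_real t) * (2 * of_real pi * \<i> * of_real t)))"
    unfolding split_beta by (intro continuous_intros)
qed auto

lemma band_limited_bound:
  assumes U: "continuous_on {-T..T} U" and A: "\<And>t. \<bar>t\<bar> \<le> T \<Longrightarrow> cmod (U t) \<le> A" and T: "0 \<le> T"
  shows "cmod (band_limited T U z) \<le> A * exp (2 * pi * T * \<bar>Im z\<bar>) * (2 * T)"
proof -
  have A0: "0 \<le> A" using A[of 0] T norm_ge_zero[of "U 0"] by linarith
  have "norm (integral {-T..T} (\<lambda>t. U t * exp (2 * of_real pi * \<i> * z * of_real t))) \<le> A * exp (2 * pi * T * \<bar>Im z\<bar>) * (T - - T)"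
  proof (rule integral_bound)
    show "continuous_on {-T..T} (\<lambda>t. U t * exp (2 * of_real pi * \<i> * z * of_real t))"
      by (intro continuous_intros U)
    fix t assume t: "t \<in> {-T..T}"
    have "Re (2 * of_real pi * \<i> * z * of_real t) = 2 * pi * (- Im z * t)" by simp
    also have "\<dots> \<le> 2 * pi * (\<bar>Im z\<bar> * T)"
    proof (rule mult_left_mono)
      have "- Im z * t \<le> \<bar>Im z\<bar> * \<bar>t\<bar>" by (metis abs_ge_self abs_minus_cancel abs_mult)
      also have "\<dots> \<le> \<bar>Im z\<bar> * T" using t by (intro mult_left_mono) auto
      finally show "- Im z * t \<le> \<bar>Im z\<bar> * T" .
    qed simp
    finally have "cmod (exp (2 * of_real pi * \<i> * z * of_real t)) \<le> exp (2 * pi * T * \<bar>Im z\<bar>)"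
      by (simp add: norm_exp_eq_Re mult_ac)
    then show "norm (U t * exp (2 * of_real pi * \<i> * z * of_real t)) \<le> A * exp (2 * pi * T * \<bar>Im z\<bar>)"
      unfolding norm_mult using A[of t] t A0 by (intro mult_mono) (auto simp: abs_le_iff)
  qed (use T in auto)
  then show ?thesis by (simp add: band_limited_def)
qed

lemma band_limited_of_real:
  assumes "continuous_on UNIV U" "\<And>t. T < \<bar>t\<bar> \<Longrightarrow> U t = 0"
  shows "band_limited T U (of_real x) = (\<integral>t. U t * cis (2 * pi * x * t) \<partial>lborel)"
proof -
  have "(\<integral>t. U t * exp (2 * of_real pi * \<i> * of_real x * of_real t) \<partial>lborel) = band_limited T U (of_real x)"
    unfolding band_limited_def
  proof (rule integral_compact_support_eq)
    show "continuous_on {-T..T} (\<lambda>t. U t * exp (2 * of_real pi * \<i> * of_real x * of_real t))"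
      by (intro continuous_intros continuous_on_subset[OF assms(1)]) auto
    show "U s * exp (2 * of_real pi * \<i> * of_real x * of_real s) = 0" if "s \<notin> {-T..T}" for s
      using assms(2)[of s] that by auto
  qed
  then show ?thesis by (simp add: cis_conv_exp mult_ac)
qed

definition bump_transform :: "real \<Rightarrow> complex \<Rightarrow> complex" where
  "bump_transform \<delta> z = band_limited \<delta> (\<lambda>s. of_real (bump \<delta> s)) (- z)"

text \<open>On the imaginary axis the transform is the integral of the bump function against a positive exponential,
  which is at least \<open>exp (- 2 pi \<delta> |y|)\<close> on the support.\<close>

lemma bump_transform_properties:
  assumes \<delta>: "0 < \<delta>"
  shows "bump_transform \<delta> holomorphic_on UNIV"
    and "bump_transform \<delta> (of_real x) = fourier (\<lambda>s. of_real (bump \<delta> s)) x"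
    and "(\<integral>s. bump \<delta> s \<partial>lborel) * exp (- 2 * pi * \<delta> * \<bar>y\<bar>) \<le> cmod (bump_transform \<delta> (\<i> * of_real y))"
proof -
  have c: "continuous_on S (\<lambda>s. complex_of_real (bump \<delta> s))" for S
    by (rule test_function_continuous[OF test_function_bump[OF \<delta>]])
  have z: "complex_of_real (bump \<delta> s) = 0" if "\<delta> < \<bar>s\<bar>" for s
    by (rule test_function_outside[OF test_function_bump[OF \<delta>] that])
  have "(band_limited \<delta> (\<lambda>s. of_real (bump \<delta> s)) \<circ> uminus) holomorphic_on UNIV"
    by (rule holomorphic_on_compose_gen[OF _ holomorphic_band_limited[OF c]]) (auto intro: holomorphic_intros)
  then show "bump_transform \<delta> holomorphic_on UNIV"
    by (simp add: bump_transform_def[abs_def] comp_def)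
  show "bump_transform \<delta> (of_real x) = fourier (\<lambda>s. of_real (bump \<delta> s)) x"
    using band_limited_of_real[OF c z, of "\<delta>" "- x"] by (simp add: bump_transform_def fourier_cis mult_ac)
  let ?f = "\<lambda>t. bump \<delta> t * exp (2 * pi * y * t)"
  have cb: "continuous_on S (bump \<delta>)" for S
    using continuous_on_Re[OF c] by simp
  have "bump_transform \<delta> (\<i> * of_real y) = integral {-\<delta>..\<delta>} (\<lambda>t. of_real (?f t))"
    unfolding bump_transform_def band_limited_def by (simp add: exp_of_real[symmetric] mult_ac)
  also have "\<dots> = of_real (integral {-\<delta>..\<delta>} ?f)"
    by (intro integral_unique has_integral_of_real integrable_integral integrable_continuous_interval continuous_intros cb)
  finally have "cmod (bump_transform \<delta> (\<i> * of_real y)) = \<bar>integral {-\<delta>..\<delta>} ?f\<bar>" by (simp only: norm_of_real)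
  moreover have "(\<integral>s. bump \<delta> s \<partial>lborel) * exp (- 2 * pi * \<delta> * \<bar>y\<bar>) \<le> integral {-\<delta>..\<delta>} ?f"
  proof -
    have "complex_of_real (\<integral>s. bump \<delta> s \<partial>lborel) = (\<integral>s. of_real (bump \<delta> s) \<partial>lborel)" by simp
    also have "\<dots> = integral (cbox (-\<delta>) \<delta>) (\<lambda>s. of_real (bump \<delta> s))"
      by (rule integral_compact_support_eq[OF c]) (rule z, auto)
    also have "\<dots> = of_real (integral {-\<delta>..\<delta>} (bump \<delta>))"
      unfolding cbox_interval by (intro integral_unique has_integral_of_real integrable_integral integrable_continuous_interval cb)
    finally have e: "(\<integral>s. bump \<delta> s \<partial>lborel) = integral {-\<delta>..\<delta>} (bump \<delta>)" by simp
    have "integral {-\<delta>..\<delta>} (\<lambda>t. bump \<delta> t * exp (- 2 * pi * \<delta> * \<bar>y\<bar>)) \<le> integral {-\<delta>..\<delta>} ?f"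
    proof (rule integral_le)
      fix t assume t: "t \<in> {-\<delta>..\<delta>}"
      have "\<bar>y * t\<bar> \<le> \<bar>y\<bar> * \<delta>" using t unfolding abs_mult by (intro mult_left_mono) auto
      then have "- (\<bar>y\<bar> * \<delta>) \<le> y * t" by linarith
      then have "2 * pi * - (\<bar>y\<bar> * \<delta>) \<le> 2 * pi * (y * t)" by (intro mult_left_mono) auto
      then have "- 2 * pi * \<delta> * \<bar>y\<bar> \<le> 2 * pi * y * t" by (simp add: mult_ac)
      then show "bump \<delta> t * exp (- 2 * pi * \<delta> * \<bar>y\<bar>) \<le> ?f t"
        using bump_nonneg[of \<delta> t] by (intro mult_left_mono) auto
    qed (intro integrable_continuous_interval continuous_intros cb)+
    then show ?thesis unfolding e by simp
  qed
  ultimately show "(\<integral>s. bump \<delta> s \<partial>lborel) * exp (- 2 * pi * \<delta> * \<bar>y\<bar>) \<le> cmod (bump_transform \<delta> (\<i> * of_real y))"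
    by linarith
qed

lemma bump_transform_imaginary_nonzero:
  assumes "0 < \<delta>" shows "bump_transform \<delta> (\<i> * of_real y) \<noteq> 0"
proof
  assume 0: "bump_transform \<delta> (\<i> * of_real y) = 0"
  have "0 < (\<integral>s. bump \<delta> s \<partial>lborel) * exp (- 2 * pi * \<delta> * \<bar>y\<bar>)"
    using integral_bump_pos(2)[OF assms] by simp
  then show False using bump_transform_properties(3)[OF assms, of y] 0 by simp
qed

text \<open>The distribution \<open>g - p\<close> has no frequencies outside \<open>[-1/2, 1/2]\<close>.\<close>

locale spectrally_supported =
  fixes g p :: "real \<Rightarrow> real"
  assumes g: "defines_tempered_distribution g"
    and p: "integrable lborel p"
    and eq: "\<And>\<phi>. schwartz \<phi> \<Longrightarrow> support \<phi> \<subseteq> - {- 1/2..1/2} \<Longrightarrow>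
      distribution_of g (fourier \<phi>) = (\<integral>x. of_real (p x) * fourier \<phi> x \<partial>lborel)"
begin

definition windowed :: "real \<Rightarrow> real \<Rightarrow> real \<Rightarrow> complex" where
  "windowed \<delta> a x = of_real (g x - p x) * fourier (\<lambda>s. of_real (bump \<delta> s)) (x - a)"

lemma integrable_packet_products:
  assumes "0 < \<delta>"
  shows "integrable lborel (\<lambda>x. of_real (g x) * fourier (wave_packet \<delta> a t) x)"
    and "integrable lborel (\<lambda>x. of_real (p x) * fourier (wave_packet \<delta> a t) x)"
proof -
  show "integrable lborel (\<lambda>x. of_real (g x) * fourier (wave_packet \<delta> a t) x)"
    using g schwartz_fourier_wave_packet[OF assms] unfolding defines_tempered_distribution_def by blast
  let ?M = "\<integral>s. cmod (wave_packet \<delta> a t s) \<partial>lborel"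
  note i = test_function_integrable[OF test_function_wave_packet[OF assms, of t a]]
  show "integrable lborel (\<lambda>x. of_real (p x) * fourier (wave_packet \<delta> a t) x)"
  proof (rule Bochner_Integration.integrable_bound)
    show "integrable lborel (\<lambda>x. p x * ?M)" using p by (rule integrable_mult_left)
    have "fourier (wave_packet \<delta> a t) \<in> borel_measurable borel"
      by (rule borel_measurable_continuous_onI[OF continuous_on_fourier[OF i]])
    then show "(\<lambda>x. of_real (p x) * fourier (wave_packet \<delta> a t) x) \<in> borel_measurable lborel"
      using borel_measurable_integrable[OF p] by simp
    show "AE x in lborel. norm (of_real (p x) * fourier (wave_packet \<delta> a t) x) \<le> norm (p x * ?M)"
      using order_trans[OF norm_fourier_le[OF i] abs_ge_self]
      by (intro AE_I2) (simp add: norm_mult abs_mult mult_left_mono)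
  qed
qed

lemma windowed_eq:
  "windowed \<delta> a x = of_real (g x) * fourier (wave_packet \<delta> a 0) x - of_real (p x) * fourier (wave_packet \<delta> a 0) x"
  by (simp add: windowed_def fourier_wave_packet left_diff_distrib)

lemma integrable_windowed: "0 < \<delta> \<Longrightarrow> integrable lborel (windowed \<delta> a)"
  unfolding windowed_eq[abs_def] by (intro Bochner_Integration.integrable_diff integrable_packet_products)

text \<open>Up to a phase, the transform of \<open>g - p\<close> times a translated window is the Fourier transform of the
  distribution \<open>g - p\<close>, evaluated at a wave packet.\<close>

lemma fourier_windowed:
  assumes "0 < \<delta>"
  shows "fourier (windowed \<delta> a) t = cis (- 2 * pi * a * t) *
    (distribution_of g (fourier (wave_packet \<delta> a t)) - (\<integral>x. of_real (p x) * fourier (wave_packet \<delta> a t) x \<partial>lborel))"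
proof -
  have "windowed \<delta> a x * cis (- 2 * pi * x * t) = cis (- 2 * pi * a * t) *
      (of_real (g x) * fourier (wave_packet \<delta> a t) x - of_real (p x) * fourier (wave_packet \<delta> a t) x)" for x
  proof -
    have "cis (- 2 * pi * a * t) * cis (2 * pi * (a - x) * t) = cis (- 2 * pi * x * t)"
      unfolding cis_mult by (rule arg_cong[where f = cis]) (simp add: algebra_simps)
    then show ?thesis
      unfolding windowed_def fourier_wave_packet
      by (simp only: left_diff_distrib[symmetric] of_real_diff[symmetric] mult.left_commute[of "cis (- 2 * pi * a * t)"]
          mult.assoc[symmetric]) (simp only: mult_ac)
  qed
  then show ?thesis
    unfolding fourier_cis[of "windowed \<delta> a"] distribution_of_def
    by (simp only: integral_mult_right_zero Bochner_Integration.integral_diff[OF integrable_packet_products[OF assms]])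
qed

lemma fourier_windowed_zero:
  assumes \<delta>: "0 < \<delta>" and t: "1/2 + \<delta> < \<bar>t\<bar>"
  shows "fourier (windowed \<delta> a) t = 0"
proof -
  have "schwartz (wave_packet \<delta> a t)"
    by (rule schwartz_test_function[OF test_function_wave_packet[OF \<delta>]]) (use \<delta> in simp)
  moreover have "support (wave_packet \<delta> a t) \<subseteq> - {- 1/2..1/2}"
    by (rule order_trans[OF support_wave_packet]) (use t in auto)
  ultimately show ?thesis
    unfolding fourier_windowed[OF \<delta>] by (simp add: eq)
qed

text \<open>Continuity of the tempered distribution bounds its value at a wave packet by finitely many seminorms, which are
  polynomial in \<open>a\<close>.\<close>

lemma fourier_windowed_bound:
  assumes \<delta>: "0 < \<delta>"
  shows "\<exists>A\<ge>0. \<exists>N. \<forall>a t. \<bar>t\<bar> \<le> T \<longrightarrow> cmod (fourier (windowed \<delta> a) t) \<le> A * (1 + \<bar>a\<bar>) ^ N"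
proof -
  have "\<forall>m n. \<exists>K\<ge>0. \<forall>a t. \<bar>t\<bar> \<le> T \<longrightarrow>
      deriv_bound (decay m) n (K * (1 + \<bar>a\<bar>) ^ m) (fourier (wave_packet \<delta> a t))"
    using fourier_wave_packet_deriv_bound[OF \<delta>] by blast
  then obtain K where K: "\<And>m n. 0 \<le> K m n"
    "\<And>m n a t. \<bar>t\<bar> \<le> T \<Longrightarrow> deriv_bound (decay m) n (K m n * (1 + \<bar>a\<bar>) ^ m) (fourier (wave_packet \<delta> a t))"
    by metis
  obtain C N where CN: "\<And>\<phi>. schwartz \<phi> \<Longrightarrow>
      cmod (distribution_of g \<phi>) \<le> C * (\<Sum>m\<le>N. \<Sum>n\<le>N. schwartz_seminorm m n \<phi>)"
    using g unfolding defines_tempered_distribution_def tempered_distribution_def by blast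
  define A1 where "A1 = \<bar>C\<bar> * (\<Sum>m\<le>N. \<Sum>n\<le>N. K m n)"
  define A2 where "A2 = (\<integral>x. \<bar>p x\<bar> \<partial>lborel) * K 0 0"
  have A: "0 \<le> A1" "0 \<le> A2" using K(1) by (auto simp: A1_def A2_def intro!: mult_nonneg_nonneg sum_nonneg)
  have "cmod (fourier (windowed \<delta> a) t) \<le> (A1 + A2) * (1 + \<bar>a\<bar>) ^ N" if t: "\<bar>t\<bar> \<le> T" for a t
  proof -
    let ?\<phi> = "fourier (wave_packet \<delta> a t)"
    have a1: "1 \<le> (1 + \<bar>a\<bar>) ^ N" by (rule one_le_power) simp
    have s: "schwartz_seminorm m n ?\<phi> \<le> K m n * (1 + \<bar>a\<bar>) ^ m" "0 \<le> schwartz_seminorm m n ?\<phi>" for m n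
      using schwartz_seminorm_bounds[OF K(2)[OF t]] K(1) by auto
    have "cmod (distribution_of g ?\<phi>) \<le> C * (\<Sum>m\<le>N. \<Sum>n\<le>N. schwartz_seminorm m n ?\<phi>)"
      by (rule CN[OF schwartz_fourier_wave_packet[OF \<delta>]])
    also have "\<dots> \<le> \<bar>C\<bar> * (\<Sum>m\<le>N. \<Sum>n\<le>N. schwartz_seminorm m n ?\<phi>)"
      using s(2) by (intro mult_right_mono sum_nonneg) auto
    also have "\<dots> \<le> \<bar>C\<bar> * (\<Sum>m\<le>N. \<Sum>n\<le>N. K m n * (1 + \<bar>a\<bar>) ^ N)"
    proof (intro mult_left_mono sum_mono)
      fix m n assume "m \<in> {..N}"
      then have "(1 + \<bar>a\<bar>) ^ m \<le> (1 + \<bar>a\<bar>) ^ N" by (intro power_increasing) auto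
      then show "schwartz_seminorm m n ?\<phi> \<le> K m n * (1 + \<bar>a\<bar>) ^ N"
        using K(1) by (intro order_trans[OF s(1)] mult_left_mono) auto
    qed simp
    also have "\<dots> = A1 * (1 + \<bar>a\<bar>) ^ N" by (simp add: A1_def sum_distrib_right mult.assoc)
    finally have 1: "cmod (distribution_of g ?\<phi>) \<le> A1 * (1 + \<bar>a\<bar>) ^ N" .
    have "cmod (?\<phi> x) \<le> K 0 0" for x
      using deriv_bound_pointwise[OF K(2)[OF t, of 0 0 a], of x] by simp
    then have "cmod (of_real (p x) * ?\<phi> x) \<le> \<bar>p x\<bar> * K 0 0" for x
      by (simp add: norm_mult mult_left_mono)
    then have "(\<integral>x. cmod (of_real (p x) * ?\<phi> x) \<partial>lborel) \<le> (\<integral>x. \<bar>p x\<bar> * K 0 0 \<partial>lborel)"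
      using integrable_packet_products(2)[OF \<delta>] p by (intro integral_mono) auto
    then have "cmod (\<integral>x. of_real (p x) * ?\<phi> x \<partial>lborel) \<le> A2"
      unfolding A2_def by (intro order_trans[OF integral_norm_bound]) simp
    also have "\<dots> \<le> A2 * (1 + \<bar>a\<bar>) ^ N" using mult_left_mono[OF a1 A(2)] by simp
    finally have 2: "cmod (\<integral>x. of_real (p x) * ?\<phi> x \<partial>lborel) \<le> A2 * (1 + \<bar>a\<bar>) ^ N" .
    show ?thesis
      unfolding fourier_windowed[OF \<delta>] norm_mult norm_cis mult_1_left distrib_right
      by (intro order_trans[OF norm_triangle_ineq4] add_mono 1 2)
  qed
  then show ?thesis using A by (intro exI[of _ "A1 + A2"] conjI exI[of _ N]) auto
qed

text \<open>Equals \<open>g - p\<close> times the translated window almost everywhere on the real line.\<close>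

definition local_extension :: "real \<Rightarrow> real \<Rightarrow> complex \<Rightarrow> complex" where
  "local_extension \<delta> a = band_limited (1/2 + \<delta>) (fourier (windowed \<delta> a))"

lemma holomorphic_local_extension:
  assumes "0 < \<delta>" shows "local_extension \<delta> a holomorphic_on UNIV"
  unfolding local_extension_def
  by (intro holomorphic_band_limited continuous_on_subset[OF continuous_on_fourier[OF integrable_windowed[OF assms]]]) auto

lemma local_extension_AE:
  assumes \<delta>: "0 < \<delta>"
  shows "AE x in lborel. local_extension \<delta> a (of_real x) = of_real (g x - p x) * bump_transform \<delta> (of_real x - of_real a)"
proof -
  note c = continuous_on_fourier[OF integrable_windowed[OF \<delta>, of a]]
  have "integrable lborel (fourier (windowed \<delta> a))"
    by (rule integrable_continuous_compact_support[OF c fourier_windowed_zero[OF \<delta>]])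
  from fourier_inversion_AE_complex[OF integrable_windowed[OF \<delta>] this]
  show ?thesis
  proof eventually_elim
    case (elim x)
    then have "local_extension \<delta> a (of_real x) = windowed \<delta> a x"
      unfolding local_extension_def by (subst band_limited_of_real[OF c fourier_windowed_zero[OF \<delta>]]) auto
    then show ?case
      using bump_transform_properties(2)[OF \<delta>, of "x - a"] by (simp add: windowed_def)
  qed
qed

lemma holomorphic_bump_transform_shift:
  assumes "0 < \<delta>" shows "(\<lambda>z. bump_transform \<delta> (z - c)) holomorphic_on S"
proof -
  have "(bump_transform \<delta> \<circ> (\<lambda>z. z - c)) holomorphic_on S"
    by (rule holomorphic_on_compose_gen[OF _ bump_transform_properties(1)[OF assms]]) (auto intro!: holomorphic_intros)
  then show ?thesis by (simp add: comp_def)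
qed

text \<open>On the real axis both sides are \<open>g - p\<close> times the product of the two windows.\<close>

lemma local_extension_consistent:
  assumes d: "0 < \<delta>" "0 < \<delta>'"
  shows "local_extension \<delta> a z * bump_transform \<delta>' (z - of_real a') = local_extension \<delta>' a' z * bump_transform \<delta> (z - of_real a)"
proof -
  let ?w = "\<lambda>z. local_extension \<delta> a z * bump_transform \<delta>' (z - of_real a') - local_extension \<delta>' a' z * bump_transform \<delta> (z - of_real a)"
  have hol: "?w holomorphic_on UNIV"
    by (intro holomorphic_intros holomorphic_local_extension holomorphic_bump_transform_shift d)
  have "AE x in lborel. ?w (of_real x) = 0"
    using local_extension_AE[OF d(1), of a] local_extension_AE[OF d(2), of a'] by eventually_elim simp
  then have "?w (of_real x) = 0" for x
    by (rule continuous_AE_eq[OF continuous_on_entire_of_real[OF hol] continuous_on_const])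
  then have "?w z = 0" by (rule entire_zero_on_reals[OF hol])
  then show ?thesis by simp
qed

text \<open>The quotient is taken with the window centred at the real part of the argument. There the
  denominator is a value on the imaginary axis, so it does not vanish.\<close>

definition extension :: "complex \<Rightarrow> complex" where
  "extension z = local_extension 1 (Re z) z / bump_transform 1 (z - of_real (Re z))"

lemma minus_Re: "z - of_real (Re z) = \<i> * of_real (Im z)"
  by (simp add: complex_eq_iff)

lemma extension_mult:
  assumes "0 < \<delta>"
  shows "extension z * bump_transform \<delta> (z - of_real a) = local_extension \<delta> a z"
  using local_extension_consistent[OF assms zero_less_one, of a z "Re z"] bump_transform_imaginary_nonzero[OF zero_less_one, of "Im z"]
  by (simp add: extension_def minus_Re field_simps)

lemma holomorphic_extension: "extension holomorphic_on UNIV"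
  unfolding holomorphic_on_def
proof
  fix z0
  let ?B = "\<lambda>z. bump_transform 1 (z - of_real (Re z0))"
  let ?S = "{z. ?B z \<noteq> 0}"
  have "open ?S"
    using holomorphic_on_imp_continuous_on[OF holomorphic_bump_transform_shift[OF zero_less_one, of "of_real (Re z0)" UNIV]]
    by (intro open_Collect_neq continuous_on_const)
  moreover have "z0 \<in> ?S" using bump_transform_imaginary_nonzero[OF zero_less_one] by (simp add: minus_Re)
  moreover have "(\<lambda>z. local_extension 1 (Re z0) z / ?B z) holomorphic_on ?S"
    by (intro holomorphic_intros holomorphic_bump_transform_shift holomorphic_on_subset[OF holomorphic_local_extension]) auto
  then have "extension holomorphic_on ?S"
  proof (rule holomorphic_transform)
    fix z assume "z \<in> ?S"
    then show "local_extension 1 (Re z0) z / ?B z = extension z"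
      using extension_mult[OF zero_less_one, of z "Re z0"] by (simp add: field_simps)
  qed
  ultimately show "extension field_differentiable at z0 within UNIV"
    by (simp add: holomorphic_on_imp_differentiable_at)
qed

text \<open>For a window of width \<open>\<delta>\<close> centred at \<open>Re z\<close> the numerator is at most a polynomial in \<open>Re z\<close> times
  \<open>exp ((pi + 2 pi \<delta>) |Im z|)\<close>, and the denominator is at least a multiple of \<open>exp (- 2 pi \<delta> |Im z|)\<close>. Since \<open>\<delta>\<close> may
  depend on \<open>\<epsilon>\<close>, the type is \<open>pi\<close>.\<close>

lemma exponential_type_extension: "exponential_type pi extension"
  unfolding exponential_type_def
proof (intro conjI allI impI holomorphic_extension)
  fix \<epsilon> :: real assume \<epsilon>: "0 < \<epsilon>"
  \<comment> \<open>numerator and denominator together cost \<open>4 pi \<delta> = \<epsilon>/2\<close> in the exponent\<close>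
  define \<delta> where "\<delta> = \<epsilon> / (8 * pi)"
  have \<delta>: "0 < \<delta>" using \<epsilon> by (simp add: \<delta>_def)
  define T where "T = 1/2 + \<delta>"
  have T: "0 \<le> T" using \<delta> by (simp add: T_def)
  obtain A N where A: "0 \<le> A" "\<And>a t. \<bar>t\<bar> \<le> T \<Longrightarrow> cmod (fourier (windowed \<delta> a) t) \<le> A * (1 + \<bar>a\<bar>) ^ N"
    using fourier_windowed_bound[OF \<delta>] by blast
  define \<kappa> where "\<kappa> = (\<integral>s. bump \<delta> s \<partial>lborel)"
  have \<kappa>: "0 < \<kappa>" using integral_bump_pos(2)[OF \<delta>] by (simp add: \<kappa>_def)
  obtain L where L: "0 \<le> L" "\<And>u. 0 \<le> u \<Longrightarrow> \<bar>poly ([:1, 1:] ^ N) u\<bar> \<le> L * exp (\<epsilon>/2 * u)"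
    using poly_exp_bound[of "\<epsilon>/2" "[:1, 1:] ^ N"] \<epsilon> by auto
  define C where "C = A * L * (2 * T) / \<kappa>"
  have C: "0 \<le> C" using A(1) L(1) T \<kappa> by (simp add: C_def)
  have "cmod (extension z) \<le> C * exp ((pi + \<epsilon>) * cmod z)" for z
  proof -
    let ?y = "\<bar>Im z\<bar>"
    have "cmod (local_extension \<delta> (Re z) z) \<le> A * (1 + \<bar>Re z\<bar>) ^ N * exp (2 * pi * T * ?y) * (2 * T)"
      unfolding local_extension_def T_def[symmetric]
      by (intro band_limited_bound continuous_on_subset[OF continuous_on_fourier[OF integrable_windowed[OF \<delta>]]] A T) auto
    moreover have "local_extension \<delta> (Re z) z = extension z * bump_transform \<delta> (\<i> * of_real (Im z))"
      using extension_mult[OF \<delta>, of z "Re z"] by (simp add: minus_Re)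
    moreover have "cmod (extension z) * (\<kappa> * exp (- 2 * pi * \<delta> * ?y)) \<le> cmod (extension z) * cmod (bump_transform \<delta> (\<i> * of_real (Im z)))"
      unfolding \<kappa>_def by (intro mult_left_mono bump_transform_properties(3)[OF \<delta>]) simp
    ultimately have 1: "cmod (extension z) * (\<kappa> * exp (- 2 * pi * \<delta> * ?y)) \<le> A * (1 + \<bar>Re z\<bar>) ^ N * exp (2 * pi * T * ?y) * (2 * T)"
      by (simp add: norm_mult)
    have 2: "(1 + \<bar>Re z\<bar>) ^ N \<le> L * exp (\<epsilon>/2 * cmod z)"
    proof -
      have "(1 + \<bar>Re z\<bar>) ^ N \<le> (1 + cmod z) ^ N" using abs_Re_le_cmod[of z] by (intro power_mono) auto
      also have "\<dots> \<le> L * exp (\<epsilon>/2 * cmod z)" using L(2)[of "cmod z"] by (simp add: poly_power)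
      finally show ?thesis .
    qed
    have "cmod (extension z) * \<kappa> = cmod (extension z) * (\<kappa> * exp (- 2 * pi * \<delta> * ?y)) * exp (2 * pi * \<delta> * ?y)"
      by (simp add: mult.assoc flip: exp_add)
    also have "\<dots> \<le> (A * (1 + \<bar>Re z\<bar>) ^ N * exp (2 * pi * T * ?y) * (2 * T)) * exp (2 * pi * \<delta> * ?y)"
      by (rule mult_right_mono[OF 1]) simp
    also have "\<dots> \<le> (A * (L * exp (\<epsilon>/2 * cmod z)) * exp (2 * pi * T * ?y) * (2 * T)) * exp (2 * pi * \<delta> * ?y)"
      using A(1) T by (intro mult_right_mono mult_left_mono 2) auto
    also have "\<dots> = A * L * (2 * T) * exp (\<epsilon>/2 * cmod z + (2 * pi * T * ?y + 2 * pi * \<delta> * ?y))"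
      by (simp add: exp_add mult_ac)
    also have "2 * pi * T * ?y + 2 * pi * \<delta> * ?y = (pi + \<epsilon>/2) * ?y"
      by (simp add: T_def \<delta>_def field_simps)
    also have "A * L * (2 * T) * exp (\<epsilon>/2 * cmod z + (pi + \<epsilon>/2) * ?y) \<le> A * L * (2 * T) * exp ((pi + \<epsilon>) * cmod z)"
    proof -
      have "(pi + \<epsilon>/2) * ?y \<le> (pi + \<epsilon>/2) * cmod z" using \<epsilon> abs_Im_le_cmod by (intro mult_left_mono) auto
      then have "\<epsilon>/2 * cmod z + (pi + \<epsilon>/2) * ?y \<le> (pi + \<epsilon>) * cmod z" by (simp add: algebra_simps)
      then show ?thesis using A(1) L(1) T by (intro mult_left_mono) auto
    qed
    finally have "cmod (extension z) * \<kappa> \<le> A * L * (2 * T) * exp ((pi + \<epsilon>) * cmod z)" .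
    then show ?thesis using \<kappa> by (simp add: C_def field_simps)
  qed
  then have "cmod (extension z) \<le> (C + 1) * exp ((pi + \<epsilon>) * cmod z)" for z
    by (rule order_trans) (simp add: distrib_right)
  then show "\<exists>C>0. \<forall>z. cmod (extension z) \<le> C * exp ((pi + \<epsilon>) * cmod z)"
    using C by (intro exI[of _ "C + 1"]) auto
qed

text \<open>The null sets for rational translations can be united, and every real point has a rational translation at which
  the window does not vanish.\<close>

lemma extension_AE: "AE x in lborel. extension (of_real x) = of_real (g x - p x)"
proof -
  \<comment> \<open>rational translations, so that only countably many null sets are united\<close>
  have "AE x in lborel. \<forall>a::rat. local_extension 1 (of_rat a) (of_real x)
      = of_real (g x - p x) * bump_transform 1 (of_real x - of_real (of_rat a))"
    unfolding AE_all_countable by (intro allI local_extension_AE zero_less_one)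
  then show ?thesis
  proof eventually_elim
    case (elim x)
    let ?B = "\<lambda>a. bump_transform 1 (of_real (x - a))"
    have "open {a. ?B a \<noteq> 0}"
      by (intro open_Collect_neq continuous_on_const
          continuous_on_compose2[OF holomorphic_on_imp_continuous_on[OF bump_transform_properties(1)[OF zero_less_one]]])
         (auto intro!: continuous_intros)
    moreover have "x \<in> {a. ?B a \<noteq> 0}"
      using bump_transform_imaginary_nonzero[OF zero_less_one, of 0] by simp
    ultimately obtain e where e: "0 < e" "ball x e \<subseteq> {a. ?B a \<noteq> 0}"
      using open_contains_ball by blast
    obtain q :: rat where "x < of_rat q" "of_rat q < x + e"
      using of_rat_dense[of x "x + e"] e(1) by auto
    then have "?B (of_rat q) \<noteq> 0" using e(2) by (auto simp: ball_def dist_real_def subset_iff)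
    moreover have "extension (of_real x) * ?B (of_rat q) = of_real (g x - p x) * ?B (of_rat q)"
      using extension_mult[OF zero_less_one, of "of_real x" "of_rat q"] elim by (simp add: of_real_diff)
    ultimately show ?case by simp
  qed
qed

end

section \<open>The approximation error of one member of the family\<close>

lemma integrable_schwartz:
  assumes "schwartz \<phi>"
  shows "integrable lborel \<phi>"
proof -
  have d: "\<phi> differentiable at x" for x
    using assms unfolding schwartz_def nth_derivative_def by (metis funpow_0)
  obtain A B where A: "\<And>x. \<bar>x\<bar> ^ 0 * cmod (\<phi> x) \<le> A" and B: "\<And>x. \<bar>x\<bar> ^ 2 * cmod (\<phi> x) \<le> B"
    using assms unfolding schwartz_def nth_derivative_def by (metis funpow_0)
  show ?thesis
  proof (rule integrable_if_power_decay[where \<epsilon> = 1 and C = "2 * A + 2 * B"])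
    show "continuous_on UNIV \<phi>"
      using d by (intro continuous_at_imp_continuous_on) (auto intro: differentiable_imp_continuous_within)
    fix x :: real
    have "(1 + \<bar>x\<bar>)\<^sup>2 \<le> 2 + 2 * x\<^sup>2"
      using zero_le_power2[of "1 - \<bar>x\<bar>"] by (simp add: power2_eq_square algebra_simps)
    then have "(1 + \<bar>x\<bar>)\<^sup>2 * cmod (\<phi> x) \<le> (2 + 2 * x\<^sup>2) * cmod (\<phi> x)" by (rule mult_right_mono) simp
    also have "\<dots> \<le> 2 * A + 2 * B" using A[of x] B[of x] by (simp add: algebra_simps)
    finally have "cmod (\<phi> x) \<le> (2 * A + 2 * B) / (1 + \<bar>x\<bar>)\<^sup>2"
      by (simp add: pos_le_divide_eq mult.commute)
    then show "cmod (\<phi> x) \<le> (2 * A + 2 * B) * (1 + \<bar>x\<bar>) powr (- 1 - 1)"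
      by (simp add: powr_minus powr_numeral divide_inverse)
  qed simp
qed

text \<open>The zero function is a competitor at finite distance.\<close>

lemma best_approximation_of_integrable:
  assumes f: "integrable lborel f" and F: "best_approximation f F"
  shows "integrable lborel (\<lambda>x. F (of_real x))"
proof -
  have hol: "F holomorphic_on UNIV" using F by (simp add: best_approximation_def exponential_type_def)
  have "L1_dist f F \<le> L1_dist f (\<lambda>_. 0)"
    using F exponential_type_zero by (simp add: best_approximation_def)
  also have "\<dots> = ennreal (\<integral>x. \<bar>f x\<bar> \<partial>lborel)"
    unfolding L1_dist_def using f by (simp add: nn_integral_eq_integral)
  finally have fin: "L1_dist f F < \<infinity>" by (simp add: order.strict_trans1)
  have m: "(\<lambda>x. F (of_real x)) \<in> borel_measurable lborel"
    using borel_measurable_continuous_onI[OF continuous_on_entire_of_real[OF hol]] by simp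
  have "integrable lborel (\<lambda>x. F (of_real x) - of_real (f x))"
    using fin m borel_measurable_integrable[OF f] unfolding L1_dist_def by (intro integrableI_bounded) auto
  from Bochner_Integration.integrable_add[OF this integrable_of_real[OF f]]
  show ?thesis by simp
qed

definition approximation_error :: "(real \<Rightarrow> real) \<Rightarrow> (complex \<Rightarrow> complex) \<Rightarrow> real \<Rightarrow> real" where
  "approximation_error f F x = f x - Re (F (of_real x))"

text \<open>A single pair \<open>G l\<close>, \<open>K l\<close>. Below, \<open>U\<close> is the transform of the approximation error, which agrees with that of
  \<open>f\<close> off the open interval \<open>|t| < 1/2\<close> and is determined by these values inside.\<close>

locale integrable_family_member =
  fixes f :: "real \<Rightarrow> real" and F :: "complex \<Rightarrow> complex" and C \<epsilon> :: real
  assumes cont: "continuous_on UNIV f" and \<epsilon>: "0 < \<epsilon>"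
    and decay_f: "\<And>x. \<bar>f x\<bar> \<le> C * (1 + \<bar>x\<bar>) powr (- 1 - \<epsilon>)"
    and decay_transform: "\<And>t. cmod (fourier (\<lambda>x. of_real (f x)) t) \<le> C * (1 + \<bar>t\<bar>) powr (- 1 - \<epsilon>)"
    and F: "family_approximation f F"
begin

abbreviation "err \<equiv> approximation_error f F"
abbreviation "U \<equiv> fourier (\<lambda>x. complex_of_real (err x))"

lemma integrable_f: "integrable lborel (\<lambda>x. complex_of_real (f x))"
  by (rule integrable_if_power_decay[OF _ \<epsilon>]) (use decay_f cont in \<open>auto intro!: continuous_intros\<close>)

lemma type_F: "exponential_type pi F" and hol_F: "F holomorphic_on UNIV"
  using F by (auto simp: family_approximation_def best_approximation_def exponential_type_def)

lemma integrable_F: "integrable lborel (\<lambda>x. F (of_real x))"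
proof (rule best_approximation_of_integrable)
  show "integrable lborel f" using integrable_Re[OF integrable_f] by simp
qed (use F in \<open>simp add: family_approximation_def\<close>)

lemma err_eq: "of_real (err x) = of_real (f x) - F (of_real x)"
proof -
  have "F (of_real x) \<in> \<real>" using F by (simp add: family_approximation_def sign_condition_at_def)
  then show ?thesis by (simp add: approximation_error_def complex_eq_iff complex_is_Real_iff)
qed

lemma continuous_err: "continuous_on UNIV (\<lambda>x. complex_of_real (err x))"
  unfolding err_eq by (intro continuous_intros cont continuous_on_entire_of_real hol_F)

lemma integrable_err: "integrable lborel (\<lambda>x. complex_of_real (err x))" "integrable lborel err"
proof -
  show 1: "integrable lborel (\<lambda>x. complex_of_real (err x))"
    unfolding err_eq by (intro Bochner_Integration.integrable_diff integrable_f integrable_F)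
  show "integrable lborel err" using integrable_Re[OF 1] by simp
qed

lemma err_sign: "0 \<le> sgn (cos (pi * x)) * err x"
  using F by (simp add: family_approximation_def sign_condition_at_def approximation_error_def)

lemma L1_dist_eq: "L1_dist f F = ennreal (\<integral>x. \<bar>err x\<bar> \<partial>lborel)"
proof -
  have "cmod (F (of_real x) - of_real (f x)) = \<bar>err x\<bar>" for x
    using arg_cong[OF err_eq, of cmod x] by (simp add: norm_minus_commute)
  then show ?thesis
    unfolding L1_dist_def using integrable_err(2) by (simp add: nn_integral_eq_integral)
qed

lemma U_outside: "1/2 \<le> \<bar>t\<bar> \<Longrightarrow> U t = fourier (\<lambda>x. of_real (f x)) t"
  unfolding err_eq fourier_diff[OF integrable_f integrable_F]
  by (subst fourier_exponential_type_eq_0[OF type_F _ integrable_F]) auto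

lemma continuous_U: "continuous_on UNIV U"
  by (rule continuous_on_fourier[OF integrable_err(1)])

lemma U_decay: "\<exists>A. \<forall>t. cmod (U t) \<le> A * (1 + \<bar>t\<bar>) powr (- 1 - \<epsilon>)"
proof -
  define A where "A = (\<integral>x. \<bar>err x\<bar> \<partial>lborel)"
  have A: "0 \<le> A" by (simp add: A_def)
  have C: "0 \<le> C" using order_trans[OF norm_ge_zero decay_transform[of 0]] by simp
  have "cmod (U t) \<le> (C + A * 2 powr (1 + \<epsilon>)) * (1 + \<bar>t\<bar>) powr (- 1 - \<epsilon>)" for t
  proof (cases "1/2 \<le> \<bar>t\<bar>")
    case True
    then show ?thesis
      using decay_transform[of t] A by (simp add: U_outside distrib_right add_increasing2)
  next
    case False
    have "2 powr (- 1 - \<epsilon>) \<le> (1 + \<bar>t\<bar>) powr (- 1 - \<epsilon>)"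
      using False \<epsilon> by (intro powr_mono2') auto
    then have "2 powr (1 + \<epsilon>) * 2 powr (- 1 - \<epsilon>) \<le> 2 powr (1 + \<epsilon>) * (1 + \<bar>t\<bar>) powr (- 1 - \<epsilon>)"
      by (intro mult_left_mono) auto
    moreover have "(2::real) powr (1 + \<epsilon>) * 2 powr (- 1 - \<epsilon>) = 1" by (simp flip: powr_add)
    ultimately have "A * 1 \<le> A * (2 powr (1 + \<epsilon>) * (1 + \<bar>t\<bar>) powr (- 1 - \<epsilon>))"
      using A by (intro mult_left_mono) auto
    moreover have "cmod (U t) \<le> A" using norm_fourier_le[OF integrable_err(1), of t] by (simp add: A_def)
    moreover have "0 \<le> C * (1 + \<bar>t\<bar>) powr (- 1 - \<epsilon>)" using C by simp
    ultimately show ?thesis by (simp add: distrib_right mult.assoc)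
  qed
  then show ?thesis by blast
qed

lemma integrable_U: "integrable lborel U"
  using U_decay integrable_if_power_decay[OF continuous_U \<epsilon>] by blast

lemma err_inversion: "of_real (err x) = (\<integral>t. U t * cis (2 * pi * x * t) \<partial>lborel)"
  by (rule fourier_inversion_continuous[OF continuous_err integrable_err(1) integrable_U])

lemma U_inside:
  assumes "\<bar>t\<bar> < 1/2"
  shows "(\<lambda>m. (-1) ^ m * (U (t + real (Suc m)) + U (t - real (Suc m)))) sums U t"
proof -
  obtain A where A: "\<And>t. cmod (U t) \<le> A * (1 + \<bar>t\<bar>) powr (- 1 - \<epsilon>)" using U_decay by blast
  have "err (of_int n + 1/2) = 0" for n :: int
    using F by (simp add: family_approximation_def interpolates_def approximation_error_def)
  then have "(\<integral>t. U t * cis (2 * pi * (of_int n + 1/2) * t) \<partial>lborel) = 0" for n :: int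
    using err_inversion[of "of_int n + 1/2"] by simp
  then show ?thesis
    by (rule alternating_periodization_eq_0[OF continuous_U integrable_U \<epsilon> A _ assms])
qed

end

section \<open>Superposition of the approximation errors\<close>

locale approximation_family =
  fixes I :: "real set" and G :: "real \<Rightarrow> real \<Rightarrow> real" and K :: "real \<Rightarrow> complex \<Rightarrow> complex"
    and \<nu> :: "real measure"
  assumes family: "best_approximation_family I G"
    and K: "\<And>l. l \<in> I \<Longrightarrow> family_approximation (G l) (K l)"
    and borel: "sets \<nu> = sets (restrict_space borel I)"
    and measurable: "\<And>t. \<bar>t\<bar> > 1/2 \<Longrightarrow> (\<lambda>l. fourier_family G l t) \<in> borel_measurable \<nu>"
    and finite: "(\<integral>\<^sup>+l. L1_dist (G l) (K l) \<partial>\<nu>) < \<infinity>"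
begin

abbreviation err :: "real \<Rightarrow> real \<Rightarrow> real" where
  "err l \<equiv> approximation_error (G l) (K l)"
abbreviation U :: "real \<Rightarrow> real \<Rightarrow> complex" where
  "U l \<equiv> fourier (\<lambda>x. complex_of_real (err l x))"

lemma space: "space \<nu> = I"
  using sets_eq_imp_space_eq[OF borel] by (simp add: space_restrict_space)

lemma member:
  assumes "l \<in> I"
  obtains C \<epsilon> where "integrable_family_member (G l) (K l) C \<epsilon>"
proof -
  have "continuous_on UNIV (G l)" and "\<exists>C>0. \<exists>\<epsilon>>0.
           (\<forall>x. \<bar>G l x\<bar> \<le> C * (1 + \<bar>x\<bar>) powr (- 1 - \<epsilon>)) \<and>
           (\<forall>t. cmod (fourier_family G l t) \<le> C * (1 + \<bar>t\<bar>) powr (- 1 - \<epsilon>))"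
    using family assms unfolding best_approximation_family_def by blast+
  then show ?thesis
    using that K[OF assms] unfolding integrable_family_member_def fourier_family_def by blast
qed

lemma U_outside: "l \<in> I \<Longrightarrow> 1/2 \<le> \<bar>t\<bar> \<Longrightarrow> U l t = fourier_family G l t"
  using integrable_family_member.U_outside unfolding fourier_family_def by (metis member)

lemma continuous_U: "l \<in> I \<Longrightarrow> continuous_on UNIV (U l)"
  using integrable_family_member.continuous_U by (metis member)

lemma integrable_err: "l \<in> I \<Longrightarrow> integrable lborel (err l)"
  using integrable_family_member.integrable_err(2) by (metis member)

lemma U_measurable_strict: "1/2 < \<bar>t\<bar> \<Longrightarrow> (\<lambda>l. U l t) \<in> borel_measurable \<nu>"
  using measurable[of t] by (subst measurable_cong[of _ _ "\<lambda>l. fourier_family G l t"]) (auto simp: space U_outside)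

text \<open>For \<open>|t| > 1/2\<close> this is the hypothesis on the family, inside the interval the alternating periodization
  expresses \<open>U\<close> by such values, and the endpoints follow by continuity.\<close>

lemma U_measurable: "(\<lambda>l. U l t) \<in> borel_measurable \<nu>"
proof -
  consider "1/2 < \<bar>t\<bar>" | "\<bar>t\<bar> < 1/2" | "\<bar>t\<bar> = 1/2" by linarith
  then show ?thesis
  proof cases
    case 1
    then show ?thesis by (rule U_measurable_strict)
  next
    case 2
    let ?S = "\<lambda>N l. \<Sum>m<N. (-1) ^ m * (U l (t + real (Suc m)) + U l (t - real (Suc m)))"
    show ?thesis
    proof (rule borel_measurable_LIMSEQ_metric)
      have "(\<lambda>l. U l (t + real (Suc m))) \<in> borel_measurable \<nu>" "(\<lambda>l. U l (t - real (Suc m))) \<in> borel_measurable \<nu>" for m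
        using 2 by (intro U_measurable_strict; auto)+
      then show "?S N \<in> borel_measurable \<nu>" for N
        by (intro borel_measurable_sum borel_measurable_times borel_measurable_add borel_measurable_const)
      fix l assume "l \<in> space \<nu>"
      then obtain C \<epsilon> where "integrable_family_member (G l) (K l) C \<epsilon>" using member space by auto
      from integrable_family_member.U_inside[OF this 2]
      show "(\<lambda>N. ?S N l) \<longlonglongrightarrow> U l t" unfolding sums_def .
    qed
  next
    case 3
    show ?thesis
    proof (rule borel_measurable_LIMSEQ_metric)
      have lt: "\<bar>t\<bar> * 1 < \<bar>t\<bar> * (1 + 1 / real (Suc n))" for n
        using 3 by (intro mult_strict_left_mono) auto
      show "(\<lambda>l. U l (t * (1 + 1 / real (Suc n)))) \<in> borel_measurable \<nu>" for n
      proof (intro U_measurable_strict)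
        have "\<bar>t * (1 + 1 / real (Suc n))\<bar> = \<bar>t\<bar> * (1 + 1 / real (Suc n))"
          unfolding abs_mult by (simp add: abs_of_nonneg del: of_nat_Suc)
        then show "1/2 < \<bar>t * (1 + 1 / real (Suc n))\<bar>"
          using lt[of n] 3 by (simp only: mult_1_right)
      qed
      fix l assume "l \<in> space \<nu>"
      then have "continuous_on UNIV (U l)" using continuous_U space by auto
      moreover have "(\<lambda>n. t * (1 + 1 / real (Suc n))) \<longlonglongrightarrow> t" by real_asymp
      ultimately show "(\<lambda>n. U l (t * (1 + 1 / real (Suc n)))) \<longlonglongrightarrow> U l t"
        by (rule continuous_on_tendsto_compose) auto
    qed
  qed
qed

lemma U_jointly_measurable: "(\<lambda>(l, t). U l t) \<in> borel_measurable (\<nu> \<Otimes>\<^sub>M lborel)"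
  by (rule Caratheodory_measurable[OF U_measurable]) (simp add: continuous_U space)

lemma err_measurable: "(\<lambda>l. complex_of_real (err l x)) \<in> borel_measurable \<nu>"
proof -
  have "(\<lambda>l. \<integral>t. U l t * cis (2 * pi * x * t) \<partial>lborel) \<in> borel_measurable \<nu>"
  proof (rule lborel.borel_measurable_lebesgue_integral)
    have "(\<lambda>p. (\<lambda>(l, t). U l t) p * cis (2 * pi * x * snd p)) \<in> borel_measurable (\<nu> \<Otimes>\<^sub>M lborel)"
      by (intro borel_measurable_times U_jointly_measurable borel_measurable_cis) measurable
    then show "(\<lambda>(l, t). U l t * cis (2 * pi * x * t)) \<in> borel_measurable (\<nu> \<Otimes>\<^sub>M lborel)"
      by (simp add: split_beta)
  qed
  moreover have "(\<integral>t. U l t * cis (2 * pi * x * t) \<partial>lborel) = of_real (err l x)" if "l \<in> space \<nu>" for l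
    using integrable_family_member.err_inversion that space by (metis member)
  ultimately show ?thesis
    by (subst measurable_cong[of _ _ "\<lambda>l. \<integral>t. U l t * cis (2 * pi * x * t) \<partial>lborel"]) auto
qed

lemma err_jointly_measurable: "(\<lambda>p. err (fst p) (snd p)) \<in> borel_measurable (\<nu> \<Otimes>\<^sub>M lborel)"
proof -
  have "(\<lambda>(l, x). complex_of_real (err l x)) \<in> borel_measurable (\<nu> \<Otimes>\<^sub>M lborel)"
  proof (rule Caratheodory_measurable[OF err_measurable])
    fix l assume "l \<in> space \<nu>"
    then show "continuous_on UNIV (\<lambda>x. complex_of_real (err l x))"
      using integrable_family_member.continuous_err space by (metis member)
  qed
  from measurable_compose[OF this borel_measurable_Re] show ?thesis by (simp add: split_beta)
qed

definition mass :: "real \<Rightarrow> real" where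
  "mass l = (\<integral>x. \<bar>err l x\<bar> \<partial>lborel)"

lemma mass_nonneg: "0 \<le> mass l"
  by (simp add: mass_def)

lemma L1_dist_eq_mass: "l \<in> I \<Longrightarrow> L1_dist (G l) (K l) = ennreal (mass l)"
  using integrable_family_member.L1_dist_eq unfolding mass_def by (metis member)

lemma mass_measurable: "mass \<in> borel_measurable \<nu>"
  unfolding mass_def[abs_def]
proof (rule lborel.borel_measurable_lebesgue_integral)
  have "(\<lambda>p. \<bar>err (fst p) (snd p)\<bar>) \<in> borel_measurable (\<nu> \<Otimes>\<^sub>M lborel)"
    by (intro borel_measurable_abs err_jointly_measurable)
  then show "(\<lambda>(l, x). \<bar>err l x\<bar>) \<in> borel_measurable (\<nu> \<Otimes>\<^sub>M lborel)" by (simp add: split_beta)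
qed

lemma total_eq: "(\<integral>\<^sup>+l. L1_dist (G l) (K l) \<partial>\<nu>) = (\<integral>\<^sup>+l. ennreal (mass l) \<partial>\<nu>)"
  by (intro nn_integral_cong) (simp add: L1_dist_eq_mass space)

lemma integrable_mass: "integrable \<nu> mass"
  using finite mass_measurable mass_nonneg unfolding total_eq
  by (intro integrableI_bounded) auto

text \<open>A finite measure against which the normalized errors superpose to the same function as the errors do against
  \<open>\<nu>\<close>. Where the density vanishes the error is \<open>0\<close>.\<close>

definition \<mu> :: "real measure" where
  "\<mu> = density \<nu> (\<lambda>l. ennreal (mass l))"

lemma sets_\<mu> [measurable_cong]: "sets \<mu> = sets \<nu>" and space_\<mu>: "space \<mu> = I"
  by (simp_all add: \<mu>_def space)

sublocale \<mu>: finite_measure \<mu>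
proof
  have "emeasure \<mu> (space \<mu>) = (\<integral>\<^sup>+l. ennreal (mass l) \<partial>\<nu>)"
    unfolding \<mu>_def using mass_measurable
    by (subst emeasure_density) (auto intro!: nn_integral_cong)
  then show "emeasure \<mu> (space \<mu>) \<noteq> \<infinity>" using finite total_eq by simp
qed

sublocale P: pair_sigma_finite \<mu> lborel ..

definition normalized_err :: "real \<Rightarrow> real \<Rightarrow> real" where
  "normalized_err l x = err l x / mass l"

lemma normalized_err_measurable: "(\<lambda>(l, x). normalized_err l x) \<in> borel_measurable (\<mu> \<Otimes>\<^sub>M lborel)"
proof -
  have "(\<lambda>p. err (fst p) (snd p) / mass (fst p)) \<in> borel_measurable (\<nu> \<Otimes>\<^sub>M lborel)"
    by (intro borel_measurable_divide err_jointly_measurable measurable_compose[OF measurable_fst mass_measurable])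
  then have "(\<lambda>(l, x). normalized_err l x) \<in> borel_measurable (\<nu> \<Otimes>\<^sub>M lborel)"
    by (simp add: normalized_err_def split_beta)
  then show ?thesis
    by (subst measurable_cong_sets[OF sets_pair_measure_cong[OF sets_\<mu> refl] refl])
qed

lemma integral_abs_normalized_err: "(\<integral>x. \<bar>normalized_err l x\<bar> \<partial>lborel) = (if mass l = 0 then 0 else 1)"
proof -
  have "(\<integral>x. \<bar>normalized_err l x\<bar> \<partial>lborel) = mass l / mass l"
    unfolding normalized_err_def abs_divide using mass_nonneg[of l] by (simp add: mass_def)
  then show ?thesis by simp
qed

lemma integrable_normalized_err: "l \<in> I \<Longrightarrow> integrable lborel (normalized_err l)"
  unfolding normalized_err_def[abs_def] using integrable_err by simp

lemma integrable_normalized_err_joint: "integrable (\<mu> \<Otimes>\<^sub>M lborel) (\<lambda>(l, x). normalized_err l x)"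
proof (rule P.Fubini_integrable[OF normalized_err_measurable])
  show "AE l in \<mu>. integrable lborel (\<lambda>x. case (l, x) of (l, x) \<Rightarrow> normalized_err l x)"
    by (intro AE_I2) (simp add: integrable_normalized_err space_\<mu>)
  have "mass \<in> borel_measurable \<mu>" using mass_measurable by (simp add: \<mu>_def)
  then have "(\<lambda>l. if mass l = 0 then 0 else 1 :: real) \<in> borel_measurable \<mu>" by measurable
  then have "integrable \<mu> (\<lambda>l. if mass l = 0 then 0 else 1 :: real)"
    by (intro \<mu>.integrable_const_bound[of _ 1]) auto
  then show "integrable \<mu> (\<lambda>l. \<integral>x. norm (case (l, x) of (l, x) \<Rightarrow> normalized_err l x) \<partial>lborel)"
    by (simp add: integral_abs_normalized_err)
qed

definition superposition :: "real \<Rightarrow> real" where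
  "superposition x = (\<integral>l. normalized_err l x \<partial>\<mu>)"

lemma integrable_superposition: "integrable lborel superposition"
  unfolding superposition_def[abs_def] by (rule P.integrable_snd[OF integrable_normalized_err_joint])

lemma normalized_err_sign: "l \<in> I \<Longrightarrow> 0 \<le> sgn (cos (pi * x)) * normalized_err l x"
  using integrable_family_member.err_sign[of "G l" "K l" _ _ x] mass_nonneg[of l] unfolding normalized_err_def
  by (metis member times_divide_eq_right divide_nonneg_nonneg)

lemma superposition_sign: "0 \<le> sgn (cos (pi * x)) * superposition x"
proof -
  have "0 \<le> (\<integral>l. sgn (cos (pi * x)) * normalized_err l x \<partial>\<mu>)"
    by (intro integral_nonneg_AE AE_I2) (simp add: normalized_err_sign space_\<mu>)
  then show ?thesis by (simp add: superposition_def)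
qed

lemma abs_eq_signed: "cos (pi * x) \<noteq> 0 \<Longrightarrow> 0 \<le> sgn (cos (pi * x)) * y \<Longrightarrow> \<bar>y\<bar> = sgn (cos (pi * x)) * (y::real)"
  by (auto simp: sgn_if split: if_splits)

text \<open>All errors have the same sign at a given point, so the modulus of their superposition is the superposition of
  their moduli.\<close>

lemma integral_abs_superposition:
  "ennreal (\<integral>x. \<bar>superposition x\<bar> \<partial>lborel) = (\<integral>\<^sup>+l. L1_dist (G l) (K l) \<partial>\<nu>)"
proof -
  have i: "integrable (\<mu> \<Otimes>\<^sub>M lborel) (\<lambda>(l, x). \<bar>normalized_err l x\<bar>)"
    using integrable_abs[OF integrable_normalized_err_joint] by (simp add: split_beta')
  have "(\<integral>x. \<bar>superposition x\<bar> \<partial>lborel) = (\<integral>x. (\<integral>l. \<bar>normalized_err l x\<bar> \<partial>\<mu>) \<partial>lborel)"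
  proof (rule integral_cong_AE)
    show "AE x in lborel. \<bar>superposition x\<bar> = (\<integral>l. \<bar>normalized_err l x\<bar> \<partial>\<mu>)"
      using AE_cos_pi_nonzero
    proof eventually_elim
      case (elim x)
      have "\<bar>superposition x\<bar> = sgn (cos (pi * x)) * superposition x"
        by (rule abs_eq_signed[OF elim superposition_sign])
      also have "\<dots> = (\<integral>l. sgn (cos (pi * x)) * normalized_err l x \<partial>\<mu>)" by (simp add: superposition_def)
      also have "\<dots> = (\<integral>l. \<bar>normalized_err l x\<bar> \<partial>\<mu>)"
        by (intro Bochner_Integration.integral_cong refl) (simp add: abs_eq_signed[OF elim normalized_err_sign] space_\<mu>)
      finally show ?case .
    qed
    show "(\<lambda>x. \<bar>superposition x\<bar>) \<in> borel_measurable lborel" using integrable_superposition by simp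
    show "(\<lambda>x. \<integral>l. \<bar>normalized_err l x\<bar> \<partial>\<mu>) \<in> borel_measurable lborel"
      by (rule borel_measurable_integrable[OF P.integrable_snd[OF i]])
  qed
  also have "\<dots> = (\<integral>l. (\<integral>x. \<bar>normalized_err l x\<bar> \<partial>lborel) \<partial>\<mu>)"
    by (rule P.Fubini_integral[OF i])
  also have "\<dots> = (\<integral>l. mass l *\<^sub>R (if mass l = 0 then 0 else 1) \<partial>\<nu>)"
    unfolding integral_abs_normalized_err \<mu>_def using mass_measurable mass_nonneg by (intro integral_density) auto
  also have "\<dots> = (\<integral>l. mass l \<partial>\<nu>)" by (intro Bochner_Integration.integral_cong) auto
  finally show ?thesis
    unfolding total_eq using nn_integral_eq_integral[OF integrable_mass] mass_nonneg by simp
qed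

lemma fourier_superposition:
  assumes t: "1/2 \<le> \<bar>t\<bar>"
  shows "fourier (\<lambda>x. of_real (superposition x)) t = (\<integral>l. fourier_family G l t \<partial>\<nu>)"
proof -
  have "integrable (\<mu> \<Otimes>\<^sub>M lborel) (\<lambda>p. of_real ((\<lambda>(l, x). normalized_err l x) p) * cis (- 2 * pi * snd p * t))"
    by (intro integrable_mult_cis integrable_of_real integrable_normalized_err_joint) measurable
  then have i: "integrable (\<mu> \<Otimes>\<^sub>M lborel) (\<lambda>(l, x). complex_of_real (normalized_err l x) * cis (- 2 * pi * x * t))"
    by (simp add: split_beta')
  have "fourier (\<lambda>x. of_real (superposition x)) t = (\<integral>x. (\<integral>l. of_real (normalized_err l x) * cis (- 2 * pi * x * t) \<partial>\<mu>) \<partial>lborel)"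
    unfolding fourier_cis superposition_def integral_complex_of_real[symmetric] integral_mult_left_zero[symmetric] ..
  also have "\<dots> = (\<integral>l. (\<integral>x. of_real (normalized_err l x) * cis (- 2 * pi * x * t) \<partial>lborel) \<partial>\<mu>)"
    by (rule P.Fubini_integral[OF i])
  also have "\<dots> = (\<integral>l. U l t / mass l \<partial>\<mu>)"
    unfolding fourier_cis integral_divide_zero[symmetric] by (simp add: normalized_err_def)
  also have "\<dots> = (\<integral>l. mass l *\<^sub>R (U l t / mass l) \<partial>\<nu>)"
    unfolding \<mu>_def using mass_measurable mass_nonneg U_measurable by (intro integral_density) auto
  also have "\<dots> = (\<integral>l. fourier_family G l t \<partial>\<nu>)"
  proof (intro Bochner_Integration.integral_cong refl)
    fix l assume "l \<in> space \<nu>"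
    then have l: "l \<in> I" by (simp add: space)
    have "cmod (U l t) \<le> mass l"
      using norm_fourier_le[of "\<lambda>x. complex_of_real (err l x)" t] integrable_err[OF l] by (simp add: mass_def)
    then have "mass l *\<^sub>R (U l t / mass l) = U l t"
      by (cases "mass l = 0") (auto simp: scaleR_conv_of_real)
    then show "mass l *\<^sub>R (U l t / mass l) = fourier_family G l t" using U_outside[OF l t] by simp
  qed
  finally show ?thesis .
qed

theorem superposition_transform:
  assumes \<phi>: "schwartz \<phi>" and supp: "support \<phi> \<subseteq> - {- 1/2..1/2}"
  shows "(\<integral>x. of_real (superposition x) * fourier \<phi> x \<partial>lborel)
    = (\<integral>t. (\<integral>l. fourier_family G l t \<partial>\<nu>) * \<phi> t \<partial>lborel)"
proof -
  have "(\<integral>x. of_real (superposition x) * fourier \<phi> x \<partial>lborel)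
      = (\<integral>t. fourier (\<lambda>x. of_real (superposition x)) t * \<phi> t \<partial>lborel)"
    by (rule fourier_multiplication_formula[OF integrable_of_real[OF integrable_superposition] integrable_schwartz[OF \<phi>]])
  also have "\<dots> = (\<integral>t. (\<integral>l. fourier_family G l t \<partial>\<nu>) * \<phi> t \<partial>lborel)"
  proof (intro Bochner_Integration.integral_cong refl)
    fix t
    show "fourier (\<lambda>x. of_real (superposition x)) t * \<phi> t = (\<integral>l. fourier_family G l t \<partial>\<nu>) * \<phi> t"
    proof (cases "\<phi> t = 0")
      case False
      then have "t \<in> support \<phi>" unfolding support_def using closure_subset by fastforce
      then have "1/2 \<le> \<bar>t\<bar>" using supp by (auto simp: abs_if)
      then show ?thesis by (simp only: fourier_superposition)
    qed simp
  qed
  finally show ?thesis .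
qed

end

section \<open>Interpolation, optimality and uniqueness\<close>

text \<open>At a half-integer the cosine has a simple zero, so both signs occur arbitrarily close to it.\<close>

lemma sgn_cos_near_half_integer:
  fixes n :: int and e \<sigma> :: real
  assumes e: "0 < e" and \<sigma>: "\<sigma> = 1 \<or> \<sigma> = -1"
  defines "x \<equiv> of_int n + 1/2"
  obtains a b where "a < b" "x - e \<le> a" "b \<le> x + e" "\<And>y. a < y \<Longrightarrow> y < b \<Longrightarrow> sgn (cos (pi * y)) = \<sigma>"
proof -
  have c0: "cos (pi * x) = 0"
    unfolding cos_zero_iff_int by (intro exI[of _ "2 * n + 1"]) (simp add: x_def algebra_simps)
  define s where "s = sin (pi * x)"
  have s: "s = 1 \<or> s = -1"
    using sin_cos_squared_add[of "pi * x"] c0 by (simp add: s_def power2_eq_1_iff)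
  have c: "cos (pi * y) = - s * sin (pi * (y - x))" for y
  proof -
    have "cos (pi * y) = cos (pi * x + pi * (y - x))" by (simp add: algebra_simps)
    then show ?thesis unfolding cos_add by (simp add: c0 s_def)
  qed
  define d where "d = min e 1"
  have d: "0 < d" "d \<le> e" "d \<le> 1" using e by (auto simp: d_def)
  show ?thesis
  proof (cases "\<sigma> = - s")
    case True
    have "sgn (cos (pi * y)) = \<sigma>" if "x < y" "y < x + d" for y
    proof -
      have "0 < sin (pi * (y - x))" using that d by (intro sin_gt_zero) auto
      then show ?thesis unfolding c True using s by (auto simp: sgn_mult)
    qed
    then show ?thesis using that[of x "x + d"] d e by auto
  next
    case False
    then have \<sigma>s: "\<sigma> = s" using \<sigma> s by auto
    have "sgn (cos (pi * y)) = \<sigma>" if "x - d < y" "y < x" for y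
    proof -
      have "0 < sin (pi * (x - y))" using that d by (intro sin_gt_zero) auto
      moreover have "sin (pi * (y - x)) = - sin (pi * (x - y))"
        by (simp add: algebra_simps flip: sin_minus)
      ultimately have "sin (pi * (y - x)) < 0" by simp
      then show ?thesis unfolding c \<sigma>s using s by (auto simp: sgn_mult)
    qed
    then show ?thesis using that[of "x - d" x] d e by auto
  qed
qed

lemma isCont_positive_nearby:
  fixes h :: "real \<Rightarrow> real"
  assumes "isCont h x" "0 < h x"
  obtains e where "0 < e" "\<And>y. \<bar>y - x\<bar> < e \<Longrightarrow> 0 < h y"
proof -
  obtain e where "0 < e" "\<And>y. dist y x < e \<Longrightarrow> dist (h y) (h x) < h x"
    using assms unfolding continuous_at_eps_delta by blast
  then show ?thesis using that[of e] by (fastforce simp: dist_real_def)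
qed

text \<open>Continuity extends the sign condition to every point of continuity of \<open>g\<close>. At a half-integer it holds with
  both signs, which forces equality.\<close>

lemma interpolation_and_sign_from_AE:
  assumes hol: "H holomorphic_on UNIV" and g: "continuous_on (- {0}) g"
    and AE: "AE x in lborel. Im (H (of_real x)) = 0 \<and> 0 \<le> sgn (cos (pi * x)) * (g x - Re (H (of_real x)))"
  shows "interpolates g H" "x \<noteq> 0 \<or> isCont g 0 \<Longrightarrow> sign_condition_at g H x"
proof -
  have cH: "continuous_on UNIV (\<lambda>x. H (of_real x))" by (rule continuous_on_entire_of_real[OF hol])
  have "complex_of_real (Im (H (of_real x))) = 0" for x
    by (rule continuous_AE_eq[where g = "\<lambda>_. 0"]) (use AE in \<open>auto intro!: continuous_intros cH\<close>)
  then have im: "Im (H (of_real x)) = 0" for x by simp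
  let ?h = "\<lambda>x. g x - Re (H (of_real x))"
  have g_cont: "isCont g x" if "x \<noteq> 0" for x
    using g that continuous_on_eq_continuous_at[of "- {0}" g] by (simp add: open_Compl)
  have h_cont: "isCont ?h x" if "isCont g x" for x
    using cH that by (intro continuous_intros) (simp_all add: continuous_on_eq_continuous_at)
  have sign: "0 \<le> \<sigma> * ?h x"
    if gx: "isCont g x" and near: "\<And>e. 0 < e \<Longrightarrow> \<exists>a b. a < b \<and> x - e \<le> a \<and> b \<le> x + e \<and> (\<forall>y. a < y \<longrightarrow> y < b \<longrightarrow> sgn (cos (pi * y)) = \<sigma>)"
    for x \<sigma>
  proof (rule ccontr)
    assume "\<not> 0 \<le> \<sigma> * ?h x"
    then have "0 < - \<sigma> * ?h x" by simp
    moreover have "isCont (\<lambda>x. - \<sigma> * ?h x) x" by (intro continuous_intros h_cont[OF gx])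
    ultimately obtain e where e: "0 < e" "\<And>y. \<bar>y - x\<bar> < e \<Longrightarrow> 0 < - \<sigma> * ?h y"
      using isCont_positive_nearby[of x "\<lambda>x. - \<sigma> * ?h x"] by blast
    obtain a b where ab: "a < b" "x - e \<le> a" "b \<le> x + e" "\<And>y. a < y \<Longrightarrow> y < b \<Longrightarrow> sgn (cos (pi * y)) = \<sigma>"
      using near[OF e(1)] by blast
    obtain y where y: "a < y" "y < b" "0 \<le> sgn (cos (pi * y)) * ?h y"
      using AE_lborel_dense[OF AE ab(1)] by blast
    have "\<bar>y - x\<bar> < e" using y ab by linarith
    then show False using e(2)[of y] y ab(4) by force
  qed
  show "interpolates g H"
    unfolding interpolates_def
  proof
    fix n :: int
    let ?x = "of_int n + 1/2 :: real"
    have "?x \<noteq> 0"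
    proof
      assume "?x = 0"
      then have "real_of_int (2 * n + 1) = of_int 0" by simp
      then have "2 * n + 1 = 0" unfolding of_int_eq_iff .
      then show False by presburger
    qed
    then have c: "isCont g ?x" by (rule g_cont)
    have "0 \<le> 1 * ?h ?x"
      by (rule sign[OF c]) (metis sgn_cos_near_half_integer)
    moreover have "0 \<le> - 1 * ?h ?x"
      by (rule sign[OF c]) (metis sgn_cos_near_half_integer)
    moreover have "0 \<le> 1 * d \<Longrightarrow> 0 \<le> - 1 * d \<Longrightarrow> d = 0" for d :: real by simp
    ultimately have "?h ?x = 0" by blast
    then have "Re (H (of_real ?x)) = g ?x" by (simp only: right_minus_eq)
    then show "H (of_real ?x) = of_real (g ?x)" using im by (simp only: complex_eq_iff Re_complex_of_real Im_complex_of_real)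
  qed
  show "sign_condition_at g H x" if "x \<noteq> 0 \<or> isCont g 0"
  proof -
    have c: "isCont g x" using that g_cont by (cases "x = 0") auto
    have "0 \<le> sgn (cos (pi * x)) * ?h x"
    proof (cases "cos (pi * x) = 0")
      case False
      define \<sigma> where "\<sigma> = sgn (cos (pi * x))"
      have s1: "\<sigma> = 1 \<or> \<sigma> = -1" using False by (auto simp: \<sigma>_def sgn_if)
      have "isCont (\<lambda>y. \<sigma> * cos (pi * y)) x" by (intro continuous_intros)
      moreover have "0 < \<sigma> * cos (pi * x)" using False by (auto simp: \<sigma>_def sgn_if)
      ultimately obtain d where d: "0 < d" "\<And>y. \<bar>y - x\<bar> < d \<Longrightarrow> 0 < \<sigma> * cos (pi * y)"
        using isCont_positive_nearby[of x "\<lambda>y. \<sigma> * cos (pi * y)"] by blast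
      have "0 \<le> \<sigma> * ?h x"
      proof (rule sign[OF c])
        fix e :: real assume "0 < e"
        have "sgn (cos (pi * y)) = \<sigma>" if "x - min d e < y" "y < x + min d e" for y
        proof -
          have "0 < \<sigma> * cos (pi * y)" by (rule d(2)) (use that in linarith)
          then show ?thesis using s1 by auto
        qed
        then show "\<exists>a b. a < b \<and> x - e \<le> a \<and> b \<le> x + e \<and> (\<forall>y. a < y \<longrightarrow> y < b \<longrightarrow> sgn (cos (pi * y)) = \<sigma>)"
          using d(1) \<open>0 < e\<close> by (intro exI[of _ "x - min d e"] exI[of _ "x + min d e"]) auto
      qed
      then show ?thesis by (simp add: \<sigma>_def)
    qed simp
    then show ?thesis using im by (simp add: sign_condition_at_def complex_is_Real_iff)
  qed
qed

text \<open>The situation after the construction: \<open>k\<close> is of exponential type \<open>pi\<close> and leaves the remainder \<open>p\<close>, which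
  has the sign of \<open>cos (pi x)\<close>.\<close>

locale signed_remainder =
  fixes g p :: "real \<Rightarrow> real" and k :: "complex \<Rightarrow> complex"
  assumes g: "continuous_on (- {0}) g"
    and p: "integrable lborel p" and p_sign: "\<And>x. 0 \<le> sgn (cos (pi * x)) * p x"
    and k: "exponential_type pi k" and k_AE: "AE x in lborel. k (of_real x) = of_real (g x - p x)"
begin

abbreviation s :: "real \<Rightarrow> real" where "s x \<equiv> sgn (cos (pi * x))"

lemma g_measurable: "g \<in> borel_measurable borel"
  by (rule borel_measurable_continuous_countable_exceptions[OF _ g]) simp

lemma exponential_type_measurable: "exponential_type pi H \<Longrightarrow> (\<lambda>x. H (of_real x)) \<in> borel_measurable borel"
  by (intro borel_measurable_continuous_onI continuous_on_entire_of_real) (simp add: exponential_type_def)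

lemma L1_dist_k: "L1_dist g k = ennreal (\<integral>x. \<bar>p x\<bar> \<partial>lborel)"
proof -
  have "L1_dist g k = (\<integral>\<^sup>+x. ennreal \<bar>p x\<bar> \<partial>lborel)"
    unfolding L1_dist_def
    by (rule nn_integral_cong_AE) (use k_AE in \<open>eventually_elim, simp flip: of_real_diff\<close>)
  then show ?thesis using p by (simp add: nn_integral_eq_integral)
qed

text \<open>The difference \<open>k - H\<close> is integrable of exponential type \<open>pi\<close>, hence orthogonal to \<open>s\<close>, so \<open>H\<close> may be
  replaced by \<open>k\<close> in the integral.\<close>

lemma signed_integral:
  assumes H: "exponential_type pi H" and fin: "L1_dist g H < \<infinity>"
  shows "integrable lborel (\<lambda>x. of_real (g x) - H (of_real x))"
    and "(\<integral>x. (of_real (g x) - H (of_real x)) * of_real (s x) \<partial>lborel) = of_real (\<integral>x. \<bar>p x\<bar> \<partial>lborel)"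
    and "L1_dist g H = ennreal (\<integral>x. cmod (of_real (g x) - H (of_real x)) \<partial>lborel)"
proof -
  note [measurable] = g_measurable exponential_type_measurable[OF H] exponential_type_measurable[OF k]
  have i0: "integrable lborel (\<lambda>x. H (of_real x) - of_real (g x))"
    using fin unfolding L1_dist_def by (intro integrableI_bounded) auto
  from Bochner_Integration.integrable_minus[OF this]
  show i: "integrable lborel (\<lambda>x. of_real (g x) - H (of_real x))" by simp
  show "L1_dist g H = ennreal (\<integral>x. cmod (of_real (g x) - H (of_real x)) \<partial>lborel)"
    unfolding L1_dist_def
    using nn_integral_eq_integral[OF integrable_norm[OF i0]] by (simp add: norm_minus_commute)
  let ?w = "\<lambda>z. k z - H z"
  have w: "exponential_type pi ?w" by (rule exponential_type_diff[OF k H])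
  have d: "AE x in lborel. of_real (g x) - H (of_real x) - of_real (p x) = ?w (of_real x)"
    using k_AE by eventually_elim simp
  have iw: "integrable lborel (\<lambda>x. ?w (of_real x))"
    by (rule integrable_cong_AE_imp[OF Bochner_Integration.integrable_diff[OF i integrable_of_real[OF p]]])
       (use d in \<open>auto elim: eventually_mono\<close>)
  have s_mult: "integrable lborel (\<lambda>x. f x * of_real (s x))" if "integrable lborel f" for f :: "real \<Rightarrow> complex"
    by (rule Bochner_Integration.integrable_bound[OF that])
       (use borel_measurable_integrable[OF that] in \<open>auto simp: norm_mult abs_sgn_eq\<close>)
  have "(\<integral>x. ?w (of_real x) * of_real (s x) \<partial>lborel) = 0"
  proof (rule integral_sgn_cos_eq_0[OF iw])
    fix n :: nat assume "odd n"
    then have "1 \<le> real n" by (cases n) auto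
    then show "fourier (\<lambda>x. ?w (of_real x)) (n / 2) = 0" "fourier (\<lambda>x. ?w (of_real x)) (- (n / 2)) = 0"
      using fourier_exponential_type_eq_0[OF w _ iw] by (simp_all add: field_simps)
  qed
  moreover have "(\<integral>x. (of_real (g x) - H (of_real x)) * of_real (s x) \<partial>lborel)
      = (\<integral>x. ?w (of_real x) * of_real (s x) + of_real \<bar>p x\<bar> \<partial>lborel)"
  proof (rule integral_cong_AE)
    show "AE x in lborel. (of_real (g x) - H (of_real x)) * of_real (s x) = ?w (of_real x) * of_real (s x) + of_real \<bar>p x\<bar>"
      using d AE_cos_pi_nonzero
    proof eventually_elim
      case (elim x)
      have "\<bar>p x\<bar> = s x * p x"
        using elim(2) p_sign[of x] by (auto simp: sgn_if split: if_splits)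
      then show ?case using elim(1) by (simp add: algebra_simps)
    qed
  qed (use borel_measurable_integrable[OF p] in measurable)
  moreover have "(\<integral>x. ?w (of_real x) * of_real (s x) + of_real \<bar>p x\<bar> \<partial>lborel)
      = (\<integral>x. ?w (of_real x) * of_real (s x) \<partial>lborel) + (\<integral>x. of_real \<bar>p x\<bar> \<partial>lborel)"
    using p by (intro Bochner_Integration.integral_add s_mult iw integrable_of_real) auto
  ultimately show "(\<integral>x. (of_real (g x) - H (of_real x)) * of_real (s x) \<partial>lborel) = of_real (\<integral>x. \<bar>p x\<bar> \<partial>lborel)"
    by simp
qed

lemma best_approximation_k: "best_approximation g k"
  unfolding best_approximation_def
proof (intro conjI allI impI k)
  fix H assume H: "exponential_type pi H"
  show "L1_dist g k \<le> L1_dist g H"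
  proof (cases "L1_dist g H < \<infinity>")
    case True
    note S = signed_integral[OF H True]
    have "(\<integral>x. \<bar>p x\<bar> \<partial>lborel) = cmod (\<integral>x. (of_real (g x) - H (of_real x)) * of_real (s x) \<partial>lborel)"
      unfolding S(2) by simp
    also have "\<dots> \<le> (\<integral>x. cmod ((of_real (g x) - H (of_real x)) * of_real (s x)) \<partial>lborel)"
      by (rule integral_norm_bound)
    also have "\<dots> = (\<integral>x. cmod (of_real (g x) - H (of_real x)) \<partial>lborel)"
    proof (rule integral_cong_AE)
      show "AE x in lborel. cmod ((of_real (g x) - H (of_real x)) * of_real (s x)) = cmod (of_real (g x) - H (of_real x))"
        using AE_cos_pi_nonzero by eventually_elim (simp add: norm_mult abs_sgn_eq)
    qed (use borel_measurable_integrable[OF S(1)] in measurable)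
    finally show ?thesis unfolding L1_dist_k S(3) by (rule ennreal_leI)
  next
    case False
    then have "L1_dist g H = \<top>" by (simp add: not_less top_unique)
    then show ?thesis by simp
  qed
qed

text \<open>Optimality forces equality in \<open>Re ((g - H) s) \<le> |g - H|\<close> almost everywhere, that is, \<open>g - H\<close> is real and has
  the sign of \<open>s\<close>.\<close>

lemma interpolation_and_sign_of_best:
  assumes H: "best_approximation g H"
  shows "interpolates g H" "x \<noteq> 0 \<or> isCont g 0 \<Longrightarrow> sign_condition_at g H x"
proof -
  have tH: "exponential_type pi H" and le: "L1_dist g H \<le> L1_dist g k"
    using H k by (auto simp: best_approximation_def)
  have fin: "L1_dist g H < \<infinity>" using le unfolding L1_dist_k by (rule order.strict_trans1) simp
  note S = signed_integral[OF tH fin]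
  let ?d = "\<lambda>x. of_real (g x) - H (of_real x)"
  note [measurable] = borel_measurable_integrable[OF S(1)]
  have ids: "integrable lborel (\<lambda>x. ?d x * of_real (s x))"
    by (rule Bochner_Integration.integrable_bound[OF S(1)]) (auto simp: norm_mult abs_sgn_eq)
  have nonneg: "0 \<le> cmod (?d x) - Re (?d x * of_real (s x))" for x
  proof -
    have "Re (?d x * of_real (s x)) \<le> cmod (?d x * of_real (s x))" by (rule complex_Re_le_cmod)
    also have "\<dots> \<le> cmod (?d x)" by (simp add: norm_mult abs_sgn_eq)
    finally show ?thesis by simp
  qed
  have "(\<integral>x. cmod (?d x) \<partial>lborel) \<le> (\<integral>x. \<bar>p x\<bar> \<partial>lborel)"
    using le unfolding S(3) L1_dist_k by (subst (asm) ennreal_le_iff) auto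
  moreover have "(\<integral>x. Re (?d x * of_real (s x)) \<partial>lborel) = (\<integral>x. \<bar>p x\<bar> \<partial>lborel)"
    unfolding integral_Re[OF ids] S(2) by simp
  ultimately have "(\<integral>x. cmod (?d x) - Re (?d x * of_real (s x)) \<partial>lborel) \<le> 0"
    unfolding Bochner_Integration.integral_diff[OF integrable_norm[OF S(1)] integrable_Re[OF ids]] by linarith
  moreover have i: "integrable lborel (\<lambda>x. cmod (?d x) - Re (?d x * of_real (s x)))"
    by (intro Bochner_Integration.integrable_diff integrable_norm S(1) integrable_Re[OF ids])
  ultimately have "(\<integral>x. cmod (?d x) - Re (?d x * of_real (s x)) \<partial>lborel) = 0"
    using integral_nonneg_AE[of "\<lambda>x. cmod (?d x) - Re (?d x * of_real (s x))" lborel] nonneg by fastforce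
  then have "AE x in lborel. cmod (?d x) - Re (?d x * of_real (s x)) = 0"
    using integral_nonneg_eq_0_iff_AE[OF i] nonneg by auto
  then have AE: "AE x in lborel. Im (H (of_real x)) = 0 \<and> 0 \<le> s x * (g x - Re (H (of_real x)))"
    using AE_cos_pi_nonzero
  proof eventually_elim
    case (elim x)
    have s1: "s x = 1 \<or> s x = -1" using elim(2) by (auto simp: sgn_if)
    have e: "cmod (?d x) = s x * Re (?d x)" using elim(1) by simp
    have "(s x)\<^sup>2 = 1" using s1 by auto
    then have "(cmod (?d x))\<^sup>2 = (Re (?d x))\<^sup>2" unfolding e power_mult_distrib by simp
    then have "Im (?d x) = 0" unfolding cmod_power2 by simp
    then show ?case using e norm_ge_zero[of "?d x"] by simp
  qed
  have hol: "H holomorphic_on UNIV" using tH by (simp add: exponential_type_def)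
  show "interpolates g H" "x \<noteq> 0 \<or> isCont g 0 \<Longrightarrow> sign_condition_at g H x"
    using interpolation_and_sign_from_AE[OF hol g AE] by auto
qed

lemma best_approximation_unique:
  assumes H: "best_approximation g H"
  shows "H = k"
proof
  fix z
  have tH: "exponential_type pi H" and le: "L1_dist g H \<le> L1_dist g k"
    using H k by (auto simp: best_approximation_def)
  have fin: "L1_dist g H < \<infinity>" "L1_dist g k < \<infinity>"
    using le unfolding L1_dist_k by (auto intro: order.strict_trans1)
  have "integrable lborel (\<lambda>x. (of_real (g x) - k (of_real x)) - (of_real (g x) - H (of_real x)))"
    by (intro Bochner_Integration.integrable_diff signed_integral tH k fin)
  then have "integrable lborel (\<lambda>x. H (of_real x) - k (of_real x))" by simp
  moreover have "H (of_real (of_int n + 1/2)) - k (of_real (of_int n + 1/2)) = 0" for n :: int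
    using interpolation_and_sign_of_best(1)[OF H] interpolation_and_sign_of_best(1)[OF best_approximation_k]
    unfolding interpolates_def by (simp only: diff_self)
  ultimately have "H z - k z = 0"
    by (rule exponential_type_determined_at_half_integers[OF exponential_type_diff[OF tH k]])
  then show "H z = k z" by simp
qed

end

theorem theorem16:
  fixes I :: "real set"
    and G :: "real \<Rightarrow> real \<Rightarrow> real"
    and K :: "real \<Rightarrow> complex \<Rightarrow> complex"
    and \<nu> :: "real measure"
    and g :: "real \<Rightarrow> real"
  assumes family: "best_approximation_family I G"
    and K: "\<And>l. l \<in> I \<Longrightarrow> family_approximation (G l) (K l)"
    and borel: "sets \<nu> = sets (restrict_space borel I)"
    and measurable: "\<And>t. \<bar>t\<bar> > 1/2 \<Longrightarrow> (\<lambda>l. fourier_family G l t) \<in> borel_measurable \<nu>"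
    and finite: "(\<integral>\<^sup>+l. L1_dist (G l) (K l) \<partial>\<nu>) < \<infinity>"
    and tempered: "defines_tempered_distribution g"
    and cont: "continuous_on (- {0}) g"
    and transform: "\<And>\<phi>. schwartz \<phi> \<Longrightarrow> support \<phi> \<subseteq> - {- 1/2..1/2} \<Longrightarrow>
          fourier_distribution (distribution_of g) \<phi> =
            (\<integral>t. (\<integral>l. fourier_family G l t \<partial>\<nu>) * \<phi> t \<partial>lborel)"
  shows "(\<exists>!k. best_approximation g k) \<and>
         (\<forall>k. best_approximation g k \<longrightarrow>
            interpolates g k \<and>
            (\<forall>x. x \<noteq> 0 \<or> isCont g 0 \<longrightarrow> sign_condition_at g k x) \<and>
            L1_dist g k = (\<integral>\<^sup>+l. L1_dist (G l) (K l) \<partial>\<nu>))"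
proof -
  interpret fam: approximation_family I G K \<nu>
    by unfold_locales (fact family K borel measurable finite)+
  interpret spec: spectrally_supported g fam.superposition
  proof
    fix \<phi> :: "real \<Rightarrow> complex" assume \<phi>: "schwartz \<phi>" "support \<phi> \<subseteq> - {- 1/2..1/2}"
    show "distribution_of g (fourier \<phi>) = (\<integral>x. of_real (fam.superposition x) * fourier \<phi> x \<partial>lborel)"
      using transform[OF \<phi>] fam.superposition_transform[OF \<phi>] by (simp add: fourier_distribution_def)
  qed (fact tempered fam.integrable_superposition)+
  interpret best: signed_remainder g fam.superposition spec.extension
    by unfold_locales (fact cont fam.integrable_superposition fam.superposition_sign
        spec.exponential_type_extension spec.extension_AE)+
  have "L1_dist g spec.extension = (\<integral>\<^sup>+l. L1_dist (G l) (K l) \<partial>\<nu>)"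
    unfolding best.L1_dist_k by (rule fam.integral_abs_superposition)
  then show ?thesis
    using best.best_approximation_k best.best_approximation_unique best.interpolation_and_sign_of_best
    by metis
qed

end
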